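(* Let $$\mathcal{A}=\begin{bmatrix}\epsilon A_1+A_0 & -\frac{\alpha\epsilon}{\mu}B^T\\ -\frac{\alpha\epsilon}{\mu}B & -\frac{\epsilon}{\mu}D\end{bmatrix},\qquad \mathcal{P}_d=\begin{bmatrix}\epsilon A_1+A_0 & 0\\ 0 & \hat S\end{bmatrix},\qquad \hat S=\frac{\epsilon}{\mu}D.$$ Let $\mathbf{r}_j$ denote the residual after $j$ steps of MINRES applied to the preconditioned system $\mathcal{P}_d^{-1}\mathcal{A}$ (understood as the equivalent symmetric system with matrix $\mathcal{P}_d^{-1/2}\mathcal{A}\mathcal{P}_d^{-1/2}$, with $\|\cdot\|$ the Euclidean norm of its residual and $\mathbf r_0\neq0$). Then $$\frac{\|\mathbf{r}_{2k}\|}{\|\mathbf{r}_0\|}\le 2\left(\frac{\sqrt{1+\frac{1}{c_0}\frac{\alpha^2d}{\mu}}-1}{\sqrt{1+\frac{1}{c_0}\frac{\alpha^2d}{\mu}}+1}\right)^k.$$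
   Context: $\Omega\subset\mathbb{R}^d$ ($d\ge1$) is a bounded domain with Lipschitz boundary, $\mathcal{T}_h$ a quasi-uniform simplicial mesh of $\Omega$ with $N$ elements $K_1,\dots,K_N$. Constants: Lamé constants $\lambda,\mu>0$, $\epsilon=\mu/(\lambda+\mu)$, Biot–Willis constant $\alpha>0$, storage capacity $c_0>0$, permeability $\kappa>0$, time step $\Delta t>0$. Discrete spaces: $\mathbf{V}_h^0$ (displacement) is the space of $\mathbf{u}_h=\{\mathbf{u}_h^\circ,\mathbf{u}_h^\partial\}$ with $\mathbf{u}_h^\circ$ a constant vector in $\mathbb{R}^d$ on each element interior, $\mathbf{u}_h^\partial$ a constant vector in $\mathbb{R}^d$ on each facet (single-valued), vanishing on facets on $\partial\Omega$. $W_h^0$ (pressure) is the analogous scalar space of $p_h=\{p_h^\circ,p_h^\partial\}$; vectors of degrees of freedom list element-interior values first, then facet values. For scalar weak functions, $\nabla_w u_h|_K\in RT_0(K)=(P_0(K))^d+\mathbf{x}P_0(K)$ satisfies $(\nabla_w u_h,\mathbf{v})_K=(u_h^\partial,\mathbf{v}\cdot\mathbf{n})_{\partial K}-(u_h^\circ,\nabla\cdot\mathbf{v})_K$ for all $\mathbf{v}\in RT_0(K)$ and all $K$; for vector-valued functions $\nabla_w$ acts on each component (rows of a matrix). The weak divergence is $\nabla_w\cdot\mathbf{u}_h|_K=\frac{1}{|K|}\int_{\partial K}\mathbf{u}_h^\partial\cdot\mathbf{n}$. Matrices (with $\mathbf{u}_h,\mathbf{v}_h\in\mathbf{V}_h^0$,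 $p_h,q_h\in W_h^0$): $\mathbf{v}_h^TA_1\mathbf{u}_h=\sum_K(\nabla_w\mathbf{u}_h,\nabla_w\mathbf{v}_h)_K$ (symmetric positive definite); $\mathbf{v}_h^TA_0\mathbf{u}_h=\sum_K(\nabla_w\cdot\mathbf{u}_h,\nabla_w\cdot\mathbf{v}_h)_K$; $\mathbf{q}_h^TB\mathbf{u}_h=\sum_K(\nabla_w\cdot\mathbf{u}_h,q_h^\circ)_K$; $\mathbf{q}_h^TD\mathbf{p}_h=c_0\sum_K(p_h^\circ,q_h^\circ)_K+\Delta t\sum_K(\kappa\nabla_wp_h,\nabla_wq_h)_K$. *)

theory Defs
  imports "HOL-Analysis.Analysis" "Jordan_Normal_Form.Matrix"
begin

text \<open>Points of the domain live in \<^typ>\<open>real ^ 'n\<close>; vectors of degrees of freedom and system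
  matrices are those of \<^theory>\<open>Jordan_Normal_Form.Matrix\<close>. The infix symbols that the two libraries
  share are kept for HOL-Analysis.\<close>

no_notation vec_index (infixl \<open>$\<close> 100)
no_notation scalar_prod (infix \<open>\<bullet>\<close> 70)


section \<open>Domain and mesh\<close>

text \<open>Near each boundary point the domain is the strict epigraph of a Lipschitz function, in the
  direction of a unit vector \<open>e\<close> and over the hyperplane orthogonal to \<open>e\<close>.\<close>

definition lipschitz_boundary :: "(real ^ 'n) set \<Rightarrow> bool" where
  "lipschitz_boundary \<Omega> \<longleftrightarrow>
     (\<forall>x\<in>frontier \<Omega>. \<exists>r>0. \<exists>e \<gamma> L. norm e = 1 \<and> L-lipschitz_on {y. e \<bullet> y = 0} \<gamma> \<and>
        \<Omega> \<inter> ball x r = {y \<in> ball x r. \<gamma> (y - (e \<bullet> y) *\<^sub>R e) < e \<bullet> y})"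

definition lipschitz_domain :: "(real ^ 'n) set \<Rightarrow> bool" where
  "lipschitz_domain \<Omega> \<longleftrightarrow>
     open \<Omega> \<and> connected \<Omega> \<and> \<Omega> \<noteq> {} \<and> bounded \<Omega> \<and> lipschitz_boundary \<Omega>"

definition simplicial_mesh :: "(real ^ 'n) set \<Rightarrow> (real ^ 'n) set set \<Rightarrow> bool" where
  "simplicial_mesh \<Omega> T \<longleftrightarrow>
     triangulation T \<and> (\<forall>K\<in>T. int CARD('n) simplex K) \<and> \<Union>T = closure \<Omega>"

definition inball_diameter :: "(real ^ 'n) set \<Rightarrow> real" where
  "inball_diameter K = 2 * Sup {r. 0 \<le> r \<and> (\<exists>x. cball x r \<subseteq> K)}"

text \<open>A family of meshes is quasi-uniform if all its members satisfy the following condition with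
  one and the same constant \<open>\<sigma>\<close>.\<close>

definition quasi_uniform :: "real \<Rightarrow> (real ^ 'n) set set \<Rightarrow> bool" where
  "quasi_uniform \<sigma> T \<longleftrightarrow>
     (\<forall>K\<in>T. diameter K \<le> \<sigma> * inball_diameter K) \<and>
     (\<forall>K\<in>T. \<forall>K'\<in>T. diameter K' \<le> \<sigma> * diameter K)"

definition mesh_facets :: "(real ^ 'n) set set \<Rightarrow> (real ^ 'n) set set" where
  "mesh_facets T = {F. \<exists>K\<in>T. F facet_of K}"

definition interior_facets :: "(real ^ 'n) set \<Rightarrow> (real ^ 'n) set set \<Rightarrow> (real ^ 'n) set set" where
  "interior_facets \<Omega> T = {F \<in> mesh_facets T. \<not> F \<subseteq> frontier \<Omega>}"


section \<open>Integrals over elements and their boundaries\<close>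

definition L2_inner :: "(real ^ 'n) set \<Rightarrow> (real ^ 'n \<Rightarrow> 'b::real_inner) \<Rightarrow> (real ^ 'n \<Rightarrow> 'b) \<Rightarrow> real"
  where "L2_inner K f g = (LINT x:K|lebesgue. f x \<bullet> g x)"

definition outward_normal :: "(real ^ 'n) set \<Rightarrow> (real ^ 'n) set \<Rightarrow> real ^ 'n" where
  "outward_normal K F = (THE \<nu>. norm \<nu> = 1 \<and> (\<forall>x\<in>K. \<forall>y\<in>F. \<nu> \<bullet> x \<le> \<nu> \<bullet> y))"

text \<open>Integral with respect to surface measure over a closed convex subset \<open>F\<close> of a hyperplane with
  unit normal \<open>\<nu>\<close>. By Fubini it is the volume integral over the right prism of height 1 on \<open>F\<close> of the
  function extended constantly along \<open>\<nu>\<close>; for points of that prism, \<open>closest_point F\<close> is the foot of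
  the perpendicular. In dimension 1, \<open>F\<close> is a point and the integral is evaluation there.\<close>

definition surface_integral ::
    "real ^ 'n \<Rightarrow> (real ^ 'n) set \<Rightarrow> (real ^ 'n \<Rightarrow> real) \<Rightarrow> real" where
  "surface_integral \<nu> F f =
     (LINT y:{x + t *\<^sub>R \<nu> | x t. x \<in> F \<and> 0 \<le> t \<and> t \<le> 1}|lebesgue. f (closest_point F y))"

text \<open>The integrand may depend on the facet and on the outward normal.\<close>

definition boundary_integral ::
    "(real ^ 'n) set \<Rightarrow> ((real ^ 'n) set \<Rightarrow> real ^ 'n \<Rightarrow> real ^ 'n \<Rightarrow> real) \<Rightarrow> real" where
  "boundary_integral K f =
     (\<Sum>F | F facet_of K. surface_integral (outward_normal K F) F (f F (outward_normal K F)))"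

definition divergence :: "(real ^ 'n \<Rightarrow> real ^ 'n) \<Rightarrow> real ^ 'n \<Rightarrow> real" where
  "divergence v x = trace (jacobian v (at x))"


section \<open>Weak functions and weak differential operators\<close>

text \<open>A weak function \<open>(u\<^sup>o, u\<^sup>b)\<close> assigns a constant to each element interior and a constant to each
  facet.\<close>

type_synonym ('n, 'b) weak_fun = "((real ^ 'n) set \<Rightarrow> 'b) \<times> ((real ^ 'n) set \<Rightarrow> 'b)"

text \<open>Values at sets that are not elements (resp. facets) carry no information and are set to 0, so
  the second condition also contains the boundary condition on the facets in \<open>frontier \<Omega>\<close>.\<close>

definition weak_space0 :: "(real ^ 'n) set \<Rightarrow> (real ^ 'n) set set \<Rightarrow> ('n, 'b::zero) weak_fun set" where
  "weak_space0 \<Omega> T =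
     {u. (\<forall>K. K \<notin> T \<longrightarrow> fst u K = 0) \<and> (\<forall>F. F \<notin> interior_facets \<Omega> T \<longrightarrow> snd u F = 0)}"

definition RT0 :: "(real ^ 'n \<Rightarrow> real ^ 'n) set" where
  "RT0 = {\<lambda>x. a + b *\<^sub>R x | a b. True}"

definition weak_grad :: "(real ^ 'n) set \<Rightarrow> ('n, real) weak_fun \<Rightarrow> real ^ 'n \<Rightarrow> real ^ 'n" where
  "weak_grad K u = (THE g. g \<in> RT0 \<and>
     (\<forall>v\<in>RT0. L2_inner K g v =
        boundary_integral K (\<lambda>F \<nu> x. snd u F * (v x \<bullet> \<nu>)) - L2_inner K (\<lambda>x. fst u K) (divergence v)))"

definition weak_component :: "'n \<Rightarrow> ('n, real ^ 'n) weak_fun \<Rightarrow> ('n, real) weak_fun" where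
  "weak_component i u = (\<lambda>K. fst u K $ i, \<lambda>F. snd u F $ i)"

text \<open>Row \<open>i\<close> is the weak gradient of component \<open>i\<close>; the inner product of \<^typ>\<open>real ^ 'n ^ 'n\<close> is the
  Frobenius inner product.\<close>

definition weak_grad_vec ::
    "(real ^ 'n) set \<Rightarrow> ('n, real ^ 'n) weak_fun \<Rightarrow> real ^ 'n \<Rightarrow> real ^ 'n ^ 'n" where
  "weak_grad_vec K u x = (\<chi> i. weak_grad K (weak_component i u) x)"

definition weak_div :: "(real ^ 'n) set \<Rightarrow> ('n, real ^ 'n) weak_fun \<Rightarrow> real" where
  "weak_div K u = 1 / measure lebesgue K * boundary_integral K (\<lambda>F \<nu> x. snd u F \<bullet> \<nu>)"


section \<open>Vectors of degrees of freedom\<close>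

text \<open>\<open>Ks\<close>, \<open>Fs\<close>, \<open>cs\<close> enumerate the elements, the interior facets and the coordinate directions.\<close>

definition scalar_dofs ::
    "(real ^ 'n) set list \<Rightarrow> (real ^ 'n) set list \<Rightarrow> ('n, real) weak_fun \<Rightarrow> real Matrix.vec" where
  "scalar_dofs Ks Fs p = vec_of_list ([fst p K. K \<leftarrow> Ks] @ [snd p F. F \<leftarrow> Fs])"

definition vector_dofs ::
    "'n list \<Rightarrow> (real ^ 'n) set list \<Rightarrow> (real ^ 'n) set list \<Rightarrow> ('n, real ^ 'n) weak_fun
      \<Rightarrow> real Matrix.vec" where
  "vector_dofs cs Ks Fs u =
     vec_of_list ([fst u K $ c. K \<leftarrow> Ks, c \<leftarrow> cs] @ [snd u F $ c. F \<leftarrow> Fs, c \<leftarrow> cs])"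


section \<open>Inverse square roots and MINRES\<close>

definition eucl_norm :: "real Matrix.vec \<Rightarrow> real" where
  "eucl_norm v = sqrt (scalar_prod v v)"

definition sym_pos_def :: "real Matrix.mat \<Rightarrow> bool" where
  "sym_pos_def A \<longleftrightarrow> square_mat A \<and> transpose_mat A = A \<and>
     (\<forall>v\<in>carrier_vec (dim_row A). v \<noteq> 0\<^sub>v (dim_row A) \<longrightarrow> 0 < scalar_prod v (A *\<^sub>v v))"

text \<open>The matrix \<open>P\<^sup>-\<^sup>1\<^sup>/\<^sup>2\<close>. For symmetric positive definite \<open>P\<close> there is exactly one such \<open>R\<close>.\<close>

definition inv_sqrt_mat :: "real Matrix.mat \<Rightarrow> real Matrix.mat" where
  "inv_sqrt_mat P = (SOME R. R \<in> carrier_mat (dim_row P) (dim_row P) \<and> sym_pos_def R \<and>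
     inverts_mat (R * R) P \<and> inverts_mat P (R * R))"

definition krylov :: "real Matrix.mat \<Rightarrow> real Matrix.vec \<Rightarrow> nat \<Rightarrow> real Matrix.vec set" where
  "krylov A r j =
     {finsum_vec TYPE(real) (dim_vec r) (\<lambda>i. c i \<cdot>\<^sub>v (A ^\<^sub>m i *\<^sub>v r)) {..<j} | c. True}"

text \<open>The \<open>j\<close>-th MINRES iterate for \<open>A x = b\<close> with initial guess \<open>x0\<close> minimises the residual norm
  over \<open>x0\<close> plus the \<open>j\<close>-th Krylov space of the initial residual.\<close>

definition minres_iterate ::
    "real Matrix.mat \<Rightarrow> real Matrix.vec \<Rightarrow> real Matrix.vec \<Rightarrow> nat \<Rightarrow> real Matrix.vec \<Rightarrow> bool" where
  "minres_iterate A b x0 j x \<longleftrightarrow>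
     (\<exists>z \<in> krylov A (b - A *\<^sub>v x0) j. x = x0 + z) \<and>
     (\<forall>z \<in> krylov A (b - A *\<^sub>v x0) j. eucl_norm (b - A *\<^sub>v x) \<le> eucl_norm (b - A *\<^sub>v (x0 + z)))"

definition minres_residual ::
    "real Matrix.mat \<Rightarrow> real Matrix.vec \<Rightarrow> real Matrix.vec \<Rightarrow> nat \<Rightarrow> real Matrix.vec \<Rightarrow> bool" where
  "minres_residual A b x0 j r \<longleftrightarrow> (\<exists>x. minres_iterate A b x0 j x \<and> r = b - A *\<^sub>v x)"

end

theory Submission
  imports Defs "Jordan_Normal_Form.Determinant"
    "HOL-Computational_Algebra.Fundamental_Theorem_Algebra"
begin

no_notation vec_index (infixl \<open>$\<close> 100)
no_notation scalar_prod (infix \<open>\<bullet>\<close> 70)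

text \<open>Write \<open>H = \<epsilon> A\<^sub>1 + A\<^sub>0\<close> and \<open>\<beta> = \<alpha> \<epsilon> / \<mu>\<close>. The off-diagonal blocks of the square of the
  preconditioned operator cancel. Hence, in the energy norm of the preconditioner, the squared norm
  of the image of \<open>(u, p)\<close> is that of \<open>(u, p)\<close> plus \<open>a\<^sup>T H a + e\<^sup>T S e\<close>, where
  \<open>H a = \<beta> B\<^sup>T p\<close> and \<open>S e = - \<beta> B u\<close>. Cauchy-Schwarz, \<open>A\<^sub>0 \<le> H\<close> and the mass term of \<open>D\<close> bound
  the addition by the factor \<open>\<alpha>\<^sup>2 \<epsilon> / (\<mu> c\<^sub>0)\<close>, and \<open>\<epsilon> < 1 \<le> d\<close>. So the squared eigenvalues lie in
  \<open>[1, c]\<close> with \<open>c = 1 + \<alpha>\<^sup>2 d / (\<mu> c\<^sub>0)\<close>, and a Chebyshev polynomial of degree \<open>k\<close> in the squared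
  matrix competes with the MINRES polynomial of degree \<open>2 k\<close>.\<close>


section \<open>Polynomials of symmetric real matrices\<close>

text \<open>Two objects are given only indirectly. \<open>inv_sqrt_mat\<close> is a choice, so it
  means something only once a positive definite inverse root exists; and \<open>A1\<close> is
  specified through its form alone, so the definiteness of \<open>H\<close> must come from the mesh:
  a weak function that vanishes on the boundary facets and has zero weak gradient is zero. This is
  where the geometry of facets, normals and neighbours enters. The matrix side works without an
  eigenbasis. A polynomial in a symmetric matrix is determined by its values at the real
  eigenvalues, which are finitely many. So a function such as a root can be replaced by an
  interpolating polynomial, and inequalities between eigenvalues become identities between sums of
  squares of matrices. The rate \<open>(sqrt c - 1) / (sqrt c + 1)\<close> is \<open>1 / t\<close>
  for the number \<open>t > 1\<close> with \<open>(t + 1 / t) / 2 = (c + 1) / (c - 1)\<close>, the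
  point at which the Chebyshev polynomial is normalised. The factor 2 comes from keeping only
  \<open>t ^ k\<close> in its value \<open>(t ^ k + (1 / t) ^ k) / 2\<close> there.\<close>

definition mat_poly :: "real Matrix.mat \<Rightarrow> real poly \<Rightarrow> real Matrix.mat" where
  "mat_poly A p =
     fold_coeffs (\<lambda>a B. a \<cdot>\<^sub>m 1\<^sub>m (dim_row A) + A * B) p (0\<^sub>m (dim_row A) (dim_row A))"

lemma mat_poly_0 [simp]: "mat_poly A 0 = 0\<^sub>m (dim_row A) (dim_row A)"
  by (simp add: mat_poly_def)

lemma mat_poly_pCons:
  assumes "A \<in> carrier_mat n n"
  shows "mat_poly A (pCons a p) = a \<cdot>\<^sub>m 1\<^sub>m n + A * mat_poly A p"
\<comment> \<open>\<open>pCons 0 0\<close> is the zero polynomial, on which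
  \<open>fold_coeffs\<close> performs no step at all.\<close>
proof (cases "a = 0 \<and> p = 0")
  case True
  then show ?thesis using assms by (intro eq_matI) auto
next
  case False
  then have "fold_coeffs (\<lambda>a B. a \<cdot>\<^sub>m 1\<^sub>m (dim_row A) + A * B) (pCons a p) =
    (\<lambda>B. a \<cdot>\<^sub>m 1\<^sub>m (dim_row A) + A * B) \<circ> fold_coeffs (\<lambda>a B. a \<cdot>\<^sub>m 1\<^sub>m (dim_row A) + A * B) p"
    by (cases "p = 0") auto
  then show ?thesis using assms by (simp add: mat_poly_def)
qed

lemma mat_poly_closed [simp]:
  assumes "A \<in> carrier_mat n n"
  shows "mat_poly A p \<in> carrier_mat n n"
proof (induction p)
  case 0
  then show ?case using assms by simp
next
  case (pCons a p)
  then show ?case using assms by (simp add: mat_poly_pCons[OF assms])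
qed

lemma mat_poly_const:
  assumes "A \<in> carrier_mat n n"
  shows "mat_poly A [:c:] = c \<cdot>\<^sub>m 1\<^sub>m n"
  using assms by (intro eq_matI) (auto simp: mat_poly_pCons[OF assms])

lemma mat_poly_1:
  assumes "A \<in> carrier_mat n n"
  shows "mat_poly A 1 = 1\<^sub>m n"
  using mat_poly_const[OF assms, of 1] by (simp add: one_pCons) (auto intro!: eq_matI)

lemma mat_poly_X:
  assumes "A \<in> carrier_mat n n"
  shows "mat_poly A [:0, 1:] = A"
proof -
  have "mat_poly A [:0, 1:] = 0 \<cdot>\<^sub>m 1\<^sub>m n + A * (1 \<cdot>\<^sub>m 1\<^sub>m n)"
    by (simp only: mat_poly_pCons[OF assms, of 0] mat_poly_const[OF assms])
  also have "1 \<cdot>\<^sub>m 1\<^sub>m n = (1\<^sub>m n :: real Matrix.mat)" by (intro eq_matI) auto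
  also have "A * 1\<^sub>m n = A" using assms by simp
  also have "0 \<cdot>\<^sub>m 1\<^sub>m n + A = A" using assms by (intro eq_matI) auto
  finally show ?thesis .
qed

lemma mat_poly_add:
  assumes A: "A \<in> carrier_mat n n"
  shows "mat_poly A (p + q) = mat_poly A p + mat_poly A q"
proof (induction p q rule: poly_induct2)
  case 0
  then show ?case using A by simp
next
  case (pCons a p b q)
  have c: "mat_poly A p \<in> carrier_mat n n" for p
    using A by auto
  have "A * (mat_poly A p + mat_poly A q) = A * mat_poly A p + A * mat_poly A q"
    using mult_add_distrib_mat[OF A c c] .
  then show ?case
    unfolding add_pCons mat_poly_pCons[OF A] pCons.IH
    using A c by (intro eq_matI) (auto simp: algebra_simps carrier_matD[OF c] simp del: index_mult_mat(1))
qed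

lemma mat_poly_smult:
  assumes A: "A \<in> carrier_mat n n"
  shows "mat_poly A (Polynomial.smult c p) = c \<cdot>\<^sub>m mat_poly A p"
proof (induction p)
  case 0
  then show ?case using A by simp
next
  case (pCons a p)
  have c: "mat_poly A p \<in> carrier_mat n n" for p using A by auto
  show ?case
    unfolding smult_pCons mat_poly_pCons[OF A] pCons.IH mult_smult_distrib[OF A c]
    using A c by (intro eq_matI) (auto simp: algebra_simps carrier_matD[OF c] simp del: index_mult_mat(1))
qed

lemma mat_poly_mult:
  assumes A: "A \<in> carrier_mat n n"
  shows "mat_poly A (p * q) = mat_poly A p * mat_poly A q"
proof (induction p)
  case 0
  then show ?case using A left_mult_zero_mat[OF mat_poly_closed[OF A, of q]] by simp
next
  case (pCons a p)
  have c: "mat_poly A p \<in> carrier_mat n n" for p using A by auto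
  have "mat_poly A (pCons a p * q) = a \<cdot>\<^sub>m mat_poly A q + (0 \<cdot>\<^sub>m 1\<^sub>m n + A * (mat_poly A p * mat_poly A q))"
    unfolding mult_pCons_left mat_poly_add[OF A] mat_poly_smult[OF A] mat_poly_pCons[OF A] pCons.IH ..
  also have "0 \<cdot>\<^sub>m 1\<^sub>m n + A * (mat_poly A p * mat_poly A q) = A * (mat_poly A p * mat_poly A q)"
    using A c by (intro eq_matI) (auto simp: carrier_matD[OF c] simp del: index_mult_mat(1))
  also have "A * (mat_poly A p * mat_poly A q) = (A * mat_poly A p) * mat_poly A q"
    using A c by (simp add: assoc_mult_mat[OF A c c])
  also have "a \<cdot>\<^sub>m mat_poly A q = (a \<cdot>\<^sub>m 1\<^sub>m n) * mat_poly A q"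
    using c[of q] by (subst mult_smult_assoc_mat[of _ n n _ n]) auto
  also have "(a \<cdot>\<^sub>m 1\<^sub>m n) * mat_poly A q + (A * mat_poly A p) * mat_poly A q
    = (a \<cdot>\<^sub>m 1\<^sub>m n + A * mat_poly A p) * mat_poly A q"
    by (rule add_mult_distrib_mat[symmetric, of _ n n _ _ n]) (use A c in auto)
  finally show ?case unfolding mat_poly_pCons[OF A] .
qed

lemma mat_poly_mult_vec:
  assumes A: "A \<in> carrier_mat n n" and v: "v \<in> carrier_vec n"
  shows "mat_poly A (p * q) *\<^sub>v v = mat_poly A p *\<^sub>v (mat_poly A q *\<^sub>v v)"
  unfolding mat_poly_mult[OF A] using A v by (intro assoc_mult_mat_vec[of _ n n _ n]) auto

text \<open>Transposition turns \<open>A * p(A)\<close> into \<open>p(A) * A\<close>. Both are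
  values of the product of \<open>p\<close> with \<open>[:0, 1:]\<close>, and polynomials
  commute.\<close>

lemma mat_poly_transpose:
  assumes A: "A \<in> carrier_mat n n" and sym: "transpose_mat A = A"
  shows "transpose_mat (mat_poly A p) = mat_poly A p"
proof (induction p)
  case 0
  then show ?case by simp
next
  case (pCons a p)
  have c: "mat_poly A p \<in> carrier_mat n n" for p using A by auto
  have "transpose_mat (A * mat_poly A p) = mat_poly A p * A"
    by (simp add: transpose_mult[OF A c] pCons.IH sym)
  also have "\<dots> = mat_poly A (p * [:0,1:])"
    unfolding mat_poly_mult[OF A] mat_poly_X[OF A] ..
  also have "p * [:0,1:] = [:0,1:] * p" by simp
  also have "mat_poly A \<dots> = A * mat_poly A p"
    unfolding mat_poly_mult[OF A] mat_poly_X[OF A] ..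
  finally have 1: "transpose_mat (A * mat_poly A p) = A * mat_poly A p" .
  have "transpose_mat (a \<cdot>\<^sub>m 1\<^sub>m n + A * mat_poly A p) = transpose_mat (a \<cdot>\<^sub>m 1\<^sub>m n) + transpose_mat (A * mat_poly A p)"
    by (rule transpose_add[of _ n n]) (use A c in auto)
  moreover have "transpose_mat (a \<cdot>\<^sub>m 1\<^sub>m n) = a \<cdot>\<^sub>m 1\<^sub>m n" by (intro eq_matI) auto
  ultimately show ?case unfolding mat_poly_pCons[OF A] 1 by simp
qed

section \<open>Annihilating polynomials and real eigenvalues\<close>

lemma sym_mat_scalar_prod:
  fixes A :: "real Matrix.mat"
  assumes "A \<in> carrier_mat n n" "transpose_mat A = A" "u \<in> carrier_vec n" "v \<in> carrier_vec n"
  shows "scalar_prod u (A *\<^sub>v v) = scalar_prod (A *\<^sub>v u) v"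
  using transpose_vec_mult_scalar[OF assms(1,4,3)] assms(2) by simp

lemma sq_norm_eq_0_iff:
  fixes v :: "real Matrix.vec"
  assumes "v \<in> carrier_vec n"
  shows "scalar_prod v v = 0 \<longleftrightarrow> v = 0\<^sub>v n"
proof
  assume "scalar_prod v v = 0"
  then have "\<forall>i\<in>{0..<n}. vec_index v i * vec_index v i = 0"
    using assms by (simp add: scalar_prod_def sum_nonneg_eq_0_iff)
  then show "v = 0\<^sub>v n" using assms by (intro eq_vecI) auto
qed (use assms in auto)

lemma sq_norm_ge_0 [simp]:
  fixes v :: "real Matrix.vec"
  shows "0 \<le> scalar_prod v v"
  by (simp add: scalar_prod_def sum_nonneg)

text \<open>The powers of \<open>A\<close> up to exponent \<open>n * n\<close> are one more than the
  dimension \<open>n * n\<close> of the space of matrices, so they are linearly dependent. Column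
  \<open>j\<close> of \<open>C\<close> is the flattened \<open>j\<close>-th power, and a zero row
  makes \<open>C\<close> square, so that the dependence follows from a vanishing
  determinant.\<close>

lemma exists_annihilating_poly:
  assumes A: "A \<in> carrier_mat n n"
  shows "\<exists>p. p \<noteq> 0 \<and> mat_poly A p = 0\<^sub>m n n"
proof -
  define C :: "real Matrix.mat" where "C = Matrix.mat (Suc (n * n)) (Suc (n * n))
    (\<lambda>(i, j). if i < n * n then mat_poly A (monom 1 j) $$ (i div n, i mod n) else 0)"
  have C: "C \<in> carrier_mat (Suc (n * n)) (Suc (n * n))" by (simp add: C_def)
  \<comment> \<open>The last row of \<open>C\<close> is zero, so this unit vector lies in the kernel
    of the transpose.\<close>
  define e :: "real Matrix.vec" where "e = unit_vec (Suc (n * n)) (n * n)"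
  have "transpose_mat C *\<^sub>v e = 0\<^sub>v (Suc (n * n))"
  proof (intro eq_vecI)
    fix i assume i: "i < dim_vec (0\<^sub>v (Suc (n * n)) :: real Matrix.vec)"
    then show "vec_index (transpose_mat C *\<^sub>v e) i = vec_index (0\<^sub>v (Suc (n * n))) i"
      using C by (simp add: e_def) (simp add: C_def)
  qed (use C in auto)
  moreover have "e \<in> carrier_vec (Suc (n * n))" "e \<noteq> 0\<^sub>v (Suc (n * n))"
    using arg_cong[of e "0\<^sub>v (Suc (n * n))" "\<lambda>v. vec_index v (n * n)"] by (auto simp: e_def)
  ultimately have "Determinant.det (transpose_mat C) = 0"
    using det_0_iff_vec_prod_zero[of "transpose_mat C" "Suc (n * n)"] C by auto
  then have "Determinant.det C = 0" using det_transpose[OF C] by simp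
  then obtain v where v: "v \<in> carrier_vec (Suc (n * n))" "v \<noteq> 0\<^sub>v (Suc (n * n))"
    and Cv: "C *\<^sub>v v = 0\<^sub>v (Suc (n * n))"
    using det_0_iff_vec_prod_zero[OF C] by auto
  define p where "p = (\<Sum>j\<in>{0..<Suc (n * n)}. Polynomial.smult (vec_index v j) (monom 1 j))"
  have coeff: "coeff p j = vec_index v j" if "j < Suc (n * n)" for j
    using that by (simp add: p_def coeff_sum coeff_monom if_distrib cong: if_cong del: sum.op_ivl_Suc)
  have "p \<noteq> 0"
  proof
    assume "p = 0"
    then have "v = 0\<^sub>v (Suc (n * n))" using coeff v(1) by (intro eq_vecI) auto
    then show False using v by simp
  qed
  have entry: "mat_poly A (\<Sum>j\<in>J. Polynomial.smult (c j) (q j)) $$ (i, k) = (\<Sum>j\<in>J. c j * mat_poly A (q j) $$ (i, k))"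
    if "finite J" "i < n" "k < n" for J :: "nat set" and c q i k
    using that(1)
  proof (induction J rule: finite_induct)
    case empty
    then show ?case using A that by simp
  next
    case (insert x F)
    have "mat_poly A r \<in> carrier_mat n n" for r using A by simp
    then have "dim_row (mat_poly A r) = n" "dim_col (mat_poly A r) = n" for r by auto
    then show ?case
      using insert that by (simp add: mat_poly_add[OF A] mat_poly_smult[OF A])
  qed
  have "mat_poly A p = 0\<^sub>m n n"
  proof (intro eq_matI)
    fix i k assume "i < dim_row (0\<^sub>m n n :: real Matrix.mat)" "k < dim_col (0\<^sub>m n n :: real Matrix.mat)"
    then have ik: "i < n" "k < n" by auto
    define l where "l = i * n + k"
    have l: "l < n * n" "l div n = i" "l mod n = k"
    proof -
      have "l < Suc i * n" using ik by (simp add: l_def)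
      also have "\<dots> \<le> n * n" using ik by (intro mult_right_mono) auto
      finally show "l < n * n" .
    qed (use ik in \<open>auto simp: l_def\<close>)
    have "0 = vec_index (C *\<^sub>v v) l" using Cv l by simp
    also have "\<dots> = (\<Sum>j\<in>{0..<Suc (n * n)}. vec_index v j * mat_poly A (monom 1 j) $$ (i, k))"
      using v l by (simp add: scalar_prod_def C_def mult.commute del: sum.op_ivl_Suc)
    also have "\<dots> = mat_poly A p $$ (i, k)"
      unfolding p_def by (rule entry[symmetric]) (use ik in auto)
    finally show "mat_poly A p $$ (i, k) = 0\<^sub>m n n $$ (i, k)" using ik by simp
  qed (use mat_poly_closed[OF A, of p] in auto)
  with \<open>p \<noteq> 0\<close> show ?thesis by blast
qed

text \<open>The quadratic is \<open>(X - z) (X - cnj z)\<close>. The remainder modulo it is real, at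
  most linear, and vanishes at the non-real \<open>z\<close>: the imaginary part of this equation
  kills the slope, the real part the constant.\<close>

lemma nonreal_root_quadratic_dvd:
  fixes p :: "real poly"
  assumes "poly (map_poly complex_of_real p) z = 0" "Im z \<noteq> 0"
  shows "[:(Re z)\<^sup>2 + (Im z)\<^sup>2, - 2 * Re z, 1:] dvd p"
proof -
  define q where "q = [:(Re z)\<^sup>2 + (Im z)\<^sup>2, - 2 * Re z, 1:]"
  have "degree q = 2" "q \<noteq> 0" by (auto simp: q_def)
  define r where "r = p mod q"
  have "degree r < 2" using \<open>q \<noteq> 0\<close> \<open>degree q = 2\<close> degree_mod_less[of q p]
    by (auto simp: r_def)
  then have r: "r = [:coeff r 0, coeff r 1:]"
    by (intro poly_eqI) (auto simp: coeff_pCons coeff_eq_0 split: nat.split)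
  have "poly (map_poly complex_of_real q) z = 0"
    by (simp add: q_def map_poly_pCons complex_eq_iff power2_eq_square algebra_simps)
  moreover have "map_poly complex_of_real p = map_poly complex_of_real (p div q) * map_poly complex_of_real q + map_poly complex_of_real r"
  proof -
    have "map_poly complex_of_real (a * b + c) = map_poly complex_of_real a * map_poly complex_of_real b + map_poly complex_of_real c" for a b c
      by (intro poly_eqI) (simp add: coeff_map_poly coeff_mult)
    from this[of "p div q" q r] show ?thesis by (simp add: r_def)
  qed
  ultimately have "poly (map_poly complex_of_real r) z = 0" using assms(1) by simp
  then have "of_real (coeff r 0) + of_real (coeff r 1) * z = 0"
    by (subst (asm) r) (simp add: map_poly_pCons mult.commute)
  then have "coeff r 1 * Im z = 0" "coeff r 0 + coeff r 1 * Re z = 0"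
    by (auto simp: complex_eq_iff)
  with assms(2) have "r = 0" by (subst r) simp
  then show ?thesis unfolding q_def[symmetric] r_def by (simp add: mod_eq_0_iff_dvd)
qed

definition real_spectrum :: "real Matrix.mat \<Rightarrow> real set" where
  "real_spectrum A = {l. \<exists>v\<in>carrier_vec (dim_row A). v \<noteq> 0\<^sub>v (dim_row A) \<and> A *\<^sub>v v = l \<cdot>\<^sub>v v}"


lemma mat_poly_zero_vec:
  assumes A: "A \<in> carrier_mat n n" shows "mat_poly A p *\<^sub>v 0\<^sub>v n = 0\<^sub>v n"
  using mat_poly_closed[OF A, of p] by (intro eq_vecI) auto

lemma sym_mat_kernel_square:
  fixes B :: "real Matrix.mat"
  assumes B: "B \<in> carrier_mat n n" "transpose_mat B = B" and v: "v \<in> carrier_vec n"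
    and 0: "B *\<^sub>v (B *\<^sub>v v) = 0\<^sub>v n"
  shows "B *\<^sub>v v = 0\<^sub>v n"
proof -
  have "scalar_prod (B *\<^sub>v v) (B *\<^sub>v v) = scalar_prod v (B *\<^sub>v (B *\<^sub>v v))"
    using sym_mat_scalar_prod[OF B v, of "B *\<^sub>v v"] B v by simp
  then show ?thesis using 0 v B sq_norm_eq_0_iff[of "B *\<^sub>v v" n] by simp
qed

lemma mat_poly_linear_vec:
  assumes A: "A \<in> carrier_mat n n" and v: "v \<in> carrier_vec n"
  shows "mat_poly A [:- a, 1:] *\<^sub>v v = A *\<^sub>v v - a \<cdot>\<^sub>v v"
proof -
  have "[:- a, 1:] = [:0, 1:] + Polynomial.smult (- a) 1" by simp
  then have "mat_poly A [:- a, 1:] = A + (- a) \<cdot>\<^sub>m 1\<^sub>m n"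
    by (simp only: mat_poly_add[OF A] mat_poly_smult[OF A] mat_poly_1[OF A] mat_poly_X[OF A])
  also have "\<dots> *\<^sub>v v = A *\<^sub>v v + ((- a) \<cdot>\<^sub>m 1\<^sub>m n) *\<^sub>v v"
    by (rule add_mult_distrib_mat_vec[of _ n n]) (use A v in auto)
  also have "((- a) \<cdot>\<^sub>m 1\<^sub>m n) *\<^sub>v v = (- a) \<cdot>\<^sub>v v"
    using v by (intro eq_vecI) auto
  also have "A *\<^sub>v v + (- a) \<cdot>\<^sub>v v = A *\<^sub>v v - a \<cdot>\<^sub>v v"
    using A v by (intro eq_vecI) auto
  finally show ?thesis .
qed

text \<open>Non-real and repeated roots of an annihilating polynomial can be dropped one at a time, since
  \<open>B\<^sup>2 w = 0\<close> implies \<open>B w = 0\<close> for symmetric \<open>B\<close>. This replaces diagonalization.\<close>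

lemma mat_poly_annihilates:
  assumes A: "A \<in> carrier_mat n n" and sym: "transpose_mat A = A"
    and "p \<noteq> 0" "w \<in> carrier_vec n" "mat_poly A p *\<^sub>v w = 0\<^sub>v n"
    and "\<And>l. l \<in> real_spectrum A \<Longrightarrow> poly p l = 0 \<Longrightarrow> poly f l = 0"
  shows "mat_poly A f *\<^sub>v w = 0\<^sub>v n"
  using assms(3-)
\<comment> \<open>\<open>w\<close> and \<open>f\<close> vary because an eigenvalue \<open>a\<close>
  that is a simple root of \<open>p\<close> is removed from both: \<open>w\<close> becomes
  \<open>(A - a) w\<close>, and \<open>f\<close> is divided by \<open>X - a\<close>.\<close>
proof (induction "degree p" arbitrary: p f w rule: less_induct)
  case less
  have c: "mat_poly A p \<in> carrier_mat n n" for p using A by auto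
  have cv: "mat_poly A p *\<^sub>v v \<in> carrier_vec n" if "v \<in> carrier_vec n" for p v
    using c[of p] that by auto
  have eig: "l \<in> real_spectrum A"
    if "v \<in> carrier_vec n" "v \<noteq> 0\<^sub>v n" "mat_poly A [:- l, 1:] *\<^sub>v v = 0\<^sub>v n" for v l
  proof -
    have "A *\<^sub>v v - l \<cdot>\<^sub>v v = 0\<^sub>v n" using that mat_poly_linear_vec[OF A that(1)] by simp
    then have "vec_index (A *\<^sub>v v - l \<cdot>\<^sub>v v) i = 0" if "i < n" for i using that by simp
    then have "A *\<^sub>v v = l \<cdot>\<^sub>v v" using A that(1) by (intro eq_vecI) auto
    then show ?thesis using that A by (auto simp: real_spectrum_def)
  qed
  note w = less.prems(2) and pw = less.prems(3)
  show ?case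
  proof (cases "degree p = 0")
    case True
    then obtain a where a: "p = [:a:]" "a \<noteq> 0" using less.prems(1) by (metis degree_0_id pCons_0_0)
    have "a \<cdot>\<^sub>v w = 0\<^sub>v n"
    proof -
      have "(a \<cdot>\<^sub>m 1\<^sub>m n) *\<^sub>v w = a \<cdot>\<^sub>v w" using w by (intro eq_vecI) auto
      then show ?thesis using pw a mat_poly_const[OF A] by simp
    qed
    then have "vec_index (a \<cdot>\<^sub>v w) i = 0" if "i < n" for i using that by simp
    then have "w = 0\<^sub>v n" using w a by (intro eq_vecI) auto
    then show ?thesis using mat_poly_zero_vec[OF A] by simp
  next
    case False
    then have "\<not> constant (poly (map_poly complex_of_real p))"
      by (simp add: constant_degree degree_map_poly)
    then obtain z where z: "poly (map_poly complex_of_real p) z = 0"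
      using fundamental_theorem_of_algebra by blast
    show ?thesis
    proof (cases "Im z = 0")
      case False
      define q where "q = [:(Re z)\<^sup>2 + (Im z)\<^sup>2, - 2 * Re z, 1:]"
      obtain h where h: "p = q * h"
        using nonreal_root_quadratic_dvd[OF z False] by (auto simp: q_def dvd_def)
      have "h \<noteq> 0" using h less.prems(1) by auto
      have "degree q = 2" "q \<noteq> 0" by (auto simp: q_def)
      then have deg: "degree h < degree p" using \<open>h \<noteq> 0\<close> by (simp add: h degree_mult_eq)
      define y where "y = mat_poly A h *\<^sub>v w"
      have y: "y \<in> carrier_vec n" using cv[OF w] by (simp add: y_def)
      let ?l = "[:- Re z, 1:]"
      have qy: "mat_poly A q *\<^sub>v y = 0\<^sub>v n"
        using pw unfolding h y_def mat_poly_mult_vec[OF A w] .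
      have "q = ?l * ?l + Polynomial.smult ((Im z)\<^sup>2) 1"
        by (simp add: q_def power2_eq_square)
      then have "mat_poly A q *\<^sub>v y = mat_poly A (?l * ?l) *\<^sub>v y + ((Im z)\<^sup>2 \<cdot>\<^sub>m 1\<^sub>m n) *\<^sub>v y"
        unfolding mat_poly_add[OF A] mat_poly_smult[OF A] mat_poly_1[OF A]
        using c y by (simp add: mat_poly_add[OF A] mat_poly_const[OF A] add_mult_distrib_mat_vec[of _ n n] del: mult_pCons_left mult_pCons_right)
      also have "((Im z)\<^sup>2 \<cdot>\<^sub>m 1\<^sub>m n) *\<^sub>v y = (Im z)\<^sup>2 \<cdot>\<^sub>v y" using y by (intro eq_vecI) auto
      also have "mat_poly A (?l * ?l) *\<^sub>v y = mat_poly A ?l *\<^sub>v (mat_poly A ?l *\<^sub>v y)"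
        by (rule mat_poly_mult_vec[OF A y])
      finally have "scalar_prod y (mat_poly A q *\<^sub>v y) =
        scalar_prod y (mat_poly A ?l *\<^sub>v (mat_poly A ?l *\<^sub>v y)) + (Im z)\<^sup>2 * scalar_prod y y"
        using y cv[OF cv[OF y]] by (simp add: scalar_prod_add_distrib[of _ n])
      also have "scalar_prod y (mat_poly A ?l *\<^sub>v (mat_poly A ?l *\<^sub>v y)) =
        scalar_prod (mat_poly A ?l *\<^sub>v y) (mat_poly A ?l *\<^sub>v y)"
        by (rule sym_mat_scalar_prod[OF c mat_poly_transpose[OF A sym] y cv[OF y]])
      finally have "scalar_prod (mat_poly A ?l *\<^sub>v y) (mat_poly A ?l *\<^sub>v y) + (Im z)\<^sup>2 * scalar_prod y y = 0"
        using y by (simp add: qy)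
      then have "(Im z)\<^sup>2 * scalar_prod y y = 0"
        using sq_norm_ge_0[of "mat_poly A ?l *\<^sub>v y"] sq_norm_ge_0[of y] zero_le_power2[of "Im z"]
        by (smt (verit) mult_nonneg_nonneg)
      then have "y = 0\<^sub>v n" using False y by (simp add: sq_norm_eq_0_iff)
      show ?thesis
      proof (rule less.hyps[OF deg \<open>h \<noteq> 0\<close> w])
        show "mat_poly A h *\<^sub>v w = 0\<^sub>v n" using \<open>y = 0\<^sub>v n\<close> y_def by simp
      qed (use less.prems(4) in \<open>auto simp: h\<close>)
    next
      case True
      define a where "a = Re z"
      have "poly p a = 0"
      proof -
        have "z = complex_of_real a" using True by (simp add: a_def complex_eq_iff)
        moreover have "poly (map_poly complex_of_real f) (complex_of_real a) = complex_of_real (poly f a)" for f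
          by (induction f) (simp_all add: map_poly_pCons)
        ultimately show ?thesis using z by simp
      qed
      define l where "l = [:- a, 1:]"
      obtain h where h: "p = l * h" using \<open>poly p a = 0\<close> by (auto simp: poly_eq_0_iff_dvd dvd_def l_def)
      have "h \<noteq> 0" using h less.prems(1) by auto
      have "degree l = 1" "l \<noteq> 0" by (auto simp: l_def)
      then have deg: "degree h < degree p" using \<open>h \<noteq> 0\<close> by (simp add: h degree_mult_eq)
      have lhw: "mat_poly A l *\<^sub>v (mat_poly A h *\<^sub>v w) = 0\<^sub>v n"
        using pw unfolding h mat_poly_mult_vec[OF A w] .
      have hcase: ?thesis if "mat_poly A h *\<^sub>v w = 0\<^sub>v n"
        by (rule less.hyps[OF deg \<open>h \<noteq> 0\<close> w that]) (use less.prems(4) in \<open>auto simp: h\<close>)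
      show ?thesis
      \<comment> \<open>If \<open>a\<close> is not an eigenvalue, \<open>A - a\<close> is injective
        and its factor can be cancelled.\<close>
      proof (cases "a \<in> real_spectrum A")
        case False
        then show ?thesis using eig[OF cv[OF w]] lhw hcase unfolding l_def by blast
      next
        case True
        then have "poly f a = 0" using less.prems(4) \<open>poly p a = 0\<close> by blast
        then obtain g where g: "f = l * g" by (auto simp: poly_eq_0_iff_dvd dvd_def l_def)
        show ?thesis
        proof (cases "poly h a = 0")
          case True
          then obtain h2 where h2: "h = l * h2" by (auto simp: poly_eq_0_iff_dvd dvd_def l_def)
          have "mat_poly A l *\<^sub>v (mat_poly A l *\<^sub>v (mat_poly A h2 *\<^sub>v w)) = 0\<^sub>v n"
            using lhw unfolding h2 mat_poly_mult_vec[OF A w] .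
          then have "mat_poly A l *\<^sub>v (mat_poly A h2 *\<^sub>v w) = 0\<^sub>v n"
            by (rule sym_mat_kernel_square[OF c mat_poly_transpose[OF A sym] cv[OF w]])
          then show ?thesis using hcase unfolding h2 mat_poly_mult_vec[OF A w] by blast
        next
          case False
          \<comment> \<open>At a simple root the factor is moved onto the vector. The roots of
            \<open>h\<close> differ from \<open>a\<close>, so at the eigenvalues among them
            \<open>g\<close> vanishes along with \<open>f\<close>.\<close>
          have "mat_poly A h *\<^sub>v (mat_poly A l *\<^sub>v w) = 0\<^sub>v n"
            using pw unfolding h mult.commute[of l] mat_poly_mult_vec[OF A w] .
          then have "mat_poly A g *\<^sub>v (mat_poly A l *\<^sub>v w) = 0\<^sub>v n"
          proof (rule less.hyps[OF deg \<open>h \<noteq> 0\<close> cv[OF w]])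
            fix x assume x: "x \<in> real_spectrum A" "poly h x = 0"
            then have "poly f x = 0" "x \<noteq> a" using less.prems(4) False by (auto simp: h)
            then show "poly g x = 0" by (simp add: g l_def)
          qed
          then show ?thesis unfolding g mult.commute[of l] mat_poly_mult_vec[OF A w] .
        qed
      qed
    qed
  qed
qed

section \<open>Functional calculus on the spectrum\<close>

lemma mat_eqI_vec:
  fixes A B :: "real Matrix.mat"
  assumes A: "A \<in> carrier_mat n m" and B: "B \<in> carrier_mat n m"
    and eq: "\<And>v. v \<in> carrier_vec m \<Longrightarrow> A *\<^sub>v v = B *\<^sub>v v"
  shows "A = B"
proof (rule eq_matI)
  fix i j assume "i < dim_row B" "j < dim_col B"
  then have ij: "i < n" "j < m" using B by auto
  have "vec_index (A *\<^sub>v unit_vec m j) i = vec_index (B *\<^sub>v unit_vec m j) i" using eq by simp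
  then show "A $$ (i, j) = B $$ (i, j)" using A B ij by simp
qed (use A B in auto)

lemma mat_poly_eq_0:
  assumes A: "A \<in> carrier_mat n n" and sym: "transpose_mat A = A"
    and "\<And>l. l \<in> real_spectrum A \<Longrightarrow> poly f l = 0"
  shows "mat_poly A f = 0\<^sub>m n n"
proof (rule mat_eqI_vec)
  obtain p where p: "p \<noteq> 0" "mat_poly A p = 0\<^sub>m n n" using exists_annihilating_poly[OF A] by blast
  fix v :: "real Matrix.vec" assume v: "v \<in> carrier_vec n"
  have "mat_poly A f *\<^sub>v v = 0\<^sub>v n"
    by (rule mat_poly_annihilates[OF A sym p(1) v]) (use p v assms(3) in auto)
  then show "mat_poly A f *\<^sub>v v = 0\<^sub>m n n *\<^sub>v v" using v by (auto intro!: eq_vecI)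
qed (use A in auto)

text \<open>The difference of the two polynomials vanishes on the spectrum, hence at
  \<open>A\<close>. So any real function of the eigenvalues can be applied to \<open>A\<close>
  through whichever polynomial interpolates it, and identities between such functions carry over to
  matrices.\<close>

lemma mat_poly_eq:
  assumes A: "A \<in> carrier_mat n n" and sym: "transpose_mat A = A"
    and "\<And>l. l \<in> real_spectrum A \<Longrightarrow> poly f l = poly g l"
  shows "mat_poly A f = mat_poly A g"
proof -
  have "mat_poly A (f - g) = 0\<^sub>m n n"
    by (rule mat_poly_eq_0[OF A sym]) (use assms(3) in simp)
  moreover have "mat_poly A f = mat_poly A (f - g) + mat_poly A g"
    by (simp flip: mat_poly_add[OF A])
  ultimately show ?thesis using left_add_zero_mat[OF mat_poly_closed[OF A]] by simp
qed

lemma mat_poly_eigenvector: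
  assumes A: "A \<in> carrier_mat n n" and v: "v \<in> carrier_vec n" and eig: "A *\<^sub>v v = l \<cdot>\<^sub>v v"
  shows "mat_poly A p *\<^sub>v v = poly p l \<cdot>\<^sub>v v"
proof (induction p)
  case 0
  then show ?case using A v by (auto intro!: eq_vecI)
next
  case (pCons a p)
  have c: "mat_poly A p \<in> carrier_mat n n" using A by auto
  have "mat_poly A (pCons a p) *\<^sub>v v = (a \<cdot>\<^sub>m 1\<^sub>m n) *\<^sub>v v + (A * mat_poly A p) *\<^sub>v v"
    unfolding mat_poly_pCons[OF A] by (rule add_mult_distrib_mat_vec[of _ n n]) (use A c v in auto)
  also have "(A * mat_poly A p) *\<^sub>v v = A *\<^sub>v (poly p l \<cdot>\<^sub>v v)"
    using assoc_mult_mat_vec[OF A c v] pCons.IH by simp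
  also have "\<dots> = poly p l \<cdot>\<^sub>v (l \<cdot>\<^sub>v v)"
    using mult_mat_vec[OF A v] eig by simp
  also have "(a \<cdot>\<^sub>m 1\<^sub>m n) *\<^sub>v v = a \<cdot>\<^sub>v v" using v by (intro eq_vecI) auto
  also have "a \<cdot>\<^sub>v v + poly p l \<cdot>\<^sub>v (l \<cdot>\<^sub>v v) = poly (pCons a p) l \<cdot>\<^sub>v v"
    by (intro eq_vecI) (auto simp: algebra_simps)
  finally show ?case .
qed

lemma finite_real_spectrum:
  assumes A: "A \<in> carrier_mat n n"
  shows "finite (real_spectrum A)"
proof -
  obtain p where p: "p \<noteq> 0" "mat_poly A p = 0\<^sub>m n n" using exists_annihilating_poly[OF A] by blast
  have "real_spectrum A \<subseteq> {x. poly p x = 0}"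
  proof
    fix l assume "l \<in> real_spectrum A"
    then obtain v where v: "v \<in> carrier_vec n" "v \<noteq> 0\<^sub>v n" "A *\<^sub>v v = l \<cdot>\<^sub>v v"
      using A by (auto simp: real_spectrum_def)
    have "poly p l \<cdot>\<^sub>v v = 0\<^sub>v n" using mat_poly_eigenvector[OF A v(1,3), of p, symmetric] p v by (auto intro!: eq_vecI)
    then have "vec_index (poly p l \<cdot>\<^sub>v v) i = 0" if "i < n" for i using that by simp
    then have "poly p l = 0 \<or> v = 0\<^sub>v n" using v(1) by (metis carrier_vecD eq_vecI index_smult_vec(1) index_zero_vec mult_eq_0_iff)
    then show "l \<in> {x. poly p x = 0}" using v by simp
  qed
  then show ?thesis using poly_roots_finite[OF p(1)] finite_subset by blast
qed

lemma exists_interpolating_poly: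
  fixes \<phi> :: "real \<Rightarrow> real"
  assumes "finite S"
  shows "\<exists>f. \<forall>x\<in>S. poly f x = \<phi> x"
  using assms
proof (induction S rule: finite_induct)
  case empty
  then show ?case by simp
next
  case (insert x F)
  then obtain f where f: "\<forall>y\<in>F. poly f y = \<phi> y" by blast
  define q where "q = (\<Prod>y\<in>F. [:- y, 1:])"
  have q: "poly q y = (\<Prod>z\<in>F. y - z)" for y by (simp add: q_def poly_prod)
  have "poly q x \<noteq> 0" "\<forall>y\<in>F. poly q y = 0" using insert by (auto simp: q)
  then have "\<forall>y\<in>insert x F. poly (f + Polynomial.smult ((\<phi> x - poly f x) / poly q x) q) y = \<phi> y"
    using f by auto
  then show ?case by blast
qed

lemma mat_poly_sq_norm:
  assumes A: "A \<in> carrier_mat n n" and sym: "transpose_mat A = A" and v: "v \<in> carrier_vec n"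
  shows "scalar_prod (mat_poly A f *\<^sub>v v) (mat_poly A f *\<^sub>v v) = scalar_prod v (mat_poly A (f * f) *\<^sub>v v)"
  unfolding mat_poly_mult_vec[OF A v]
  using sym_mat_scalar_prod[OF mat_poly_closed[OF A] mat_poly_transpose[OF A sym] v, of "mat_poly A f *\<^sub>v v"]
    mat_poly_closed[OF A, of f] v by auto

text \<open>On the spectrum \<open>c\<^sup>2 - f\<^sup>2\<close> is nonnegative, hence the square of
  a function, which \<open>h\<close> interpolates. Then \<open>f(A)\<^sup>2 + h(A)\<^sup>2\<close>
  is \<open>c\<^sup>2\<close> times the identity, and pairing with \<open>v\<close> gives two
  squared norms whose sum is \<open>c\<^sup>2\<close> times that of \<open>v\<close>.\<close>

lemma mat_poly_norm_le:
  assumes A: "A \<in> carrier_mat n n" and sym: "transpose_mat A = A" and v: "v \<in> carrier_vec n"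
    and bound: "\<And>l. l \<in> real_spectrum A \<Longrightarrow> \<bar>poly f l\<bar> \<le> c"
    and "0 \<le> c"
  shows "eucl_norm (mat_poly A f *\<^sub>v v) \<le> c * eucl_norm v"
proof -
  obtain h where h: "\<forall>l\<in>real_spectrum A. poly h l = sqrt (c\<^sup>2 - (poly f l)\<^sup>2)"
    using exists_interpolating_poly[OF finite_real_spectrum[OF A], of "\<lambda>l. sqrt (c\<^sup>2 - (poly f l)\<^sup>2)"] by blast
  have "mat_poly A (f * f + h * h) = mat_poly A [:c\<^sup>2:]"
  proof (rule mat_poly_eq[OF A sym])
    fix l assume l: "l \<in> real_spectrum A"
    have "(poly f l)\<^sup>2 \<le> c\<^sup>2" using bound[OF l] by (metis abs_ge_zero power2_abs power_mono)
    then have "(poly h l)\<^sup>2 = c\<^sup>2 - (poly f l)\<^sup>2" using h l by simp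
    then show "poly (f * f + h * h) l = poly [:c\<^sup>2:] l"
      by (simp add: power2_eq_square)
  qed
  then have "mat_poly A (f * f) + mat_poly A (h * h) = c\<^sup>2 \<cdot>\<^sub>m 1\<^sub>m n"
    by (simp add: mat_poly_add[OF A] mat_poly_const[OF A])
  then have "(mat_poly A (f * f) + mat_poly A (h * h)) *\<^sub>v v = (c\<^sup>2 \<cdot>\<^sub>m 1\<^sub>m n) *\<^sub>v v" by simp
  also have "(c\<^sup>2 \<cdot>\<^sub>m 1\<^sub>m n) *\<^sub>v v = c\<^sup>2 \<cdot>\<^sub>v v" using v by (intro eq_vecI) auto
  also have "(mat_poly A (f * f) + mat_poly A (h * h)) *\<^sub>v v =
    mat_poly A (f * f) *\<^sub>v v + mat_poly A (h * h) *\<^sub>v v"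
    by (rule add_mult_distrib_mat_vec[of _ n n]) (use A v in auto)
  finally have "scalar_prod v (mat_poly A (f * f) *\<^sub>v v + mat_poly A (h * h) *\<^sub>v v) = c\<^sup>2 * scalar_prod v v"
    using v by simp
  also have "scalar_prod v (mat_poly A (f * f) *\<^sub>v v + mat_poly A (h * h) *\<^sub>v v) =
     scalar_prod v (mat_poly A (f * f) *\<^sub>v v) + scalar_prod v (mat_poly A (h * h) *\<^sub>v v)"
    by (rule scalar_prod_add_distrib[of _ n])
      (use v mat_poly_closed[OF A] in \<open>auto intro!: mult_mat_vec_carrier[of _ n n]\<close>)
  finally have "scalar_prod (mat_poly A f *\<^sub>v v) (mat_poly A f *\<^sub>v v)
    + scalar_prod (mat_poly A h *\<^sub>v v) (mat_poly A h *\<^sub>v v) = c\<^sup>2 * scalar_prod v v"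
    by (simp add: mat_poly_sq_norm[OF A sym v])
  then have "scalar_prod (mat_poly A f *\<^sub>v v) (mat_poly A f *\<^sub>v v) \<le> c\<^sup>2 * scalar_prod v v"
    using sq_norm_ge_0[of "mat_poly A h *\<^sub>v v"] by linarith
  then have "eucl_norm (mat_poly A f *\<^sub>v v) \<le> sqrt (c\<^sup>2 * scalar_prod v v)"
    unfolding eucl_norm_def by simp
  also have "\<dots> = c * eucl_norm v" using \<open>0 \<le> c\<close> by (simp add: real_sqrt_mult eucl_norm_def)
  finally show ?thesis .
qed

text \<open>\<open>g\<close> interpolates the power \<open>- 1 / 4\<close> on the spectrum, which is
  positive, and \<open>R\<close> is \<open>g(P)\<^sup>2\<close>. Passing through the fourth root
  exhibits \<open>R\<close> itself as a square: its quadratic form is the squared norm of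
  \<open>g(P) v\<close>.\<close>

lemma inv_sqrt_mat_exists:
  assumes P: "P \<in> carrier_mat n n" and spd: "sym_pos_def P"
  shows "\<exists>R. R \<in> carrier_mat n n \<and> sym_pos_def R \<and> R * R * P = 1\<^sub>m n \<and> P * (R * R) = 1\<^sub>m n"
proof -
  have sym: "transpose_mat P = P" using spd by (simp add: sym_pos_def_def)
  have pos: "0 < l" if l: "l \<in> real_spectrum P" for l
  proof -
    obtain v where v: "v \<in> carrier_vec n" "v \<noteq> 0\<^sub>v n" "P *\<^sub>v v = l \<cdot>\<^sub>v v"
      using l P unfolding real_spectrum_def by auto
    then have "0 < scalar_prod v (P *\<^sub>v v)" using spd P by (auto simp: sym_pos_def_def)
    also have "\<dots> = l * scalar_prod v v" using v by simp
    finally show ?thesis using sq_norm_ge_0[of v] by (simp add: zero_less_mult_iff)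
  qed
  obtain g where g: "\<forall>l\<in>real_spectrum P. poly g l = 1 / sqrt (sqrt l)"
    using exists_interpolating_poly[OF finite_real_spectrum[OF P], of "\<lambda>l. 1 / sqrt (sqrt l)"] by blast
  have g4: "poly (g * g * (g * g) * [:0, 1:]) l = 1" if "l \<in> real_spectrum P" for l
  proof -
    have "poly g l * poly g l = 1 / sqrt l" using g that pos[OF that] by simp
    then have "poly g l * poly g l * (poly g l * poly g l) = 1 / l" using pos[OF that] by simp
    then show ?thesis using pos[OF that] by (simp add: algebra_simps)
  qed
  define R where "R = mat_poly P (g * g)"
  have R: "R \<in> carrier_mat n n" using P by (simp add: R_def)
  have e1: "mat_poly P (g * g * (g * g) * [:0, 1:]) = 1\<^sub>m n"
    using mat_poly_eq[OF P sym, of _ 1] g4 mat_poly_1[OF P] by auto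
  then have RRP: "R * R * P = 1\<^sub>m n" unfolding mat_poly_mult[OF P] R_def mat_poly_X[OF P] .
  have PRR: "P * (R * R) = 1\<^sub>m n"
    using e1 unfolding mult.commute[of _ "[:0,1:]"]
    unfolding mat_poly_mult[OF P] R_def mat_poly_X[OF P] .
  have symR: "transpose_mat R = R" unfolding R_def by (rule mat_poly_transpose[OF P sym])
  have "0 < scalar_prod v (R *\<^sub>v v)" if v: "v \<in> carrier_vec n" "v \<noteq> 0\<^sub>v n" for v
  proof -
    \<comment> \<open>Positivity is strict because \<open>g(P)\<close> is injective: its fourth
      power times \<open>P\<close> is the identity.\<close>
    have "mat_poly P g *\<^sub>v v \<noteq> 0\<^sub>v n"
    proof
      assume gv: "mat_poly P g *\<^sub>v v = 0\<^sub>v n"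
      have "v = mat_poly P (g * g * (g * g) * [:0, 1:]) *\<^sub>v v" using e1 v by simp
      also have "g * g * (g * g) * [:0, 1:] = ([:0,1:] * (g * g) * g) * g" by (simp only: ac_simps)
      also have "mat_poly P \<dots> *\<^sub>v v = 0\<^sub>v n"
        unfolding mat_poly_mult_vec[OF P v(1)] gv by (rule mat_poly_zero_vec[OF P])
      finally show False using v by simp
    qed
    moreover have "mat_poly P g *\<^sub>v v \<in> carrier_vec n" using mat_poly_closed[OF P] v by (auto intro!: mult_mat_vec_carrier[of _ n n])
    ultimately have "scalar_prod (mat_poly P g *\<^sub>v v) (mat_poly P g *\<^sub>v v) \<noteq> 0"
      by (simp add: sq_norm_eq_0_iff)
    then show ?thesis using sq_norm_ge_0[of "mat_poly P g *\<^sub>v v"]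
      unfolding R_def mat_poly_sq_norm[OF P sym v(1)] by linarith
  qed
  then have "sym_pos_def R" using R symR by (auto simp: sym_pos_def_def)
  then show ?thesis using R RRP PRR by blast
qed

lemma inv_sqrt_mat:
  assumes P: "P \<in> carrier_mat n n" and spd: "sym_pos_def P"
  shows "inv_sqrt_mat P \<in> carrier_mat n n" "transpose_mat (inv_sqrt_mat P) = inv_sqrt_mat P"
    "P * (inv_sqrt_mat P * inv_sqrt_mat P) = 1\<^sub>m n" "inv_sqrt_mat P * inv_sqrt_mat P * P = 1\<^sub>m n"
proof -
  obtain R where R: "R \<in> carrier_mat n n" "sym_pos_def R" "R * R * P = 1\<^sub>m n" "P * (R * R) = 1\<^sub>m n"
    using inv_sqrt_mat_exists[OF assms] by blast
  have "\<exists>R. R \<in> carrier_mat (dim_row P) (dim_row P) \<and> sym_pos_def R \<and>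
     inverts_mat (R * R) P \<and> inverts_mat P (R * R)"
    using R P by (intro exI[of _ R]) (auto simp: inverts_mat_def)
  from someI_ex[OF this] have *: "inv_sqrt_mat P \<in> carrier_mat n n \<and> sym_pos_def (inv_sqrt_mat P) \<and>
     inverts_mat (inv_sqrt_mat P * inv_sqrt_mat P) P \<and> inverts_mat P (inv_sqrt_mat P * inv_sqrt_mat P)"
    unfolding inv_sqrt_mat_def using P by simp
  then show "inv_sqrt_mat P \<in> carrier_mat n n" "transpose_mat (inv_sqrt_mat P) = inv_sqrt_mat P"
    "P * (inv_sqrt_mat P * inv_sqrt_mat P) = 1\<^sub>m n" "inv_sqrt_mat P * inv_sqrt_mat P * P = 1\<^sub>m n"
    using P by (auto simp: inverts_mat_def sym_pos_def_def)
qed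


section \<open>MINRES and block preconditioning\<close>

fun chebyshev_poly :: "nat \<Rightarrow> real poly" where
  "chebyshev_poly 0 = 1"
| "chebyshev_poly (Suc 0) = [:0, 1:]"
| "chebyshev_poly (Suc (Suc n)) = [:0, 2:] * chebyshev_poly (Suc n) - chebyshev_poly n"

lemma degree_chebyshev_poly: "degree (chebyshev_poly n) \<le> n"
proof (induction n rule: chebyshev_poly.induct)
  case (3 n)
  have "degree ([:0, 2:] * chebyshev_poly (Suc n)) \<le> Suc (Suc n)"
    using degree_mult_le[of "[:0, 2:]" "chebyshev_poly (Suc n)"] 3 by simp
  then show ?case unfolding chebyshev_poly.simps
    by (rule degree_diff_le) (use 3 in simp)
qed auto

lemma chebyshev_poly_cos: "poly (chebyshev_poly n) (cos t) = cos (real n * t)"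
proof (induction n rule: chebyshev_poly.induct)
  case (3 n)
  have "cos (real (Suc (Suc n)) * t) = cos (real (Suc n) * t + t)" by (simp add: algebra_simps)
  moreover have "cos (real n * t) = cos (real (Suc n) * t - t)" by (simp add: algebra_simps)
  ultimately have "cos (real (Suc (Suc n)) * t) = 2 * cos t * cos (real (Suc n) * t) - cos (real n * t)"
    by (simp add: cos_add cos_diff del: of_nat_Suc)
  then show ?case using 3 by simp
qed auto

lemma abs_chebyshev_poly_le_1:
  assumes "\<bar>x\<bar> \<le> 1" shows "\<bar>poly (chebyshev_poly n) x\<bar> \<le> 1"
  using chebyshev_poly_cos[of n "arccos x"] assms by (simp add: cos_arccos_abs)

text \<open>At this argument both \<open>t ^ n\<close> and \<open>(1 / t) ^ n\<close> solve the
  three-term recursion. For real arguments of modulus at least 1 this takes the place of the cosine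
  formula and shows the growth.\<close>

lemma chebyshev_poly_joukowski:
  assumes "t \<noteq> 0"
  shows "poly (chebyshev_poly n) ((t + 1 / t) / 2) = (t ^ n + (1 / t) ^ n) / 2"
proof (induction n rule: chebyshev_poly.induct)
  case (3 n)
  then have "poly (chebyshev_poly (Suc (Suc n))) ((t + 1 / t) / 2) =
    2 * ((t + 1 / t) / 2) * ((t ^ Suc n + (1 / t) ^ Suc n) / 2) - (t ^ n + (1 / t) ^ n) / 2"
    by (simp only: chebyshev_poly.simps poly_diff poly_mult) (simp del: power_Suc)
  also have "\<dots> = (t ^ Suc (Suc n) + (1 / t) ^ Suc (Suc n)) / 2"
    using assms by (simp add: field_simps)
  finally show ?case .
qed auto

text \<open>The affine map \<open>x \<mapsto> (c + 1 - 2 * x) / (c - 1)\<close> takes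
  \<open>[1, c]\<close> onto \<open>[-1, 1]\<close> and \<open>0\<close> to \<open>m\<close>, beyond
  1. \<open>q\<close> is the Chebyshev polynomial composed with it and divided by its value
  \<open>T\<close> at \<open>m\<close>, so on \<open>[1, c]\<close> its modulus is at most
  \<open>1 / T\<close>.\<close>

lemma exists_small_poly:
  fixes c :: real
  assumes "1 < c"
  shows "\<exists>q. degree q \<le> k \<and> poly q 0 = 1 \<and>
    (\<forall>x. 1 \<le> x \<longrightarrow> x \<le> c \<longrightarrow> \<bar>poly q x\<bar> \<le> 2 * ((sqrt c - 1) / (sqrt c + 1)) ^ k)"
proof -
  define s where "s = sqrt c"
  have s: "1 < s" "c = s * s" using assms by (auto simp: s_def)
  \<comment> \<open>The larger of the two solutions of \<open>(t + 1 / t) / 2 = m\<close>; with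
    \<open>c = s * s\<close> both are rational in \<open>s\<close>.\<close>
  define t where "t = (s + 1) / (s - 1)"
  have t: "0 < t" using s by (simp add: t_def)
  define m where "m = (c + 1) / (c - 1)"
  have cm: "c - 1 = (s - 1) * (s + 1)" using s by (simp add: algebra_simps)
  have tm: "(t + 1 / t) / 2 = m"
  proof -
    have "s - 1 \<noteq> 0" "s + 1 \<noteq> 0" "(s - 1) * (s + 1) \<noteq> 0" using s by auto
    then have "(t + 1 / t) / 2 = (s * s + 1) / ((s - 1) * (s + 1))"
      unfolding t_def by (simp add: divide_simps) (simp add: algebra_simps)
    then show ?thesis unfolding m_def cm[symmetric] s(2)[symmetric] .
  qed
  define T where "T = poly (chebyshev_poly k) m"
  have "T = (t ^ k + (1 / t) ^ k) / 2"
    unfolding T_def tm[symmetric] by (rule chebyshev_poly_joukowski) (use t in simp)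
  then have T: "t ^ k / 2 \<le> T" using t by simp
  then have "0 < T" using t by (smt (verit) zero_less_power half_gt_zero)
  define q where "q = Polynomial.smult (1 / T) (pcompose (chebyshev_poly k) [:m, - 2 / (c - 1):])"
  have "degree q \<le> degree (chebyshev_poly k) * degree [:m, - 2 / (c - 1):]"
    unfolding q_def by (intro order.trans[OF degree_smult_le] degree_pcompose_le)
  also have "\<dots> \<le> k * 1" by (intro mult_mono degree_chebyshev_poly) auto
  finally have "degree q \<le> k" by simp
  moreover have "poly q 0 = 1" using \<open>0 < T\<close> by (simp add: q_def poly_pcompose T_def)
  moreover have "\<bar>poly q x\<bar> \<le> 2 * ((sqrt c - 1) / (sqrt c + 1)) ^ k" if x: "1 \<le> x" "x \<le> c" for x
  proof -
    have arg: "m + x * (- 2 / (c - 1)) = (c + 1 - 2 * x) / (c - 1)"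
      by (simp add: m_def diff_divide_distrib)
    have "\<bar>(c + 1 - 2 * x) / (c - 1)\<bar> \<le> 1" using assms x by (auto simp: divide_simps)
    then have "\<bar>poly (chebyshev_poly k) (m + x * (- 2 / (c - 1)))\<bar> \<le> 1"
      unfolding arg by (rule abs_chebyshev_poly_le_1)
    then have "\<bar>poly q x\<bar> \<le> 1 / T" using \<open>0 < T\<close> by (simp add: q_def poly_pcompose abs_mult divide_simps)
    also have "\<dots> \<le> 1 / (t ^ k / 2)" by (rule divide_left_mono) (use T t \<open>0 < T\<close> in auto)
    also have "\<dots> = 2 * (1 / t) ^ k" by (simp add: power_divide)
    also have "1 / t = (sqrt c - 1) / (sqrt c + 1)" by (simp add: t_def s_def)
    finally show ?thesis .
  qed
  ultimately show ?thesis by blast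
qed

section \<open>Krylov spaces and residual polynomials\<close>

lemma mat_poly_monom:
  assumes A: "A \<in> carrier_mat n n"
  shows "mat_poly A (monom c i) = c \<cdot>\<^sub>m (A ^\<^sub>m i)"
proof -
  have 1: "mat_poly A (monom 1 i) = A ^\<^sub>m i"
  proof (induction i)
    case 0
    then show ?case using A mat_poly_1[OF A] by (simp add: monom_0 one_pCons)
  next
    case (Suc i)
    have "monom (1::real) (Suc i) = monom 1 i * [:0, 1:]" by (simp add: monom_Suc mult.commute)
    then show ?case using Suc mat_poly_mult[OF A, of "monom 1 i" "[:0,1:]"] mat_poly_X[OF A] by simp
  qed
  have "monom c i = Polynomial.smult c (monom 1 i)" by (simp add: smult_monom)
  then show ?thesis using 1 mat_poly_smult[OF A] by simp
qed

text \<open>The alternative \<open>s = 0\<close> is for \<open>j = 0\<close>: there no degree is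
  below \<open>j\<close>, and the Krylov space consists of the zero vector alone.\<close>

lemma mat_poly_mem_krylov:
  assumes A: "A \<in> carrier_mat n n" and v: "v \<in> carrier_vec n" and s: "degree s < j \<or> s = 0"
  shows "mat_poly A s *\<^sub>v v \<in> krylov A v j"
proof -
  have c: "mat_poly A p \<in> carrier_mat n n" for p using A by auto
  have cp: "A ^\<^sub>m i \<in> carrier_mat n n" for i using A by auto
  have summand: "a \<cdot>\<^sub>v (A ^\<^sub>m i *\<^sub>v v) \<in> carrier_vec n" for a i
    using cp[of i] v by (auto intro!: mult_mat_vec_carrier[of _ n n])
  have *: "mat_poly A (\<Sum>i<j. monom (a i) i) *\<^sub>v v =
    finsum_vec TYPE(real) n (\<lambda>i. a i \<cdot>\<^sub>v (A ^\<^sub>m i *\<^sub>v v)) {..<j}" for a and j :: nat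
  proof (induction j)
    case 0
    then show ?case using A v finsum_vec_empty[of n "\<lambda>i. a i \<cdot>\<^sub>v (A ^\<^sub>m i *\<^sub>v v)"] by (auto intro!: eq_vecI)
  next
    case (Suc j)
    have "mat_poly A (\<Sum>i<Suc j. monom (a i) i) = mat_poly A (monom (a j) j) + mat_poly A (\<Sum>i<j. monom (a i) i)"
      by (simp add: mat_poly_add[OF A, symmetric] add.commute)
    also have "\<dots> *\<^sub>v v = mat_poly A (monom (a j) j) *\<^sub>v v + mat_poly A (\<Sum>i<j. monom (a i) i) *\<^sub>v v"
      by (rule add_mult_distrib_mat_vec[OF c c v])
    also have "mat_poly A (monom (a j) j) *\<^sub>v v = a j \<cdot>\<^sub>v (A ^\<^sub>m j *\<^sub>v v)"
      using A cp[of j] v by (simp add: mat_poly_monom[OF A]) (auto intro!: eq_vecI simp: carrier_matD[OF cp])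
    also have "a j \<cdot>\<^sub>v (A ^\<^sub>m j *\<^sub>v v) + mat_poly A (\<Sum>i<j. monom (a i) i) *\<^sub>v v =
      finsum_vec TYPE(real) n (\<lambda>i. a i \<cdot>\<^sub>v (A ^\<^sub>m i *\<^sub>v v)) {..<Suc j}"
      unfolding Suc.IH lessThan_Suc
      by (rule finsum_vec_insert[symmetric]) (use summand in auto)
    finally show ?case .
  qed
  have "s = (\<Sum>i<j. monom (coeff s i) i)"
    using s by (intro poly_eqI) (auto simp: coeff_sum if_distrib coeff_eq_0 cong: if_cong)
  then have "mat_poly A s *\<^sub>v v = finsum_vec TYPE(real) (dim_vec v) (\<lambda>i. coeff s i \<cdot>\<^sub>v (A ^\<^sub>m i *\<^sub>v v)) {..<j}"
    using *[of "coeff s" j] v by simp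
  then show ?thesis unfolding krylov_def by blast
qed

text \<open>Constant coefficient 1 means \<open>p = 1 + X p'\<close>. The correction
  \<open>z = - p'(M) r0\<close> lies in the Krylov space and leaves the residual
  \<open>r0 - M z = p(M) r0\<close>, with which the minimiser has to compete.\<close>

lemma minres_residual_le:
  assumes M: "M \<in> carrier_mat n n" and b: "b \<in> carrier_vec n" and x0: "x0 \<in> carrier_vec n"
    and r: "minres_residual M b x0 j r" and p: "degree p \<le> j" "poly p 0 = 1"
  shows "eucl_norm r \<le> eucl_norm (mat_poly M p *\<^sub>v (b - M *\<^sub>v x0))"
proof -
  define r0 where "r0 = b - M *\<^sub>v x0"
  have r0: "r0 \<in> carrier_vec n" using M b x0 by (auto simp: r0_def)
  obtain a p' where p': "p = pCons a p'" by (cases p) auto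
  then have "a = 1" using p by simp
  define z where "z = mat_poly M (- p') *\<^sub>v r0"
  have z: "z \<in> carrier_vec n" using mat_poly_closed[OF M] r0 by (auto simp: z_def intro!: mult_mat_vec_carrier[of _ n n])
  have "degree (- p') < j \<or> - p' = 0" using p(1) p' by (auto split: if_splits)
  then have zk: "z \<in> krylov M r0 j" unfolding z_def by (rule mat_poly_mem_krylov[OF M r0])
  have Mz: "M *\<^sub>v z = mat_poly M ([:0, 1:] * - p') *\<^sub>v r0"
    by (simp only: mat_poly_mult_vec[OF M r0] mat_poly_X[OF M] z_def)
  have "b - M *\<^sub>v (x0 + z) = r0 - M *\<^sub>v z"
    unfolding r0_def mult_add_distrib_mat_vec[OF M x0 z] using M b x0 z by (intro eq_vecI) auto
  also have "\<dots> = mat_poly M p *\<^sub>v r0"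
  proof -
    have "1 = p + [:0, 1:] * - p'" using p' \<open>a = 1\<close> by (simp add: one_pCons)
    then have "1\<^sub>m n = mat_poly M p + mat_poly M ([:0, 1:] * - p')"
      by (metis M mat_poly_1 mat_poly_add)
    then have "r0 = (mat_poly M p + mat_poly M ([:0, 1:] * - p')) *\<^sub>v r0" using r0 by (metis one_mult_mat_vec)
    also have "\<dots> = mat_poly M p *\<^sub>v r0 + mat_poly M ([:0, 1:] * - p') *\<^sub>v r0"
      by (rule add_mult_distrib_mat_vec[of _ n n]) (use M r0 in auto)
    finally have e: "r0 = mat_poly M p *\<^sub>v r0 + M *\<^sub>v z" unfolding Mz .
    have c: "mat_poly M p *\<^sub>v r0 \<in> carrier_vec n" using mat_poly_closed[OF M] r0 by (auto intro!: mult_mat_vec_carrier[of _ n n])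
    have "y = x - w" if "x = y + w" "y \<in> carrier_vec n" "w \<in> carrier_vec n" for x y w :: "real Matrix.vec"
      using that by (intro eq_vecI) auto
    from this[OF e c] show ?thesis using M z by simp
  qed
  finally have "b - M *\<^sub>v (x0 + z) = mat_poly M p *\<^sub>v r0" .
  then show ?thesis using r zk unfolding minres_residual_def minres_iterate_def r0_def[symmetric] by metis
qed

text \<open>The sum defining the Krylov space is empty, so \<open>x0\<close> is the only
  candidate.\<close>

lemma minres_residual_0:
  assumes M: "M \<in> carrier_mat n n" and b: "b \<in> carrier_vec n" and x0: "x0 \<in> carrier_vec n"
    and r: "minres_residual M b x0 0 r"
  shows "r = b - M *\<^sub>v x0"
proof -
  have d: "dim_vec (b - M *\<^sub>v x0) = n" using M by simp
  have "z = 0\<^sub>v n" if "z \<in> krylov M (b - M *\<^sub>v x0) 0" for z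
    using that finsum_vec_empty[of n] unfolding krylov_def d by auto
  then show ?thesis using r right_zero_vec[OF x0] unfolding minres_residual_def minres_iterate_def by metis
qed

lemma minres_bound_even_step:
  assumes M: "M \<in> carrier_mat n n" and sym: "transpose_mat M = M"
    and b: "b \<in> carrier_vec n" and x0: "x0 \<in> carrier_vec n"
    and r: "\<And>j. minres_residual M b x0 j (r j)"
    and "1 < c"
    and lower: "\<And>v. v \<in> carrier_vec n \<Longrightarrow> scalar_prod v v \<le> scalar_prod (M *\<^sub>v v) (M *\<^sub>v v)"
    and upper: "\<And>v. v \<in> carrier_vec n \<Longrightarrow> scalar_prod (M *\<^sub>v v) (M *\<^sub>v v) \<le> c * scalar_prod v v"
  shows "eucl_norm (r (2 * k)) \<le> 2 * ((sqrt c - 1) / (sqrt c + 1)) ^ k * eucl_norm (r 0)"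
proof -
  obtain q where q: "degree q \<le> k" "poly q 0 = 1"
    "\<And>x. 1 \<le> x \<Longrightarrow> x \<le> c \<Longrightarrow> \<bar>poly q x\<bar> \<le> 2 * ((sqrt c - 1) / (sqrt c + 1)) ^ k"
    using exists_small_poly[OF \<open>1 < c\<close>] by blast
  \<comment> \<open>Eigenvalues of \<open>M\<close> may have either sign, but their squares are in
    \<open>[1, c]\<close>. An even polynomial sees only the squares; the price is the doubled
    degree, hence a bound after \<open>2 * k\<close> steps.\<close>
  define p where "p = pcompose q [:0, 0, 1:]"
  have "degree p \<le> degree q * degree [:0, 0, 1::real:]" unfolding p_def by (rule degree_pcompose_le)
  then have deg: "degree p \<le> 2 * k" using q(1) by simp
  have p0: "poly p 0 = 1" using q by (simp add: p_def poly_pcompose)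
  have r0: "r 0 = b - M *\<^sub>v x0" by (rule minres_residual_0[OF M b x0 r])
  have r0c: "r 0 \<in> carrier_vec n" unfolding r0 using M b x0 by auto
  have "eucl_norm (r (2 * k)) \<le> eucl_norm (mat_poly M p *\<^sub>v r 0)"
    unfolding r0 by (rule minres_residual_le[OF M b x0 r deg p0])
  also have "\<dots> \<le> 2 * ((sqrt c - 1) / (sqrt c + 1)) ^ k * eucl_norm (r 0)"
  proof (rule mat_poly_norm_le[OF M sym r0c])
    fix l assume "l \<in> real_spectrum M"
    then obtain v where v: "v \<in> carrier_vec n" "v \<noteq> 0\<^sub>v n" "M *\<^sub>v v = l \<cdot>\<^sub>v v"
      using M unfolding real_spectrum_def by auto
    have pos: "0 < scalar_prod v v" using sq_norm_ge_0[of v] sq_norm_eq_0_iff[OF v(1)] v(2) by linarith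
    have "scalar_prod (M *\<^sub>v v) (M *\<^sub>v v) = l * l * scalar_prod v v" using v by simp
    then have "1 * scalar_prod v v \<le> l * l * scalar_prod v v" "l * l * scalar_prod v v \<le> c * scalar_prod v v"
      using lower[OF v(1)] upper[OF v(1)] by auto
    then have "1 \<le> l * l" "l * l \<le> c" using pos by (auto simp only: mult_le_cancel_right_pos)
    then show "\<bar>poly p l\<bar> \<le> 2 * ((sqrt c - 1) / (sqrt c + 1)) ^ k"
      using q(3) by (simp add: p_def poly_pcompose)
  qed (use \<open>1 < c\<close> in auto)
  finally show ?thesis .
qed

section \<open>Energy estimates for the block system\<close>

lemma sym_mat_quadratic_diff:
  fixes H :: "real Matrix.mat"
  assumes H: "H \<in> carrier_mat n n" "transpose_mat H = H" and uv: "u \<in> carrier_vec n" "v \<in> carrier_vec n"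
  shows "scalar_prod (u - v) (H *\<^sub>v (u - v)) =
    scalar_prod u (H *\<^sub>v u) - 2 * scalar_prod u (H *\<^sub>v v) + scalar_prod v (H *\<^sub>v v)"
proof -
  have c: "H *\<^sub>v u \<in> carrier_vec n" "H *\<^sub>v v \<in> carrier_vec n" using H uv by auto
  have "scalar_prod v (H *\<^sub>v u) = scalar_prod u (H *\<^sub>v v)"
    using sym_mat_scalar_prod[OF H uv(2,1)] comm_scalar_prod[OF uv(1) c(2)] by simp
  moreover have "scalar_prod (u - v) (H *\<^sub>v (u - v)) =
    scalar_prod u (H *\<^sub>v u) - scalar_prod u (H *\<^sub>v v) - (scalar_prod v (H *\<^sub>v u) - scalar_prod v (H *\<^sub>v v))"
    using H uv c
    by (simp add: mult_minus_distrib_mat_vec[of _ n n] minus_scalar_prod_distrib[of _ n] scalar_prod_minus_distrib[of _ n])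
  ultimately show ?thesis by simp
qed

lemma vec_append_split:
  assumes "v \<in> carrier_vec (n + m)"
  obtains u p where "u \<in> carrier_vec n" "p \<in> carrier_vec m" "v = u @\<^sub>v p"
  using assms by (metis vec_first_carrier vec_last_carrier vec_first_last_append)

lemma sym_pos_def_block_diag:
  assumes H: "H \<in> carrier_mat n n" "sym_pos_def H" and S: "S \<in> carrier_mat m m" "sym_pos_def S"
  shows "sym_pos_def (four_block_mat H (0\<^sub>m n m) (0\<^sub>m m n) S)"
proof -
  let ?P = "four_block_mat H (0\<^sub>m n m) (0\<^sub>m m n) S"
  have P: "?P \<in> carrier_mat (n + m) (n + m)" using H S by auto
  have sym: "transpose_mat ?P = ?P"
    using H S by (subst transpose_four_block_mat[of _ n n _ m _ m]) (auto simp: sym_pos_def_def)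
  have nn: "0 \<le> scalar_prod u (A *\<^sub>v u)" "scalar_prod u (A *\<^sub>v u) = 0 \<Longrightarrow> u = 0\<^sub>v d"
    if "A \<in> carrier_mat d d" "sym_pos_def A" "u \<in> carrier_vec d" for u A d
    using that by (cases "u = 0\<^sub>v d"; force simp: sym_pos_def_def)+
  have "0 < scalar_prod v (?P *\<^sub>v v)" if v: "v \<in> carrier_vec (n + m)" "v \<noteq> 0\<^sub>v (n + m)" for v
  proof -
    obtain u p where up: "u \<in> carrier_vec n" "p \<in> carrier_vec m" "v = u @\<^sub>v p"
      using vec_append_split[OF v(1)] by blast
    have "scalar_prod v (?P *\<^sub>v v) = scalar_prod u (H *\<^sub>v u) + scalar_prod p (S *\<^sub>v p)"
      unfolding up(3) mult_mat_vec_split[OF H(1) S(1) up(1,2)]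
      by (rule scalar_prod_append) (use H S up in auto)
    moreover have "u \<noteq> 0\<^sub>v n \<or> p \<noteq> 0\<^sub>v m"
      using v(2) up by (auto simp: append_vec_def intro!: eq_vecI)
    ultimately show ?thesis using nn[OF H up(1)] nn[OF S up(2)] by fastforce
  qed
  then show ?thesis using P sym H S unfolding sym_pos_def_def by auto
qed

text \<open>Meant for a Cauchy-Schwarz estimate in which the quantity to be bounded is itself a
  factor on the right and has to be cancelled.\<close>

lemma le_of_sq_le_mult:
  fixes x g s :: real
  assumes "x\<^sup>2 \<le> g * (x * s)" "0 \<le> x" "0 \<le> g" "0 \<le> s"
  shows "x \<le> g * s"
proof (cases "x = 0")
  case False
  then have "x * x \<le> x * (g * s)" using assms by (simp add: power2_eq_square algebra_simps)
  then show ?thesis using False assms(2) by simp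
qed (use assms in simp)

text \<open>In block form \<open>M\<close> is \<open>(I, - C\<^sup>T; - C, - I)\<close> with
  \<open>C = \<beta> S^(-1/2) B H^(-1/2)\<close>, so its square is block diagonal with blocks
  \<open>I + C\<^sup>T C\<close> and \<open>I + C C\<^sup>T\<close>; \<open>coupling\<close> says
  that the squared norm of \<open>C\<close> is at most \<open>g\<close>. The proof forms no roots of
  \<open>H\<close> or \<open>S\<close>: it works with the components of \<open>R v\<close>, for
  which only \<open>H\<close>, \<open>S\<close> and \<open>B\<close> occur.\<close>

lemma block_preconditioned_bounds:
  assumes H: "H \<in> carrier_mat n n" "sym_pos_def H" and S: "S \<in> carrier_mat m m" "sym_pos_def S"
    and B: "B \<in> carrier_mat m n" and "0 \<le> g"
    and coupling: "\<forall>u\<in>carrier_vec n. \<forall>q\<in>carrier_vec m.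
       (\<beta> * scalar_prod q (B *\<^sub>v u))\<^sup>2 \<le> g * (scalar_prod u (H *\<^sub>v u) * scalar_prod q (S *\<^sub>v q))"
    and P: "P = four_block_mat H (0\<^sub>m n m) (0\<^sub>m m n) S"
    and A: "A = four_block_mat H (- \<beta> \<cdot>\<^sub>m transpose_mat B) (- \<beta> \<cdot>\<^sub>m B) (- S)"
    and M: "M = inv_sqrt_mat P * A * inv_sqrt_mat P"
  shows "M \<in> carrier_mat (n + m) (n + m)" "transpose_mat M = M"
    "\<And>v. v \<in> carrier_vec (n + m) \<Longrightarrow> scalar_prod v v \<le> scalar_prod (M *\<^sub>v v) (M *\<^sub>v v)"
    "\<And>v. v \<in> carrier_vec (n + m) \<Longrightarrow>
       scalar_prod (M *\<^sub>v v) (M *\<^sub>v v) \<le> (1 + g) * scalar_prod v v"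
proof -
  let ?N = "n + m"
  have Hs: "transpose_mat H = H" and Ss: "transpose_mat S = S" using H S by (auto simp: sym_pos_def_def)
  have Pc: "P \<in> carrier_mat ?N ?N" using H S by (auto simp: P)
  have Pspd: "sym_pos_def P" unfolding P by (rule sym_pos_def_block_diag[OF H S])
  have Ac: "A \<in> carrier_mat ?N ?N" using H S by (auto simp: A)
  have As: "transpose_mat A = A"
  proof -
    have "transpose_mat (- \<beta> \<cdot>\<^sub>m B) = - \<beta> \<cdot>\<^sub>m transpose_mat B"
      "transpose_mat (- \<beta> \<cdot>\<^sub>m transpose_mat B) = - \<beta> \<cdot>\<^sub>m B" "transpose_mat (- S) = - S"
      using Ss by (auto simp: transpose_uminus intro!: eq_matI)
    then show ?thesis
      unfolding A using H S B Hs by (subst transpose_four_block_mat[of _ n n _ m _ m]) auto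
  qed
  define R where "R = inv_sqrt_mat P"
  note inv = inv_sqrt_mat[OF Pc Pspd, folded R_def]
  have M': "M = R * A * R" by (simp add: M R_def)
  show Mc: "M \<in> carrier_mat ?N ?N" unfolding M' using inv(1) Ac by auto
  have "transpose_mat M = R * (A * R)"
    unfolding M' using transpose_mult[of "R * A" ?N ?N R ?N] transpose_mult[OF inv(1) Ac] inv(1,2) Ac As by simp
  also have "\<dots> = M" unfolding M' using inv(1) Ac by (simp add: assoc_mult_mat[of _ ?N ?N _ ?N _ ?N])
  finally show "transpose_mat M = M" .
  have "R * (R * P) = 1\<^sub>m ?N" using inv(4) assoc_mult_mat[OF inv(1) inv(1) Pc] by simp
  \<comment> \<open>A right inverse of a square matrix is also a left inverse, which moves one
    \<open>R\<close> to the other side.\<close>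
  then have RPR: "R * P * R = 1\<^sub>m ?N" by (rule mat_mult_left_right_inverse[rotated 2]) (use inv Pc in auto)
  \<comment> \<open>The substitution \<open>v \<mapsto> R v\<close> turns the Euclidean norm into
    the energy of the block diagonal \<open>P\<close>, in which the two components separate.\<close>
  have energy: "scalar_prod v v = scalar_prod (R *\<^sub>v v) (P *\<^sub>v (R *\<^sub>v v))" if v: "v \<in> carrier_vec ?N" for v
  proof -
    have Rv: "R *\<^sub>v v \<in> carrier_vec ?N" using inv(1) v by auto
    have "v = (R * P * R) *\<^sub>v v" using RPR v by simp
    also have "\<dots> = (R * P) *\<^sub>v (R *\<^sub>v v)" by (rule assoc_mult_mat_vec[of _ ?N ?N _ ?N]) (use inv Pc v in auto)
    also have "\<dots> = R *\<^sub>v (P *\<^sub>v (R *\<^sub>v v))" by (rule assoc_mult_mat_vec[OF inv(1) Pc Rv])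
    finally have "scalar_prod v v = scalar_prod v (R *\<^sub>v (P *\<^sub>v (R *\<^sub>v v)))" by simp
    also have "\<dots> = scalar_prod (R *\<^sub>v v) (P *\<^sub>v (R *\<^sub>v v))"
      by (rule sym_mat_scalar_prod[OF inv(1,2) v]) (use Pc Rv in auto)
    finally show ?thesis .
  qed
  have key: "\<exists>x y. 0 \<le> x \<and> 0 \<le> y \<and> scalar_prod (M *\<^sub>v v) (M *\<^sub>v v) = scalar_prod v v + x + y \<and>
      x + y \<le> g * scalar_prod v v" if v: "v \<in> carrier_vec ?N" for v
  proof -
    define w where "w = M *\<^sub>v v"
    have w: "w \<in> carrier_vec ?N" using Mc v by (simp add: w_def)
    have Rv: "R *\<^sub>v v \<in> carrier_vec ?N" and Rw: "R *\<^sub>v w \<in> carrier_vec ?N" using inv(1) v w by auto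
    obtain u p where up: "u \<in> carrier_vec n" "p \<in> carrier_vec m" "R *\<^sub>v v = u @\<^sub>v p"
      using vec_append_split[OF Rv] by blast
    obtain u' p' where up': "u' \<in> carrier_vec n" "p' \<in> carrier_vec m" "R *\<^sub>v w = u' @\<^sub>v p'"
      using vec_append_split[OF Rw] by blast
    have ARv: "A *\<^sub>v (R *\<^sub>v v) \<in> carrier_vec ?N" using Ac Rv by auto
    have "w = R *\<^sub>v (A *\<^sub>v (R *\<^sub>v v))"
      unfolding w_def M' using inv(1) Ac v by (simp add: assoc_mult_mat_vec[of _ ?N ?N _ ?N])
    \<comment> \<open>\<open>P\<close> cancels \<open>R * R\<close>, so \<open>R w\<close> solves a
      block diagonal system with right-hand side \<open>A (R v)\<close>.\<close>
    then have "P *\<^sub>v (R *\<^sub>v w) = (P * (R * R)) *\<^sub>v (A *\<^sub>v (R *\<^sub>v v))"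
      using inv(1) Pc ARv by (simp add: assoc_mult_mat_vec[of _ ?N ?N _ ?N])
    then have "P *\<^sub>v (R *\<^sub>v w) = A *\<^sub>v (R *\<^sub>v v)" using inv(3) ARv by simp
    then have "H *\<^sub>v u' @\<^sub>v S *\<^sub>v p' =
      (H *\<^sub>v u + (- \<beta> \<cdot>\<^sub>m transpose_mat B) *\<^sub>v p) @\<^sub>v ((- \<beta> \<cdot>\<^sub>m B) *\<^sub>v u + (- S) *\<^sub>v p)"
      unfolding up up' P A mult_mat_vec_split[OF H(1) S(1) up'(1,2)]
      by (subst (asm) four_block_mat_mult_vec[of _ n n _ m _ m]) (use H S B up in auto)
    moreover have "dim_vec (H *\<^sub>v u') = n" "dim_vec (H *\<^sub>v u + (- \<beta> \<cdot>\<^sub>m transpose_mat B) *\<^sub>v p) = n"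
      using H B by auto
    ultimately have e1: "H *\<^sub>v u' = H *\<^sub>v u + (- \<beta> \<cdot>\<^sub>m transpose_mat B) *\<^sub>v p"
      and e2: "S *\<^sub>v p' = (- \<beta> \<cdot>\<^sub>m B) *\<^sub>v u + (- S) *\<^sub>v p"
      using append_vec_eq[of "H *\<^sub>v u'" n "H *\<^sub>v u + (- \<beta> \<cdot>\<^sub>m transpose_mat B) *\<^sub>v p"]
      by (auto simp only: carrier_vec_def mem_Collect_eq)
    \<comment> \<open>\<open>a\<close> and \<open>e\<close> measure what the coupling adds to the
      uncoupled solution \<open>(u, - p)\<close>: \<open>u' = u - a\<close> and
      \<open>p' = e - p\<close>, the sign of \<open>p\<close> coming from the block
      \<open>- S\<close>.\<close>
    define a where "a = u - u'"
    define e where "e = p' + p"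
    have ac: "a \<in> carrier_vec n" "e \<in> carrier_vec m" using up up' by (auto simp: a_def e_def)
    have smv: "(k \<cdot>\<^sub>m X) *\<^sub>v x = k \<cdot>\<^sub>v (X *\<^sub>v x)" if "X \<in> carrier_mat i j" "x \<in> carrier_vec j"
      for X :: "real Matrix.mat" and x k i j
      using that by (intro eq_vecI) auto
    have Ha: "H *\<^sub>v a = \<beta> \<cdot>\<^sub>v (transpose_mat B *\<^sub>v p)"
      unfolding a_def mult_minus_distrib_mat_vec[OF H(1) up(1) up'(1)] e1
      using H B up by (subst smv[of _ n m]) (auto intro!: eq_vecI)
    have Se: "S *\<^sub>v e = - \<beta> \<cdot>\<^sub>v (B *\<^sub>v u)"
      unfolding e_def mult_add_distrib_mat_vec[OF S(1) up'(2) up(2)] e2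
      using S B up by (subst smv[of _ m n]) (auto intro!: eq_vecI)
    have ha: "scalar_prod x (H *\<^sub>v a) = \<beta> * scalar_prod p (B *\<^sub>v x)" if x: "x \<in> carrier_vec n" for x
    proof -
      have "scalar_prod x (H *\<^sub>v a) = \<beta> * scalar_prod x (transpose_mat B *\<^sub>v p)"
        unfolding Ha using x B up by (intro scalar_prod_smult_right) auto
      also have "scalar_prod x (transpose_mat B *\<^sub>v p) = scalar_prod (transpose_mat B *\<^sub>v p) x"
        by (rule comm_scalar_prod[OF x]) (use B up in auto)
      also have "\<dots> = scalar_prod p (B *\<^sub>v x)" by (rule transpose_vec_mult_scalar[OF B x up(2)])
      finally show ?thesis .
    qed
    have se: "scalar_prod x (S *\<^sub>v e) = - \<beta> * scalar_prod x (B *\<^sub>v u)" if x: "x \<in> carrier_vec m" for x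
      unfolding Se using x B up by (intro scalar_prod_smult_right) auto
    have u': "u' = u - a" and p': "p' = e - p" using up up' by (auto simp: a_def e_def intro!: eq_vecI)
    define hu where "hu = scalar_prod u (H *\<^sub>v u)"
    define sp where "sp = scalar_prod p (S *\<^sub>v p)"
    define haa where "haa = scalar_prod a (H *\<^sub>v a)"
    define see where "see = scalar_prod e (S *\<^sub>v e)"
    have vv: "scalar_prod v v = hu + sp"
      unfolding energy[OF v] up(3) P mult_mat_vec_split[OF H(1) S(1) up(1,2)] hu_def sp_def
      by (rule scalar_prod_append) (use H S up in auto)
    have "scalar_prod w w = scalar_prod u' (H *\<^sub>v u') + scalar_prod p' (S *\<^sub>v p')"
      unfolding energy[OF w] up'(3) P mult_mat_vec_split[OF H(1) S(1) up'(1,2)]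
      by (rule scalar_prod_append) (use H S up' in auto)
    also have "scalar_prod u' (H *\<^sub>v u') = hu - 2 * scalar_prod u (H *\<^sub>v a) + haa"
      unfolding u' hu_def haa_def by (rule sym_mat_quadratic_diff[OF H(1) Hs up(1) ac(1)])
    also have "scalar_prod p' (S *\<^sub>v p') = see - 2 * scalar_prod e (S *\<^sub>v p) + sp"
      unfolding p' see_def sp_def by (rule sym_mat_quadratic_diff[OF S(1) Ss ac(2) up(2)])
    also have "scalar_prod e (S *\<^sub>v p) = scalar_prod p (S *\<^sub>v e)"
      using sym_mat_scalar_prod[OF S(1) Ss ac(2) up(2)] comm_scalar_prod[of "S *\<^sub>v e" m p] S ac up by simp
    \<comment> \<open>The mixed terms are \<open>- 2 * \<beta>\<close> and
      \<open>2 * \<beta>\<close> times the same \<open>scalar_prod p (B *\<^sub>v u)\<close> and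
      cancel.\<close>
    finally have ww: "scalar_prod w w = scalar_prod v v + haa + see"
      unfolding vv ha[OF up(1)] se[OF up(2)] by simp
    have nn: "0 \<le> scalar_prod x (X *\<^sub>v x)"
      if "X \<in> carrier_mat d d" "sym_pos_def X" "x \<in> carrier_vec d" for x X d
      using that by (cases "x = 0\<^sub>v d") (force simp: sym_pos_def_def)+
    have pos: "0 \<le> hu" "0 \<le> sp" "0 \<le> haa" "0 \<le> see"
      unfolding hu_def sp_def haa_def see_def using nn H S up ac by auto
    \<comment> \<open>By \<open>ha\<close>, \<open>haa\<close> is itself
      \<open>\<beta> * scalar_prod p (B *\<^sub>v a)\<close>, so \<open>coupling\<close> at the pair
      \<open>(a, p)\<close> bounds its square by a product that contains \<open>haa\<close>
      again.\<close>
    have "haa\<^sup>2 \<le> g * (haa * sp)"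
      using coupling[rule_format, OF ac(1) up(2)] unfolding haa_def[symmetric] sp_def[symmetric] ha[OF ac(1), symmetric] .
    then have 1: "haa \<le> g * sp" by (rule le_of_sq_le_mult) (use pos \<open>0 \<le> g\<close> in auto)
    have "see\<^sup>2 \<le> g * (see * hu)"
      using coupling[rule_format, OF up(1) ac(2)] se[OF ac(2)] unfolding hu_def[symmetric] see_def[symmetric]
      by (simp add: mult.commute)
    then have 2: "see \<le> g * hu" by (rule le_of_sq_le_mult) (use pos \<open>0 \<le> g\<close> in auto)
    show ?thesis
      using ww pos 1 2 unfolding w_def[symmetric] vv by (intro exI[of _ haa] exI[of _ see]) (simp add: algebra_simps)
  qed
  show "scalar_prod v v \<le> scalar_prod (M *\<^sub>v v) (M *\<^sub>v v)" if "v \<in> carrier_vec ?N" for v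
    using key[OF that] by auto
  show "scalar_prod (M *\<^sub>v v) (M *\<^sub>v v) \<le> (1 + g) * scalar_prod v v" if "v \<in> carrier_vec ?N" for v
    using key[OF that] by (auto simp: algebra_simps)
qed


section \<open>Facets of simplices and Raviart-Thomas fields\<close>

lemma full_simplex:
  fixes K :: "(real ^ 'n) set"
  assumes "int CARD('n) simplex K"
  shows "compact K" "convex K" "polyhedron K" "aff_dim K = int CARD('n)" "interior K \<noteq> {}"
    "0 < measure lebesgue K"
proof -
  show cK: "compact K" and vK: "convex K" and "polyhedron K" and d: "aff_dim K = int CARD('n)"
    using assms compact_simplex convex_simplex simplex_imp_polyhedron aff_dim_simplex by blast+
  have "affine hull K = UNIV" using d aff_dim_eq_full[of K] by simp
  then have "rel_interior K = interior K" by (rule rel_interior_interior)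
  moreover have "K \<noteq> {}" using d by auto
  ultimately show int: "interior K \<noteq> {}" using rel_interior_eq_empty[OF vK] by auto
  then have "\<not> negligible K" using negligible_convex_interior[OF vK] by simp
  then have "measure lebesgue K \<noteq> 0" using negligible_iff_measure0[OF lmeasurable_compact[OF cK]] by simp
  then show "0 < measure lebesgue K" using measure_nonneg[of lebesgue K] by linarith
qed

lemma facet_of_full_simplex:
  fixes K :: "(real ^ 'n) set"
  assumes K: "int CARD('n) simplex K" and F: "F facet_of K"
  shows "F \<subseteq> K" "F \<noteq> {}" "convex F" "compact F" "aff_dim F = int CARD('n) - 1"
proof -
  show "F \<subseteq> K" using F by (rule facet_of_imp_subset)
  show "F \<noteq> {}" using F by (auto simp: facet_of_def)
  have f: "F face_of K" using F by (rule facet_of_imp_face_of)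
  show "convex F" using f by (rule face_of_imp_convex)
  show "compact F" using f full_simplex[OF K] face_of_imp_compact by blast
  show "aff_dim F = int CARD('n) - 1" using F full_simplex[OF K] by (simp add: facet_of_def)
qed

lemma affine_hull_eq_hyperplane:
  fixes F :: "(real ^ 'n) set"
  assumes "aff_dim F = int CARD('n) - 1" "F \<noteq> {}" "\<nu> \<noteq> 0" "\<And>y. y \<in> F \<Longrightarrow> \<nu> \<bullet> y = h"
  shows "affine hull F = {x. \<nu> \<bullet> x = h}"
proof (rule affine_dim_equal)
  show "affine hull F \<subseteq> {x. \<nu> \<bullet> x = h}"
    by (rule hull_minimal) (use assms affine_hyperplane in auto)
qed (use assms affine_hyperplane in auto)

text \<open>Both hyperplanes are the affine hull of \<open>F\<close>. The part \<open>w\<close> of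
  \<open>\<eta>\<close> orthogonal to \<open>\<nu>\<close> is a direction inside it, hence
  orthogonal to \<open>\<eta>\<close> too, which forces \<open>w = 0\<close>.\<close>

lemma unit_normals_parallel:
  fixes F :: "(real ^ 'n) set"
  assumes F: "aff_dim F = int CARD('n) - 1" "F \<noteq> {}"
    and n: "norm \<nu> = 1" "\<And>y. y \<in> F \<Longrightarrow> \<nu> \<bullet> y = h"
    and m: "norm \<eta> = 1" "\<And>y. y \<in> F \<Longrightarrow> \<eta> \<bullet> y = g"
  shows "\<eta> = \<nu> \<or> \<eta> = - \<nu>"
proof -
  obtain y where y: "y \<in> F" using F by auto
  have eq: "{x. \<nu> \<bullet> x = h} = {x. \<eta> \<bullet> x = g}"
  proof -
    have "\<nu> \<noteq> 0" "\<eta> \<noteq> 0" using n(1) m(1) by auto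
    then show ?thesis
      using affine_hull_eq_hyperplane[OF F _ n(2)] affine_hull_eq_hyperplane[OF F _ m(2)] by metis
  qed
  have \<nu>\<nu>: "\<nu> \<bullet> \<nu> = 1" using n(1) by (simp add: dot_square_norm)
  define w where "w = \<eta> - (\<nu> \<bullet> \<eta>) *\<^sub>R \<nu>"
  have "\<nu> \<bullet> w = 0" by (simp add: w_def inner_diff_right \<nu>\<nu>)
  then have "y + w \<in> {x. \<nu> \<bullet> x = h}" using y n by (simp add: inner_add_right)
  then have "\<eta> \<bullet> w = 0" unfolding eq using m y by (simp add: inner_add_right)
  then have "w \<bullet> w = 0" using \<open>\<nu> \<bullet> w = 0\<close> by (subst (1) w_def) (simp add: inner_diff_left)
  then have e: "\<eta> = (\<nu> \<bullet> \<eta>) *\<^sub>R \<nu>" by (simp add: w_def)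
  then have "norm \<eta> = \<bar>\<nu> \<bullet> \<eta>\<bar>" using n(1) by (metis mult.right_neutral norm_scaleR)
  then have "\<nu> \<bullet> \<eta> = 1 \<or> \<nu> \<bullet> \<eta> = - 1" using m(1) by auto
  then show ?thesis using e by (metis scaleR_minus1_left scaleR_one)
qed

text \<open>Makes the definite description meaningful. A facet of a polyhedron is cut out by a
  supporting hyperplane, which gives existence. A second unit normal could only be the opposite one,
  and both together would squeeze \<open>K\<close> into a hyperplane although it has interior
  points.\<close>

lemma outward_normal:
  fixes K :: "(real ^ 'n) set"
  assumes K: "int CARD('n) simplex K" and F: "F facet_of K"
  shows "norm (outward_normal K F) = 1"
    "\<And>x y. x \<in> K \<Longrightarrow> y \<in> F \<Longrightarrow> outward_normal K F \<bullet> x \<le> outward_normal K F \<bullet> y"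
proof -
  define Q where "Q \<nu> \<longleftrightarrow> norm \<nu> = 1 \<and> (\<forall>x\<in>K. \<forall>y\<in>F. \<nu> \<bullet> x \<le> \<nu> \<bullet> y)" for \<nu>
  note FK = facet_of_full_simplex[OF K F] and Kf = full_simplex[OF K]
  obtain y where y: "y \<in> F" using FK by auto
  have const: "\<nu> \<bullet> x = \<nu> \<bullet> y" if "Q \<nu>" "x \<in> F" for \<nu> x
    using that y FK(1) unfolding Q_def by (intro order.antisym) auto
  have "\<exists>!\<nu>. Q \<nu>"
  proof (rule ex_ex1I)
    obtain a b where ab: "a \<noteq> 0" "K \<subseteq> {x. a \<bullet> x \<le> b}" "F = K \<inter> {x. a \<bullet> x = b}"
      using facet_of_polyhedron[OF Kf(3) F] by metis
    have "Q (a /\<^sub>R norm a)"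
      using ab by (auto simp: Q_def field_simps)
    then show "\<exists>\<nu>. Q \<nu>" ..
  next
    fix \<nu> \<eta> assume Q: "Q \<nu>" "Q \<eta>"
    have "\<eta> = \<nu> \<or> \<eta> = - \<nu>"
      by (rule unit_normals_parallel[OF FK(5,2) _ const[OF Q(1)] _ const[OF Q(2)]])
        (use Q in \<open>simp_all add: Q_def\<close>)
    moreover have "\<eta> \<noteq> - \<nu>"
    proof
      assume e: "\<eta> = - \<nu>"
      have "K \<subseteq> {x. \<nu> \<bullet> x = \<nu> \<bullet> y}"
        using Q y unfolding Q_def e by (auto intro: order.antisym)
      then have "interior K \<subseteq> interior {x. \<nu> \<bullet> x = \<nu> \<bullet> y}" by (rule interior_mono)
      moreover have "\<nu> \<noteq> 0" using Q by (auto simp: Q_def)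
      ultimately show False using Kf(5) by (simp add: interior_hyperplane)
    qed
    ultimately show "\<nu> = \<eta>" by auto
  qed
  from theI'[OF this] have "Q (outward_normal K F)"
    unfolding outward_normal_def Q_def .
  then show "norm (outward_normal K F) = 1"
    "\<And>x y. x \<in> K \<Longrightarrow> y \<in> F \<Longrightarrow> outward_normal K F \<bullet> x \<le> outward_normal K F \<bullet> y"
    by (auto simp: Q_def)
qed

lemma outward_normal_const:
  fixes K :: "(real ^ 'n) set"
  assumes K: "int CARD('n) simplex K" and F: "F facet_of K" and "x \<in> F" "y \<in> F"
  shows "outward_normal K F \<bullet> x = outward_normal K F \<bullet> y"
  using outward_normal(2)[OF K F] facet_of_full_simplex(1)[OF K F] assms(3,4)
  by (intro order.antisym) auto

lemma outward_normal_interior: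
  fixes K :: "(real ^ 'n) set"
  assumes K: "int CARD('n) simplex K" and F: "F facet_of K" and z: "z \<in> interior K" and y: "y \<in> F"
  shows "outward_normal K F \<bullet> z < outward_normal K F \<bullet> y"
proof -
  let ?\<nu> = "outward_normal K F"
  have "K \<subseteq> {x. ?\<nu> \<bullet> x \<le> ?\<nu> \<bullet> y}" using outward_normal(2)[OF K F _ y] by auto
  then have "interior K \<subseteq> interior {x. ?\<nu> \<bullet> x \<le> ?\<nu> \<bullet> y}" by (rule interior_mono)
  moreover have "?\<nu> \<noteq> 0" using outward_normal(1)[OF K F] by auto
  ultimately show ?thesis using z by (auto simp: interior_halfspace_le)
qed

text \<open>A point \<open>p\<close> on the inner side lies between a fixed interior point
  \<open>z\<close> and the point \<open>f\<close> where the ray from \<open>z\<close> through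
  \<open>p\<close> meets the hyperplane of \<open>F\<close>. For \<open>p\<close> close to
  \<open>y\<close>, \<open>f\<close> stays in \<open>F\<close>, and convexity puts \<open>p\<close>
  into \<open>K\<close>. This serves to show that two simplices on the same side of a facet
  overlap.\<close>

lemma simplex_contains_half_ball:
  fixes K :: "(real ^ 'n) set"
  assumes K: "int CARD('n) simplex K" and F: "F facet_of K" and y: "y \<in> rel_interior F"
  obtains d where "0 < d"
    "\<And>p. dist p y < d \<Longrightarrow> outward_normal K F \<bullet> p \<le> outward_normal K F \<bullet> y \<Longrightarrow> p \<in> K"
proof -
  define \<nu> where "\<nu> = outward_normal K F"
  note FK = facet_of_full_simplex[OF K F] and Kf = full_simplex[OF K]
  have nu1: "norm \<nu> = 1" using outward_normal(1)[OF K F] by (simp add: \<nu>_def)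
  have yF: "y \<in> F" using y rel_interior_subset by auto
  obtain z where z: "z \<in> interior K" using Kf(5) by auto
  then have zK: "z \<in> K" using interior_subset by auto
  define h where "h = \<nu> \<bullet> y"
  define g where "g = h - \<nu> \<bullet> z"
  have g: "0 < g" using outward_normal_interior[OF K F z yF] by (simp add: g_def h_def \<nu>_def)
  have hull: "affine hull F = {x. \<nu> \<bullet> x = h}"
    by (rule affine_hull_eq_hyperplane[OF FK(5,2)])
      (use nu1 outward_normal_const[OF K F _ yF] in \<open>auto simp: \<nu>_def h_def\<close>)
  obtain e where e: "0 < e" "ball y e \<inter> affine hull F \<subseteq> F" using y by (auto simp: mem_rel_interior_ball)
  define D where "D = norm (y - z)"
  define c where "c = 1 + 2 * (D + 1) / g"
  have c: "0 < c" using g by (auto simp: c_def D_def intro!: add_pos_nonneg)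
  \<comment> \<open>The three bounds serve, in order, \<open>norm (p - z) \<le> D + 1\<close>, the
    weight \<open>s \<le> 1 / 2\<close>, and \<open>norm (f - y) < e\<close>: the point
    \<open>f\<close> is at most \<open>c\<close> times as far from \<open>y\<close> as
    \<open>p\<close> is.\<close>
  define d where "d = min 1 (min (g / 2) (e / c))"
  have d: "0 < d" "d \<le> 1" "d \<le> g / 2" "d \<le> e / c" using g e c unfolding d_def by (simp, linarith, linarith, linarith)
  show thesis
  proof (rule that[OF d(1)])
    fix p assume p: "dist p y < d" "outward_normal K F \<bullet> p \<le> outward_normal K F \<bullet> y"
    define t where "t = h - \<nu> \<bullet> p"
    have t0: "0 \<le> t" using p by (simp add: t_def h_def \<nu>_def)
    have "t = \<nu> \<bullet> (y - p)" by (simp add: t_def h_def inner_diff_right)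
    also have "\<dots> \<le> norm \<nu> * norm (y - p)" by (rule norm_cauchy_schwarz)
    also have "\<dots> = dist p y" using nu1 by (simp add: dist_norm norm_minus_commute)
    finally have t: "t \<le> dist p y" .
    \<comment> \<open>\<open>t\<close> and \<open>g\<close> are the distances of \<open>p\<close>
      and \<open>z\<close> from the hyperplane of \<open>F\<close>, so \<open>s\<close> is the
      weight for which \<open>p = (1 - s) *\<^sub>R f + s *\<^sub>R z\<close>.\<close>
    define s where "s = t / g"
    have s0: "0 \<le> s" using t0 g by (simp add: s_def)
    have "t \<le> g / 2" using t p(1) d(3) by linarith
    then have s2: "s \<le> 1 / 2" using g by (simp add: s_def)
    define f where "f = p + (s / (1 - s)) *\<^sub>R (p - z)"
    have "\<nu> \<bullet> f = (h - t) + (s / (1 - s)) * (g - t)"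
      by (simp add: f_def inner_add_right inner_diff_right t_def g_def)
    also have "\<dots> = h"
    proof -
      have "t = s * g" using g by (simp add: s_def)
      then have "g - t = g * (1 - s)" by (simp add: algebra_simps)
      then have "(s / (1 - s)) * (g - t) = s * g" using s2 by simp
      then show ?thesis using \<open>t = s * g\<close> by simp
    qed
    finally have f_hull: "f \<in> affine hull F" using hull by simp
    have "norm (f - y) \<le> norm (p - y) + norm ((s / (1 - s)) *\<^sub>R (p - z))"
      using norm_triangle_ineq[of "p - y" "(s / (1 - s)) *\<^sub>R (p - z)"] by (simp add: f_def algebra_simps)
    also have "norm ((s / (1 - s)) *\<^sub>R (p - z)) = (s / (1 - s)) * norm (p - z)"
      using s0 s2 by simp
    also have "\<dots> \<le> (2 * s) * (D + 1)"
    proof (rule mult_mono)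
      have "s * 1 \<le> s * (2 * (1 - s))" by (rule mult_left_mono) (use s0 s2 in auto)
      then show "s / (1 - s) \<le> 2 * s" using s2 by (simp add: field_simps)
      have "norm (p - z) \<le> norm (p - y) + norm (y - z)" using norm_triangle_ineq[of "p - y" "y - z"] by simp
      then show "norm (p - z) \<le> D + 1" using p d by (simp add: D_def dist_norm)
    qed (use s0 in auto)
    also have "\<dots> \<le> 2 * (dist p y / g) * (D + 1)"
      using t g by (intro mult_right_mono mult_left_mono) (auto simp: s_def D_def divide_right_mono)
    also have "norm (p - y) + 2 * (dist p y / g) * (D + 1) = dist p y * c"
      by (simp add: c_def dist_norm field_simps)
    also have "\<dots> < d * c" using p c by (intro mult_strict_right_mono)
    also have "\<dots> \<le> e" using d(4) c by (simp add: field_simps)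
    finally have "f \<in> ball y e" by (simp add: dist_norm norm_minus_commute)
    then have "f \<in> K" using f_hull e FK(1) by auto
    then have "(1 - s) *\<^sub>R f + s *\<^sub>R z \<in> K"
      using convexD_alt[OF Kf(2) _ zK, of f s] s0 s2 by auto
    moreover have "(1 - s) *\<^sub>R f + s *\<^sub>R z = p"
    proof -
      have "(1 - s) *\<^sub>R f = (1 - s) *\<^sub>R p + s *\<^sub>R (p - z)"
        using s2 by (simp add: f_def scaleR_add_right)
      then show ?thesis by (simp add: algebra_simps)
    qed
    ultimately show "p \<in> K" by simp
  qed
qed

section \<open>Prisms and the measure of facets\<close>

definition prism :: "real ^ 'n \<Rightarrow> (real ^ 'n) set \<Rightarrow> (real ^ 'n) set" where
  "prism \<nu> F = {x + t *\<^sub>R \<nu> | x t. x \<in> F \<and> 0 \<le> t \<and> t \<le> 1}"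

lemma prismI: "x \<in> F \<Longrightarrow> 0 \<le> t \<Longrightarrow> t \<le> 1 \<Longrightarrow> z = x + t *\<^sub>R \<nu> \<Longrightarrow> z \<in> prism \<nu> F"
  unfolding prism_def by blast

lemma prism_image: "prism \<nu> F = (\<lambda>(x, t). x + t *\<^sub>R \<nu>) ` (F \<times> {0..1})"
proof (intro equalityI subsetI)
  fix z assume "z \<in> prism \<nu> F"
  then obtain x t where "x \<in> F" "0 \<le> t" "t \<le> 1" "z = x + t *\<^sub>R \<nu>" unfolding prism_def by blast
  then show "z \<in> (\<lambda>(x, t). x + t *\<^sub>R \<nu>) ` (F \<times> {0..1})" by (intro image_eqI[of _ _ "(x, t)"]) auto
qed (auto intro: prismI)

lemma compact_prism: "compact F \<Longrightarrow> compact (prism \<nu> F)"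
  unfolding prism_image
  unfolding case_prod_unfold
  by (rule compact_continuous_image[OF _ compact_Times[OF _ compact_Icc]]) (intro continuous_intros)

lemma convex_prism: "convex F \<Longrightarrow> convex (prism \<nu> F)"
proof -
  assume F: "convex F"
  have "linear (\<lambda>(x, t). x + t *\<^sub>R \<nu>)"
    by (auto intro!: linearI simp: algebra_simps)
  then show ?thesis unfolding prism_image by (intro convex_linear_image convex_Times F convex_real_interval)
qed

text \<open>Lifting one point of \<open>F\<close> by \<open>\<nu>\<close> leaves the hyperplane, so
  the prism has full affine dimension; being convex, it has interior points.\<close>

lemma measure_prism_pos:
  fixes F :: "(real ^ 'n) set"
  assumes F: "aff_dim F = int CARD('n) - 1" "F \<noteq> {}" "convex F" "compact F"
    and n: "norm \<nu> = 1" "\<And>y. y \<in> F \<Longrightarrow> \<nu> \<bullet> y = h"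
  shows "0 < measure lebesgue (prism \<nu> F)"
proof -
  obtain y where y: "y \<in> F" using F by auto
  have "\<nu> \<bullet> \<nu> = 1" using n(1) by (simp add: dot_square_norm)
  then have "y + \<nu> \<notin> affine hull F"
    using affine_hull_eq_hyperplane[OF F(1,2), of \<nu> h] n y by (cases "\<nu> = 0") (auto simp: inner_add_right)
  then have d: "aff_dim (insert (y + \<nu>) F) = int CARD('n)" using F by (simp add: aff_dim_insert)
  have "insert (y + \<nu>) F \<subseteq> prism \<nu> F"
  proof -
    have "y + \<nu> \<in> prism \<nu> F" by (rule prismI[OF y, of 1]) auto
    moreover have "x \<in> prism \<nu> F" if "x \<in> F" for x by (rule prismI[OF that, of 0]) auto
    ultimately show ?thesis by auto
  qed
  then have "int CARD('n) \<le> aff_dim (prism \<nu> F)" using aff_dim_subset d by metis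
  moreover have "aff_dim (prism \<nu> F) \<le> int CARD('n)" using aff_dim_le_DIM[of "prism \<nu> F"] by simp
  ultimately have "affine hull (prism \<nu> F) = UNIV" using aff_dim_eq_full[of "prism \<nu> F"] by simp
  then have "rel_interior (prism \<nu> F) = interior (prism \<nu> F)" by (rule rel_interior_interior)
  moreover have "prism \<nu> F \<noteq> {}" using \<open>insert (y + \<nu>) F \<subseteq> prism \<nu> F\<close> by auto
  ultimately have "interior (prism \<nu> F) \<noteq> {}" using rel_interior_eq_empty[OF convex_prism[OF F(3)]] by metis
  then have "\<not> negligible (prism \<nu> F)" using negligible_convex_interior[OF convex_prism[OF F(3)]] by simp
  then have "measure lebesgue (prism \<nu> F) \<noteq> 0"
    using negligible_iff_measure0[OF lmeasurable_compact[OF compact_prism[OF F(4)]]] by blast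
  then show ?thesis using measure_nonneg[of lebesgue "prism \<nu> F"] by linarith
qed

text \<open>Two elements see a common facet with opposite normals but have to give it the same
  measure. The two prisms differ by the translation by \<open>\<nu>\<close>, with \<open>t\<close>
  replaced by \<open>1 - t\<close>.\<close>

lemma measure_prism_uminus: "measure lebesgue (prism (- \<nu>) F) = measure lebesgue (prism \<nu> F)"
proof -
  have "prism (- \<nu>) F = (\<lambda>x. x - \<nu>) ` prism \<nu> F"
  proof (intro equalityI subsetI)
    fix z assume "z \<in> prism (- \<nu>) F"
    then obtain x t where z: "z = x + t *\<^sub>R - \<nu>" "x \<in> F" "0 \<le> t" "t \<le> 1" unfolding prism_def by blast
    have "x + (1 - t) *\<^sub>R \<nu> \<in> prism \<nu> F" by (rule prismI[of x _ "1 - t"]) (use z in auto)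
    moreover have "z = (x + (1 - t) *\<^sub>R \<nu>) - \<nu>" using z by (simp add: algebra_simps)
    ultimately show "z \<in> (\<lambda>x. x - \<nu>) ` prism \<nu> F" by blast
  next
    fix z assume "z \<in> (\<lambda>x. x - \<nu>) ` prism \<nu> F"
    then obtain x t where z: "z = x + t *\<^sub>R \<nu> - \<nu>" "x \<in> F" "0 \<le> t" "t \<le> 1" unfolding prism_def by blast
    then show "z \<in> prism (- \<nu>) F" by (intro prismI[of x _ "1 - t"]) (auto simp: algebra_simps)
  qed
  then show ?thesis by (simp add: measure_translation_subtract)
qed

lemma surface_integral_const:
  assumes F: "compact F" "F \<noteq> {}" and c: "\<And>x. x \<in> F \<Longrightarrow> f x = c"
  shows "surface_integral \<nu> F f = c * measure lebesgue (prism \<nu> F)"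
proof -
  have "f (closest_point F y) = c" for y
    using closest_point_in_set[OF compact_imp_closed[OF F(1)] F(2)] c by blast
  then have "surface_integral \<nu> F f = (LINT y:prism \<nu> F|lebesgue. c)"
    by (simp add: surface_integral_def prism_def)
  also have "\<dots> = measure lebesgue (prism \<nu> F) *\<^sub>R c"
    by (simp add: set_lebesgue_integral_def)
  finally show ?thesis by simp
qed

definition facet_measure :: "(real ^ 'n) set \<Rightarrow> (real ^ 'n) set \<Rightarrow> real" where
  "facet_measure K F = measure lebesgue (prism (outward_normal K F) F)"

text \<open>The signed distance of the hyperplane of \<open>F\<close> from the origin. The point is
  chosen from \<open>F\<close> alone, so opposite normals give opposite heights at once.\<close>

definition facet_height :: "(real ^ 'n) set \<Rightarrow> (real ^ 'n) set \<Rightarrow> real" where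
  "facet_height K F = outward_normal K F \<bullet> (SOME y. y \<in> F)"

lemma facet_height:
  fixes K :: "(real ^ 'n) set"
  assumes K: "int CARD('n) simplex K" and F: "F facet_of K" and "y \<in> F"
  shows "facet_height K F = outward_normal K F \<bullet> y"
  unfolding facet_height_def
  by (rule outward_normal_const[OF K F someI[of "\<lambda>y. y \<in> F", OF assms(3)] assms(3)])

lemma facet_measure_pos:
  fixes K :: "(real ^ 'n) set"
  assumes K: "int CARD('n) simplex K" and F: "F facet_of K"
  shows "0 < facet_measure K F"
  unfolding facet_measure_def
  by (rule measure_prism_pos[where h = "facet_height K F"])
    (use facet_of_full_simplex[OF K F] outward_normal(1)[OF K F] facet_height[OF K F, symmetric] in auto)

text \<open>The normal component of a Raviart-Thomas field of lowest order is constant on each facet.\<close>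

lemma boundary_integral_RT0:
  fixes K :: "(real ^ 'n) set"
  assumes K: "int CARD('n) simplex K"
  shows "boundary_integral K (\<lambda>F \<nu> x. w F * ((a + b *\<^sub>R x) \<bullet> \<nu>)) =
    (\<Sum>F | F facet_of K. w F * (a \<bullet> outward_normal K F + b * facet_height K F) * facet_measure K F)"
  unfolding boundary_integral_def
proof (rule sum.cong)
  fix F assume "F \<in> {F. F facet_of K}"
  then have F: "F facet_of K" by simp
  show "surface_integral (outward_normal K F) F (\<lambda>x. w F * ((a + b *\<^sub>R x) \<bullet> outward_normal K F)) =
    w F * (a \<bullet> outward_normal K F + b * facet_height K F) * facet_measure K F"
    unfolding facet_measure_def
    by (rule surface_integral_const)
      (use facet_of_full_simplex[OF K F] in \<open>auto simp: facet_height[OF K F, symmetric] inner_add_right inner_commute[of _ "outward_normal K F"]\<close>)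
qed simp


section \<open>Weak gradients on a simplicial mesh\<close>

text \<open>Both simplices contain a half ball on the same side of \<open>F\<close>, so their
  interiors meet. A face containing an interior point of a simplex is the whole simplex, and
  \<open>K \<inter> K'\<close> is such a face of both.\<close>

lemma simplex_eq_of_same_side:
  fixes K K' :: "(real ^ 'n) set"
  assumes K: "int CARD('n) simplex K" "F facet_of K" and K': "int CARD('n) simplex K'" "F facet_of K'"
    and faces: "K \<inter> K' face_of K" "K \<inter> K' face_of K'"
    and eq: "outward_normal K' F = outward_normal K F"
  shows "K = K'"
proof -
  define \<nu> where "\<nu> = outward_normal K F"
  have nu: "norm \<nu> = 1" using outward_normal(1)[OF K] by (simp add: \<nu>_def)
  then have \<nu>\<nu>: "\<nu> \<bullet> \<nu> = 1" by (simp add: dot_square_norm)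
  have "rel_interior F \<noteq> {}" using rel_interior_eq_empty facet_of_full_simplex[OF K] by metis
  then obtain y where y: "y \<in> rel_interior F" by auto
  obtain d where d: "0 < d" "\<And>p. dist p y < d \<Longrightarrow> \<nu> \<bullet> p \<le> \<nu> \<bullet> y \<Longrightarrow> p \<in> K"
    using simplex_contains_half_ball[OF K y] unfolding \<nu>_def by metis
  obtain d' where d': "0 < d'" "\<And>p. dist p y < d' \<Longrightarrow> \<nu> \<bullet> p \<le> \<nu> \<bullet> y \<Longrightarrow> p \<in> K'"
    using simplex_contains_half_ball[OF K' y] unfolding eq \<nu>_def by metis
  define e where "e = min d d'"
  have e: "0 < e" "e \<le> d" "e \<le> d'" using d d' by (auto simp: e_def)
  define U where "U = ball y e \<inter> {x. \<nu> \<bullet> x < \<nu> \<bullet> y}"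
  have "open U" by (simp add: U_def open_Int open_halfspace_lt)
  have U: "U \<subseteq> K" "U \<subseteq> K'"
    using d(2) d'(2) e by (auto simp: U_def dist_commute)
  define p where "p = y - (e / 2) *\<^sub>R \<nu>"
  have "p \<in> U" using e nu \<nu>\<nu> by (simp add: U_def p_def dist_norm inner_diff_right)
  then have p: "p \<in> interior K" "p \<in> interior K'" "p \<in> K \<inter> K'"
    using U \<open>open U\<close> by (auto intro: interiorI)
  have "K \<inter> K' = K" using face_of_disjoint_interior[OF faces(1)] p by blast
  moreover have "K \<inter> K' = K'" using face_of_disjoint_interior[OF faces(2)] p by blast
  ultimately show ?thesis by simp
qed

lemma simplicial_meshD:
  fixes \<Omega> :: "(real ^ 'n) set"
  assumes "simplicial_mesh \<Omega> T"
  shows "finite T" "\<And>K. K \<in> T \<Longrightarrow> int CARD('n) simplex K" "\<Union>T = closure \<Omega>"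
    "\<And>K K'. K \<in> T \<Longrightarrow> K' \<in> T \<Longrightarrow> K \<inter> K' face_of K"
    "\<And>K K'. K \<in> T \<Longrightarrow> K' \<in> T \<Longrightarrow> K \<inter> K' face_of K'"
proof -
  show "finite T" "\<And>K. K \<in> T \<Longrightarrow> int CARD('n) simplex K" "\<Union>T = closure \<Omega>"
    and *: "\<And>K K'. K \<in> T \<Longrightarrow> K' \<in> T \<Longrightarrow> K \<inter> K' face_of K"
    using assms unfolding simplicial_mesh_def triangulation_def by auto
  show "\<And>K K'. K \<in> T \<Longrightarrow> K' \<in> T \<Longrightarrow> K \<inter> K' face_of K'" using * by (metis Int_commute)
qed

lemma opposite_normals:
  fixes \<Omega> :: "(real ^ 'n) set"
  assumes mesh: "simplicial_mesh \<Omega> T" and K: "K \<in> T" "F facet_of K" and K': "K' \<in> T" "F facet_of K'"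
    and ne: "K \<noteq> K'"
  shows "outward_normal K' F = - outward_normal K F"
proof -
  note m = simplicial_meshD[OF mesh]
  note FK = facet_of_full_simplex[OF m(2)[OF K(1)] K(2)]
  obtain y where y: "y \<in> F" using FK by auto
  have "outward_normal K' F = outward_normal K F \<or> outward_normal K' F = - outward_normal K F"
    by (rule unit_normals_parallel[OF FK(5,2) outward_normal(1)[OF m(2)[OF K(1)] K(2)]
      outward_normal_const[OF m(2)[OF K(1)] K(2) _ y] outward_normal(1)[OF m(2)[OF K'(1)] K'(2)]
      outward_normal_const[OF m(2)[OF K'(1)] K'(2) _ y]])
  moreover have "outward_normal K' F \<noteq> outward_normal K F"
    using simplex_eq_of_same_side[OF m(2)[OF K(1)] K(2) m(2)[OF K'(1)] K'(2) m(4,5)[OF K(1) K'(1)]] ne by blast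
  ultimately show ?thesis by blast
qed

text \<open>The normals of \<open>K'\<close> and \<open>K''\<close> are both opposite to that of
  \<open>K\<close>, hence equal.\<close>

lemma neighbour_unique:
  fixes \<Omega> :: "(real ^ 'n) set"
  assumes mesh: "simplicial_mesh \<Omega> T" and K: "K \<in> T" "F facet_of K"
    and K': "K' \<in> T" "F facet_of K'" "K' \<noteq> K" and K'': "K'' \<in> T" "F facet_of K''" "K'' \<noteq> K"
  shows "K' = K''"
proof -
  note m = simplicial_meshD[OF mesh]
  have "outward_normal K'' F = outward_normal K' F"
    using opposite_normals[OF mesh K K'(1,2) K'(3)[symmetric]] opposite_normals[OF mesh K K''(1,2) K''(3)[symmetric]]
    by simp
  then show ?thesis
    by (rule simplex_eq_of_same_side[OF m(2)[OF K'(1)] K'(2) m(2)[OF K''(1)] K''(2) m(4,5)[OF K'(1) K''(1)]])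
qed

text \<open>The mesh fills \<open>closure \<Omega>\<close>, so crossing \<open>F\<close> from
  \<open>K\<close> at a point inside \<open>\<Omega>\<close> leads into another element
  \<open>K'\<close>. Compatibility of the triangulation makes \<open>K \<inter> K'\<close> a common
  face, and by dimension that face is \<open>F\<close>.\<close>

lemma neighbour_exists:
  fixes \<Omega> :: "(real ^ 'n) set"
  assumes mesh: "simplicial_mesh \<Omega> T" and "open \<Omega>"
    and K: "K \<in> T" "F facet_of K" and F: "F \<in> interior_facets \<Omega> T"
  shows "\<exists>K'\<in>T. K' \<noteq> K \<and> F facet_of K'"
proof -
  note m = simplicial_meshD[OF mesh]
  note sK = m(2)[OF K(1)]
  note FK = facet_of_full_simplex[OF sK K(2)]
  define \<nu> where "\<nu> = outward_normal K F"
  have nu: "norm \<nu> = 1" using outward_normal(1)[OF sK K(2)] by (simp add: \<nu>_def)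
  then have \<nu>\<nu>: "\<nu> \<bullet> \<nu> = 1" by (simp add: dot_square_norm)
  obtain x where x: "x \<in> F" "x \<notin> frontier \<Omega>" using F by (auto simp: interior_facets_def)
  have "x \<in> closure \<Omega>" using x FK(1) K(1) m(3) by auto
  then have "x \<in> \<Omega>" using x \<open>open \<Omega>\<close> by (auto simp: frontier_def interior_open)
  \<comment> \<open>A facet counts as interior as soon as one of its points is off the boundary of
    \<open>\<Omega>\<close>. Since \<open>\<Omega>\<close> is open and the relative interior is
    dense in \<open>F\<close>, such a point can be found in the relative interior.\<close>
  have "x \<in> closure (rel_interior F)" using x convex_closure_rel_interior[OF FK(3)] closure_subset by auto
  then have "\<Omega> \<inter> rel_interior F \<noteq> {}"
    using open_Int_closure_eq_empty[OF \<open>open \<Omega>\<close>, of "rel_interior F"] \<open>x \<in> \<Omega>\<close> by auto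
  then obtain y where y: "y \<in> \<Omega>" "y \<in> rel_interior F" by auto
  have yF: "y \<in> F" using y(2) rel_interior_subset by auto
  \<comment> \<open>The elements avoiding \<open>y\<close> have a closed union. A ball around
    \<open>y\<close> that misses it forces the element found at \<open>p\<close> to contain
    \<open>y\<close> as well.\<close>
  define T0 where "T0 = {K' \<in> T. y \<notin> K'}"
  have "closed (\<Union>T0)"
    by (rule closed_Union) (use m(1,2) closed_simplex in \<open>auto simp: T0_def\<close>)
  then have "open (\<Omega> - \<Union>T0)" using \<open>open \<Omega>\<close> by (rule open_Diff[rotated])
  moreover have "y \<in> \<Omega> - \<Union>T0" using y by (auto simp: T0_def)
  ultimately obtain e where e: "0 < e" "ball y e \<subseteq> \<Omega> - \<Union>T0" by (meson open_contains_ball)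
  define p where "p = y + (e / 2) *\<^sub>R \<nu>"
  have "p \<in> ball y e" using e nu by (simp add: p_def dist_norm)
  then have p: "p \<in> \<Omega>" "p \<notin> \<Union>T0" using e by auto
  then have "p \<in> \<Union>T" using m(3) subsetD[OF closure_subset] by blast
  then obtain K' where K': "K' \<in> T" "p \<in> K'" by auto
  then have yK': "y \<in> K'" using p by (auto simp: T0_def)
  have "\<nu> \<bullet> y < \<nu> \<bullet> p" using e \<nu>\<nu> by (simp add: p_def inner_add_right)
  then have "p \<notin> K" using outward_normal(2)[OF sK K(2) _ yF, of p] by (auto simp: \<nu>_def)
  note sK' = m(2)[OF K'(1)]
  define G where "G = K \<inter> K'"
  have G: "G face_of K" "G face_of K'" using m(4,5)[OF K(1) K'(1)] by (auto simp: G_def)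
  \<comment> \<open>A face of \<open>K\<close> that meets the relative interior of \<open>F\<close>,
    here at \<open>y\<close>, contains all of \<open>F\<close>.\<close>
  have "F \<subseteq> G"
    by (rule subset_of_face_of[OF G(1) FK(1)]) (use y yF yK' FK(1) in \<open>auto simp: G_def\<close>)
  have "G \<noteq> K"
  proof
    assume "G = K"
    then have KK': "K face_of K'" "K \<noteq> K'" using G(2) K'(2) \<open>p \<notin> K\<close> by auto
    have "aff_dim K < aff_dim K'" by (rule face_of_aff_dim_lt[OF full_simplex(2)[OF sK'] KK'])
    then show False using full_simplex(4)[OF sK] full_simplex(4)[OF sK'] by simp
  qed
  then have "aff_dim G < aff_dim K" by (rule face_of_aff_dim_lt[OF full_simplex(2)[OF sK] G(1)])
  then have aG: "aff_dim G \<le> int CARD('n) - 1" using full_simplex(4)[OF sK] by simp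
  have "F = G"
  proof (rule ccontr)
    assume "F \<noteq> G"
    have "F face_of G"
      by (rule face_of_subset[OF facet_of_imp_face_of[OF K(2)] \<open>F \<subseteq> G\<close>]) (auto simp: G_def)
    then have "aff_dim F < aff_dim G"
      by (rule face_of_aff_dim_lt[OF face_of_imp_convex[OF G(1)] _ \<open>F \<noteq> G\<close>])
    then show False using FK(5) aG by simp
  qed
  then have "F facet_of K'"
    using G(2) FK(2,5) full_simplex(4)[OF sK'] by (simp add: facet_of_def)
  then show ?thesis using K' \<open>p \<notin> K\<close> by blast
qed

section \<open>The L2 product on Raviart-Thomas fields\<close>

lemma set_integrable_continuous:
  fixes f :: "'a::euclidean_space \<Rightarrow> 'b::euclidean_space"
  assumes "compact K" "continuous_on K f"
  shows "set_integrable lebesgue K f"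
proof -
  have i: "integrable lborel (\<lambda>x. indicator K x *\<^sub>R f x)" by (rule borel_integrable_compact[OF assms])
  then have "(\<lambda>x. indicator K x *\<^sub>R f x) \<in> borel_measurable lborel" by (rule borel_measurable_integrable)
  then show ?thesis unfolding set_integrable_def using i integrable_completion by blast
qed

lemma L2_inner_const:
  fixes c e :: "'b::real_inner"
  shows "L2_inner K (\<lambda>x. c) (\<lambda>x. e) = (c \<bullet> e) * measure lebesgue K"
  by (simp add: L2_inner_def set_lebesgue_integral_def)

lemma L2_inner_nonneg: "0 \<le> L2_inner K f f"
  unfolding L2_inner_def set_lebesgue_integral_def
  by (rule Bochner_Integration.integral_nonneg) (simp add: indicator_def)

lemma L2_inner_commute: "L2_inner K f g = L2_inner K g f"
  by (simp add: L2_inner_def inner_commute)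

text \<open>Measured from the centroid, constants and radial fields are orthogonal.\<close>

lemma L2_inner_RT0:
  fixes K :: "(real ^ 'n) set"
  assumes K: "int CARD('n) simplex K"
  obtains s z where "0 < s"
    "\<forall>a b a' b'. L2_inner K (\<lambda>x. a + b *\<^sub>R (x - z)) (\<lambda>x. a' + b' *\<^sub>R (x - z)) =
       measure lebesgue K * (a \<bullet> a') + s * (b * b')"
proof -
  note Kf = full_simplex[OF K]
  let ?m = "measure lebesgue K"
  have int: "set_integrable lebesgue K f" if "continuous_on K f" for f :: "real ^ 'n \<Rightarrow> 'c::euclidean_space"
    using set_integrable_continuous[OF Kf(1) that] .
  define z where "z = (LINT x:K|lebesgue. x) /\<^sub>R ?m"
  have const: "(LINT x:K|lebesgue. c) = ?m *\<^sub>R c" for c :: "'c::euclidean_space"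
  proof -
    have "integrable lebesgue (indicat_real K)"
      using int[of "\<lambda>x. 1::real"] by (simp add: set_integrable_def)
    then show ?thesis by (simp add: set_lebesgue_integral_def)
  qed
  have "(LINT x:K|lebesgue. x - z) = (LINT x:K|lebesgue. x) - (LINT x:K|lebesgue. z)"
    by (rule set_integral_diff) (auto intro!: int continuous_intros)
  also have "\<dots> = 0" using Kf(6) by (simp add: const z_def)
  finally have z0: "(LINT x:K|lebesgue. x - z) = 0" .
  have lin: "(LINT x:K|lebesgue. c \<bullet> (x - z)) = 0" for c
  proof -
    have i: "set_integrable lebesgue K (\<lambda>x. x - z)" by (auto intro!: int continuous_intros)
    have "(LINT x:K|lebesgue. c \<bullet> (x - z)) = (LINT x|lebesgue. c \<bullet> (indicator K x *\<^sub>R (x - z)))"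
      by (simp add: set_lebesgue_integral_def)
    also have "\<dots> = c \<bullet> (LINT x:K|lebesgue. x - z)"
      using i unfolding set_lebesgue_integral_def set_integrable_def by (intro integral_inner_right)
    finally show ?thesis by (simp add: z0)
  qed
  define s where "s = (LINT x:K|lebesgue. (x - z) \<bullet> (x - z))"
  have si: "set_integrable lebesgue K (\<lambda>x. (x - z) \<bullet> (x - z))" by (auto intro!: int continuous_intros)
  have "0 \<le> s" unfolding s_def set_lebesgue_integral_def
    by (rule Bochner_Integration.integral_nonneg) (simp add: indicator_def)
  \<comment> \<open>If the second moment about \<open>z\<close> vanished, \<open>K\<close> would be
    negligible, since the integrand is positive on \<open>K\<close> except at
    \<open>z\<close>.\<close>
  moreover have "s \<noteq> 0"
  proof
    assume "s = 0"
    then have "AE x in lebesgue. indicat_real K x *\<^sub>R ((x - z) \<bullet> (x - z)) = 0"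
      using si unfolding s_def set_lebesgue_integral_def set_integrable_def
      by (subst (asm) integral_nonneg_eq_0_iff_AE) (auto simp: indicator_def)
    then have "negligible {x. indicat_real K x *\<^sub>R ((x - z) \<bullet> (x - z)) \<noteq> 0}"
      unfolding eventually_ae_filter_negligible by (auto elim: negligible_subset)
    then have "negligible (insert z {x. indicat_real K x *\<^sub>R ((x - z) \<bullet> (x - z)) \<noteq> 0})" by simp
    then have "negligible K" by (rule negligible_subset) (auto simp: indicator_def)
    then show False using negligible_convex_interior[OF Kf(2)] Kf(5) by simp
  qed
  ultimately have "0 < s" by simp
  moreover have "L2_inner K (\<lambda>x. a + b *\<^sub>R (x - z)) (\<lambda>x. a' + b' *\<^sub>R (x - z)) = ?m * (a \<bullet> a') + s * (b * b')"
    for a b a' b'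
  proof -
    have expand: "(a + b *\<^sub>R y) \<bullet> (a' + b' *\<^sub>R y) = (a \<bullet> a' + (b' *\<^sub>R a + b *\<^sub>R a') \<bullet> y) + (b * b') * (y \<bullet> y)" for y
      by (simp add: inner_add_left inner_add_right inner_commute[of y a'] distrib_left)
    have "L2_inner K (\<lambda>x. a + b *\<^sub>R (x - z)) (\<lambda>x. a' + b' *\<^sub>R (x - z)) =
      (LINT x:K|lebesgue. (a \<bullet> a' + (b' *\<^sub>R a + b *\<^sub>R a') \<bullet> (x - z)) + (b * b') * ((x - z) \<bullet> (x - z)))"
      unfolding L2_inner_def expand ..
    also have "\<dots> = (LINT x:K|lebesgue. a \<bullet> a' + (b' *\<^sub>R a + b *\<^sub>R a') \<bullet> (x - z)) +
        (LINT x:K|lebesgue. (b * b') * ((x - z) \<bullet> (x - z)))"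
      by (rule set_integral_add) (auto intro!: int continuous_intros)
    also have "(LINT x:K|lebesgue. a \<bullet> a' + (b' *\<^sub>R a + b *\<^sub>R a') \<bullet> (x - z)) =
        (LINT x:K|lebesgue. a \<bullet> a') + (LINT x:K|lebesgue. (b' *\<^sub>R a + b *\<^sub>R a') \<bullet> (x - z))"
      by (rule set_integral_add) (auto intro!: int continuous_intros)
    also have "(LINT x:K|lebesgue. (b * b') * ((x - z) \<bullet> (x - z))) = (b * b') * s"
      unfolding s_def by (rule set_integral_mult_right)
    finally show ?thesis by (simp only: lin const) (simp add: mult.commute)
  qed
  ultimately show thesis by (blast intro: that)
qed

lemma divergence_RT0: "divergence (\<lambda>x. a + b *\<^sub>R x) x = b * real CARD('n)" for a x :: "real ^ 'n"
proof -
  have "((\<lambda>x. a + b *\<^sub>R x) has_derivative (\<lambda>h. b *\<^sub>R h)) (at x)" by (auto intro!: derivative_eq_intros)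
  then have "frechet_derivative (\<lambda>x. a + b *\<^sub>R x) (at x) = (\<lambda>h. b *\<^sub>R h)"
    by (rule frechet_derivative_at[symmetric])
  then show ?thesis
    by (simp add: divergence_def jacobian_def matrix_def trace_def)
qed

lemma RT0_centered:
  fixes g :: "real ^ 'n \<Rightarrow> real ^ 'n"
  assumes "g \<in> RT0"
  obtains a b where "g = (\<lambda>x. a + b *\<^sub>R (x - z))"
proof -
  obtain a b where g: "g = (\<lambda>x. a + b *\<^sub>R x)" using assms by (auto simp: RT0_def)
  show thesis by (rule that[of "a + b *\<^sub>R z" b]) (auto simp: g algebra_simps)
qed

lemma RT0_memI: "(\<lambda>x. a + b *\<^sub>R x) \<in> RT0" "(\<lambda>x. a + b *\<^sub>R (x - z)) \<in> RT0"
proof -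
  show *: "(\<lambda>x. a + b *\<^sub>R x) \<in> RT0" for a b unfolding RT0_def by blast
  have "(\<lambda>x. a + b *\<^sub>R (x - z)) = (\<lambda>x. (a - b *\<^sub>R z) + b *\<^sub>R x)" by (auto simp: algebra_simps)
  then show "(\<lambda>x. a + b *\<^sub>R (x - z)) \<in> RT0" using * by metis
qed

lemma L2_inner_RT0_eq_0:
  fixes K :: "(real ^ 'n) set"
  assumes K: "int CARD('n) simplex K" and g: "g \<in> RT0" and 0: "L2_inner K g g = 0"
  shows "g = (\<lambda>x. 0)"
proof -
  obtain s z where s: "0 < s" and
    z: "\<forall>a b a' b'. L2_inner K (\<lambda>x. a + b *\<^sub>R (x - z)) (\<lambda>x. a' + b' *\<^sub>R (x - z)) =
       measure lebesgue K * (a \<bullet> a') + s * (b * b')"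
    by (rule L2_inner_RT0[OF K])
  obtain a b where g: "g = (\<lambda>x. a + b *\<^sub>R (x - z))" by (rule RT0_centered[OF g])
  have "measure lebesgue K * (a \<bullet> a) + s * (b * b) = 0" using 0 unfolding g z[rule_format] .
  moreover have "0 \<le> measure lebesgue K * (a \<bullet> a)" "0 \<le> s * (b * b)" using s by auto
  ultimately have "measure lebesgue K * (a \<bullet> a) = 0" "s * (b * b) = 0" by linarith+
  then have "a = 0" "b = 0" using full_simplex(6)[OF K] s by auto
  then show ?thesis by (simp add: g)
qed

text \<open>The boundary term of the weak gradient for facet values \<open>w\<close>, tested with
  the field \<open>a + b x\<close>, in the closed form given by
  \<open>boundary_integral_RT0\<close>.\<close>

definition boundary_flux :: "(real ^ 'n) set \<Rightarrow> ((real ^ 'n) set \<Rightarrow> real) \<Rightarrow> real ^ 'n \<Rightarrow> real \<Rightarrow> real" where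
  "boundary_flux K w a b =
    (\<Sum>F | F facet_of K. w F * (a \<bullet> outward_normal K F + b * facet_height K F) * facet_measure K F)"

text \<open>Riesz representation in the finite-dimensional space \<open>RT0\<close>: the right-hand
  side is a linear functional of the test field and \<open>L2_inner\<close> is definite there, which
  justifies the definite description.\<close>

lemma weak_grad:
  fixes K :: "(real ^ 'n) set"
  assumes K: "int CARD('n) simplex K"
  shows "weak_grad K u \<in> RT0"
    "L2_inner K (weak_grad K u) (\<lambda>x. a + b *\<^sub>R x) =
      boundary_flux K (snd u) a b - fst u K * (b * real CARD('n)) * measure lebesgue K"
proof -
  obtain s z where s: "0 < s" and
    z: "\<forall>a b a' b'. L2_inner K (\<lambda>x. a + b *\<^sub>R (x - z)) (\<lambda>x. a' + b' *\<^sub>R (x - z)) =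
       measure lebesgue K * (a \<bullet> a') + s * (b * b')"
    by (rule L2_inner_RT0[OF K])
  let ?m = "measure lebesgue K"
  have m: "0 < ?m" using full_simplex(6)[OF K] .
  define Q where "Q g \<longleftrightarrow> g \<in> RT0 \<and> (\<forall>v\<in>RT0. L2_inner K g v =
    boundary_integral K (\<lambda>F \<nu> x. snd u F * (v x \<bullet> \<nu>)) - L2_inner K (\<lambda>x. fst u K) (divergence v))" for g
  have rhs: "boundary_integral K (\<lambda>F \<nu> x. snd u F * ((a + b *\<^sub>R x) \<bullet> \<nu>))
      - L2_inner K (\<lambda>x. fst u K) (divergence (\<lambda>x. a + b *\<^sub>R x)) =
    boundary_flux K (snd u) a b - fst u K * (b * real CARD('n)) * ?m" for a b
    unfolding boundary_integral_RT0[OF K] divergence_RT0[abs_def] L2_inner_const boundary_flux_def by simp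
  define A where "A = (\<Sum>F | F facet_of K. (snd u F * facet_measure K F) *\<^sub>R outward_normal K F)"
  define B where "B = (\<Sum>F | F facet_of K. snd u F * facet_height K F * facet_measure K F) - fst u K * real CARD('n) * ?m"
  have lin: "boundary_flux K (snd u) a b - fst u K * (b * real CARD('n)) * ?m = a \<bullet> A + b * B" for a b
  proof -
    have "boundary_flux K (snd u) a b = a \<bullet> A + b * (\<Sum>F | F facet_of K. snd u F * facet_height K F * facet_measure K F)"
      unfolding boundary_flux_def A_def inner_sum_right sum_distrib_left sum.distrib[symmetric]
      by (rule sum.cong[OF refl]) (simp add: distrib_left distrib_right)
    then show ?thesis by (simp add: B_def right_diff_distrib)
  qed
  have "\<exists>!g. Q g"
  proof (rule ex_ex1I)
    \<comment> \<open>The coefficients come from writing the test field as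
      \<open>(a + b z) + b (x - z)\<close>: the functional \<open>a \<bullet> A + b * B\<close>
      equals \<open>(a + b z) \<bullet> A + b * (B - A \<bullet> z)\<close>, and the two parts are
      weighted by the volume and by \<open>s\<close>.\<close>
    define g where "g = (\<lambda>x. A /\<^sub>R ?m + ((B - A \<bullet> z) / s) *\<^sub>R (x - z))"
    have "Q g" unfolding Q_def
    proof (intro conjI ballI)
      show "g \<in> RT0" unfolding g_def by (rule RT0_memI)
      fix v :: "real ^ 'n \<Rightarrow> real ^ 'n" assume "v \<in> RT0"
      then obtain a b where v: "v = (\<lambda>x. a + b *\<^sub>R x)" by (auto simp: RT0_def)
      have v': "v = (\<lambda>x. (a + b *\<^sub>R z) + b *\<^sub>R (x - z))" by (auto simp: v algebra_simps)
      have "L2_inner K g v = ?m * ((A /\<^sub>R ?m) \<bullet> (a + b *\<^sub>R z)) + s * ((B - A \<bullet> z) / s * b)"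
        unfolding g_def v' z[rule_format] ..
      also have "s * ((B - A \<bullet> z) / s * b) = (B - A \<bullet> z) * b" using s by simp
      also have "?m * ((A /\<^sub>R ?m) \<bullet> (a + b *\<^sub>R z)) + (B - A \<bullet> z) * b = a \<bullet> A + b * B" using m
        by (simp add: inner_add_right inner_commute[of a] algebra_simps)
      finally show "L2_inner K g v = boundary_integral K (\<lambda>F \<nu> x. snd u F * (v x \<bullet> \<nu>)) - L2_inner K (\<lambda>x. fst u K) (divergence v)"
        unfolding v rhs lin .
    qed
    then show "\<exists>g. Q g" by (rule exI[where P = Q])
  next
    fix g h assume gh: "Q g" "Q h"
    obtain a b where g: "g = (\<lambda>x. a + b *\<^sub>R (x - z))" by (rule RT0_centered[OF gh(1)[unfolded Q_def, THEN conjunct1]])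
    obtain a' b' where h: "h = (\<lambda>x. a' + b' *\<^sub>R (x - z))" by (rule RT0_centered[OF gh(2)[unfolded Q_def, THEN conjunct1]])
    have eq: "L2_inner K g v = L2_inner K h v" if "v \<in> RT0" for v using gh that unfolding Q_def by simp
    have "?m * (a \<bullet> e) + s * (b * f) = ?m * (a' \<bullet> e) + s * (b' * f)" for e f
      using eq[OF RT0_memI(2)[of e f z]] unfolding g h z[rule_format] .
    from this[of "a - a'" 0] this[of 0 1] have "?m * ((a - a') \<bullet> (a - a')) = 0" "s * b = s * b'"
      by (auto simp: inner_diff_left inner_diff_right algebra_simps)
    then show "g = h" using m s by (auto simp: g h)
  qed
  from theI'[OF this] have Q: "Q (weak_grad K u)" unfolding weak_grad_def Q_def .
  then show "weak_grad K u \<in> RT0" by (simp add: Q_def)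
  have "L2_inner K (weak_grad K u) (\<lambda>x. a + b *\<^sub>R x) =
    boundary_integral K (\<lambda>F \<nu> x. snd u F * ((a + b *\<^sub>R x) \<bullet> \<nu>)) - L2_inner K (\<lambda>x. fst u K) (divergence (\<lambda>x. a + b *\<^sub>R x))"
    using Q RT0_memI(1)[of a b] unfolding Q_def by blast
  then show "L2_inner K (weak_grad K u) (\<lambda>x. a + b *\<^sub>R x) =
      boundary_flux K (snd u) a b - fst u K * (b * real CARD('n)) * measure lebesgue K" unfolding rhs .
qed

section \<open>Injectivity of the weak gradient\<close>

lemma weak_grad_null:
  fixes K :: "(real ^ 'n) set"
  assumes K: "int CARD('n) simplex K" and 0: "L2_inner K (weak_grad K u) (weak_grad K u) = 0"
  shows "boundary_flux K (snd u) a b = fst u K * (b * real CARD('n)) * measure lebesgue K"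
  using weak_grad(2)[OF K, of u a b] L2_inner_RT0_eq_0[OF K weak_grad(1)[OF K] 0]
  by (simp add: L2_inner_def)

text \<open>Test with \<open>x - v\<close>, where \<open>v\<close> is the vertex opposite to \<open>F\<close>: all other facets contain \<open>v\<close>, so
  they carry no flux.\<close>

lemma boundary_flux_single_facet:
  fixes K :: "(real ^ 'n) set"
  assumes K: "int CARD('n) simplex K" and F: "F facet_of K"
  obtains c a where "0 < c" "\<forall>w. boundary_flux K w a 1 = w F * c"
proof -
  obtain C where C: "finite C" "\<not> affine_dependent C" "K = convex hull C"
    using K by (auto simp: simplex)
  obtain v where v: "v \<in> C" "F = convex hull (C - {v})" and "F \<noteq> {}"
    using F facet_of_convex_hull_affine_independent[OF C(2)] unfolding C(3) by blast
  obtain y where y: "y \<in> F" using \<open>F \<noteq> {}\<close> by auto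
  have vK: "v \<in> K" using v C by (simp add: hull_inc)
  let ?N = "outward_normal K"
  have other: "- v \<bullet> ?N G + 1 * facet_height K G = 0" if G: "G facet_of K" "G \<noteq> F" for G
  proof -
    obtain u where "u \<in> C" "G = convex hull (C - {u})"
      using G facet_of_convex_hull_affine_independent[OF C(2)] unfolding C(3) by blast
    moreover from this have "u \<noteq> v" using v(2) G(2) by auto
    ultimately have "v \<in> G" using v(1) by (simp add: hull_inc)
    then show ?thesis using facet_height[OF K G(1)] by (simp add: inner_commute)
  qed
  \<comment> \<open>Otherwise \<open>v\<close> would lie in the hyperplane of \<open>F\<close>
    together with all other vertices, and \<open>K\<close> would be flat.\<close>
  have "?N F \<bullet> v < ?N F \<bullet> y"
  proof (rule ccontr)
    assume "\<not> ?N F \<bullet> v < ?N F \<bullet> y"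
    then have "?N F \<bullet> v = ?N F \<bullet> y" using outward_normal(2)[OF K F vK y] by simp
    moreover have "?N F \<bullet> x = ?N F \<bullet> y" if "x \<in> C" "x \<noteq> v" for x
      by (rule outward_normal_const[OF K F _ y]) (use that v(2) in \<open>simp add: hull_inc\<close>)
    ultimately have "C \<subseteq> {x. ?N F \<bullet> x = ?N F \<bullet> y}" by auto
    then have "K \<subseteq> {x. ?N F \<bullet> x = ?N F \<bullet> y}"
      unfolding C(3) by (rule hull_minimal) (rule convex_hyperplane)
    moreover obtain z where "z \<in> interior K" using full_simplex(5)[OF K] by auto
    ultimately show False using outward_normal_interior[OF K F _ y] interior_subset by fastforce
  qed
  then have pos: "0 < - v \<bullet> ?N F + 1 * facet_height K F"
    using facet_height[OF K F y] by (simp add: inner_commute)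
  have fin: "finite {F. F facet_of K}"
    using finite_polyhedron_facets[OF full_simplex(3)[OF K]] .
  show thesis
  proof (rule that)
    show "0 < (- v \<bullet> ?N F + 1 * facet_height K F) * facet_measure K F"
      using pos facet_measure_pos[OF K F] by simp
    have "boundary_flux K w (- v) 1 = w F * ((- v \<bullet> ?N F + 1 * facet_height K F) * facet_measure K F)" for w
    proof -
    have "boundary_flux K w (- v) 1 = (\<Sum>G | G facet_of K. if G = F then w F * (- v \<bullet> ?N F + 1 * facet_height K F) * facet_measure K F else 0)"
      unfolding boundary_flux_def by (rule sum.cong[OF refl]) (use other in auto)
    also have "\<dots> = w F * ((- v \<bullet> ?N F + 1 * facet_height K F) * facet_measure K F)"
      using fin F by simp
    finally show ?thesis .
    qed
    then show "\<forall>w. boundary_flux K w (- v) 1 = w F * ((- v \<bullet> ?N F + 1 * facet_height K F) * facet_measure K F)" by blast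
  qed
qed

text \<open>The test field that sees only \<open>F\<close> turns the balance into one equation
  between the value on \<open>F\<close> and the value on \<open>K\<close>. Positivity of the factor
  lets the sign of \<open>u\<close> pass from an element to its facets and so to its
  neighbours.\<close>

lemma balanced_facet_value:
  fixes K :: "(real ^ 'n) set" and u :: "('n, real) weak_fun"
  assumes K: "int CARD('n) simplex K" and F: "F facet_of K"
    and bal: "\<And>a b. boundary_flux K (snd u) a b = fst u K * (b * real CARD('n)) * measure lebesgue K"
  obtains c where "0 < c" "snd u F = fst u K * c"
proof -
  obtain c a where c: "0 < c" "\<forall>w. boundary_flux K w a 1 = w F * c"
    by (rule boundary_flux_single_facet[OF K F])
  have "snd u F * c = fst u K * real CARD('n) * measure lebesgue K"
    using bal[of a 1] c(2) by simp
  then have "snd u F = fst u K * (real CARD('n) * measure lebesgue K / c)"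
    using c(1) by (simp add: field_simps)
  moreover have "0 < real CARD('n) * measure lebesgue K / c" using full_simplex(6)[OF K] c(1) by simp
  ultimately show thesis by (rule that[rotated])
qed

text \<open>The elements on which \<open>u\<close> is positive have positive facet values, so they form a set closed
  under passing to neighbours. Testing with the field \<open>x\<close>, the fluxes over this set cancel in pairs,
  while the volume terms are all positive.\<close>

lemma balanced_nonpos:
  fixes \<Omega> :: "(real ^ 'n) set" and u :: "('n, real) weak_fun"
  assumes mesh: "simplicial_mesh \<Omega> T" and "open \<Omega>" and u: "u \<in> weak_space0 \<Omega> T"
    and bal: "\<And>K a b. K \<in> T \<Longrightarrow>
      boundary_flux K (snd u) a b = fst u K * (b * real CARD('n)) * measure lebesgue K"
    and K: "K \<in> T"
  shows "fst u K \<le> 0"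
proof (rule ccontr)
  assume "\<not> fst u K \<le> 0"
  note m = simplicial_meshD[OF mesh]
  define X where "X = {K \<in> T. 0 < fst u K}"
  have "K \<in> X" using \<open>\<not> fst u K \<le> 0\<close> K by (simp add: X_def)
  have finX: "finite X" using m(1) by (simp add: X_def)
  define Z where "Z = (SIGMA K:X. {F. F facet_of K})"
  define f where "f = (\<lambda>(K, F). snd u F * facet_height K F * facet_measure K F)"
  have sign: "0 < snd u F \<longleftrightarrow> 0 < fst u K" if KF: "K \<in> T" "F facet_of K" for K F
  proof -
    obtain c where "0 < c" "snd u F = fst u K * c"
      by (rule balanced_facet_value[OF m(2)[OF KF(1)] KF(2) bal[OF KF(1)]])
    then show ?thesis by (simp add: zero_less_mult_iff)
  qed
  define nb where "nb K F = (SOME K'. K' \<in> T \<and> K' \<noteq> K \<and> F facet_of K')" for K F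
  have nb: "nb K F \<in> X" "nb K F \<noteq> K" "F facet_of nb K F" if KF: "K \<in> X" "F facet_of K" for K F
  proof -
    have "K \<in> T" "0 < snd u F" using KF sign by (auto simp: X_def)
    \<comment> \<open>Weak functions in the space vanish off the interior facets, so a positive
      facet value guarantees a neighbour.\<close>
    then have "F \<in> interior_facets \<Omega> T" using u unfolding weak_space0_def by force
    then have "\<exists>K'. K' \<in> T \<and> K' \<noteq> K \<and> F facet_of K'"
      using neighbour_exists[OF mesh \<open>open \<Omega>\<close> \<open>K \<in> T\<close> KF(2)] by blast
    from someI_ex[OF this] have *: "nb K F \<in> T \<and> nb K F \<noteq> K \<and> F facet_of nb K F" unfolding nb_def .
    then show "nb K F \<in> X" "nb K F \<noteq> K" "F facet_of nb K F"
      using sign[of "nb K F" F] \<open>0 < snd u F\<close> by (auto simp: X_def)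
  qed
  \<comment> \<open>Crossing the facet is an involution on the pairs in \<open>Z\<close>. It flips
    the sign of \<open>f\<close>, since \<open>facet_height\<close> changes sign with the normal
    while \<open>facet_measure\<close> does not.\<close>
  define \<phi> where "\<phi> = (\<lambda>(K, F). (nb K F, F))"
  have "sum f Z = (\<Sum>p\<in>Z. - f p)"
  proof (rule sum.reindex_bij_witness[of _ \<phi> \<phi>])
    fix p assume "p \<in> Z"
    then obtain K F where p: "p = (K, F)" "K \<in> X" "F facet_of K" by (auto simp: Z_def)
    note n = nb[OF p(2,3)]
    have "nb (nb K F) F = K"
      by (rule neighbour_unique[OF mesh, of "nb K F" F])
        (use n p nb[OF n(1,3)] in \<open>auto simp: X_def\<close>)
    then show "\<phi> (\<phi> p) = p" "\<phi> (\<phi> p) = p" by (auto simp: \<phi>_def p)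
    show "\<phi> p \<in> Z" "\<phi> p \<in> Z" using n by (auto simp: \<phi>_def p Z_def)
    have T: "K \<in> T" "nb K F \<in> T" using p(2) n(1) by (auto simp: X_def)
    have opp: "outward_normal (nb K F) F = - outward_normal K F"
      by (rule opposite_normals[OF mesh T(1) p(3) T(2) n(3) n(2)[symmetric]])
    show "- f (\<phi> p) = f p"
      by (simp add: f_def \<phi>_def p facet_height_def facet_measure_def opp measure_prism_uminus)
  qed
  then have "sum f Z = 0" by (simp add: sum_negf)
  moreover have "sum f Z = (\<Sum>K\<in>X. boundary_flux K (snd u) 0 1)"
    unfolding Z_def f_def boundary_flux_def
    by (subst sum.Sigma[symmetric])
      (use finX m(2) in \<open>auto simp: X_def intro!: finite_polyhedron_facets simplex_imp_polyhedron\<close>)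
  moreover have "(\<Sum>K\<in>X. boundary_flux K (snd u) 0 1) = (\<Sum>K\<in>X. fst u K * real CARD('n) * measure lebesgue K)"
    by (rule sum.cong[OF refl]) (use bal in \<open>auto simp: X_def\<close>)
  moreover have "0 < (\<Sum>K\<in>X. fst u K * real CARD('n) * measure lebesgue K)"
    by (rule sum_pos) (use finX \<open>K \<in> X\<close> full_simplex(6)[OF m(2)] in \<open>auto simp: X_def\<close>)
  ultimately show False by simp
qed

text \<open>Each facet value is a multiple of an element value, hence zero. This is the form that
  suits the pressure, where the mass term supplies the vanishing element values.\<close>

lemma weak_space0_eq_0:
  fixes \<Omega> :: "(real ^ 'n) set" and u :: "('n, real) weak_fun"
  assumes mesh: "simplicial_mesh \<Omega> T" and u: "u \<in> weak_space0 \<Omega> T"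
    and grad: "\<And>K. K \<in> T \<Longrightarrow> L2_inner K (weak_grad K u) (weak_grad K u) = 0"
    and 0: "\<And>K. K \<in> T \<Longrightarrow> fst u K = 0"
  shows "u = (\<lambda>_. 0, \<lambda>_. 0)"
proof -
  note m = simplicial_meshD[OF mesh]
  have "fst u K = 0" for K using u 0 unfolding weak_space0_def by blast
  moreover have "snd u F = 0" for F
  proof (cases "F \<in> interior_facets \<Omega> T")
    case True
    then obtain K where K: "K \<in> T" "F facet_of K" by (auto simp: interior_facets_def mesh_facets_def)
    obtain c where "0 < c" "snd u F = fst u K * c"
      by (rule balanced_facet_value[OF m(2)[OF K(1)] K(2) weak_grad_null[OF m(2)[OF K(1)] grad[OF K(1)]]])
    then show ?thesis using 0[OF K(1)] by simp
  next
    case False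
    then show ?thesis using u unfolding weak_space0_def by blast
  qed
  ultimately show ?thesis by (auto simp: prod_eq_iff)
qed

text \<open>The balance is linear, so \<open>balanced_nonpos\<close> applies to \<open>u\<close> and
  to \<open>- u\<close> and leaves only zero element values. Applied to each component, this gives
  the definiteness of the form of \<open>A1\<close>.\<close>

lemma weak_grad_injective:
  fixes \<Omega> :: "(real ^ 'n) set" and u :: "('n, real) weak_fun"
  assumes mesh: "simplicial_mesh \<Omega> T" and "open \<Omega>" and u: "u \<in> weak_space0 \<Omega> T"
    and grad: "\<And>K. K \<in> T \<Longrightarrow> L2_inner K (weak_grad K u) (weak_grad K u) = 0"
  shows "u = (\<lambda>_. 0, \<lambda>_. 0)"
proof (rule weak_space0_eq_0[OF mesh u grad])
  note m = simplicial_meshD[OF mesh]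
  fix K assume K: "K \<in> T"
  have bal: "boundary_flux K (snd u) a b = fst u K * (b * real CARD('n)) * measure lebesgue K"
    if "K \<in> T" for K a b by (rule weak_grad_null[OF m(2)[OF that] grad[OF that]])
  have "fst u K \<le> 0" by (rule balanced_nonpos[OF mesh \<open>open \<Omega>\<close> u bal K])
  moreover have "fst (\<lambda>K. - fst u K, \<lambda>F. - snd u F) K \<le> 0"
  proof (rule balanced_nonpos[OF mesh \<open>open \<Omega>\<close> _ _ K])
    show "(\<lambda>K. - fst u K, \<lambda>F. - snd u F) \<in> weak_space0 \<Omega> T" using u by (simp add: weak_space0_def)
    fix K a b assume "K \<in> T"
    have "boundary_flux K (\<lambda>F. - snd u F) a b = - boundary_flux K (snd u) a b"
      by (simp add: boundary_flux_def sum_negf)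
    then show "boundary_flux K (snd (\<lambda>K. - fst u K, \<lambda>F. - snd u F)) a b =
      fst (\<lambda>K. - fst u K, \<lambda>F. - snd u F) K * (b * real CARD('n)) * measure lebesgue K"
      using bal[OF \<open>K \<in> T\<close>] by simp
  qed
  ultimately show "fst u K = 0" by simp
qed

lemma L2_inner_weak_grad_vec:
  fixes K :: "(real ^ 'n) set"
  assumes K: "int CARD('n) simplex K"
  shows "L2_inner K (weak_grad_vec K u) (weak_grad_vec K v) =
    (\<Sum>i\<in>UNIV. L2_inner K (weak_grad K (weak_component i u)) (weak_grad K (weak_component i v)))"
proof -
  have int: "set_integrable lebesgue K (\<lambda>x. weak_grad K p x \<bullet> weak_grad K q x)" for p q
  proof (rule set_integrable_continuous[OF full_simplex(1)[OF K]])
    have "continuous_on K (weak_grad K p)" for p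
    proof -
      obtain a b where "weak_grad K p = (\<lambda>x. a + b *\<^sub>R x)" using weak_grad(1)[OF K, of p] by (auto simp: RT0_def)
      then show ?thesis by (auto intro!: continuous_intros)
    qed
    then show "continuous_on K (\<lambda>x. weak_grad K p x \<bullet> weak_grad K q x)" by (intro continuous_intros)
  qed
  show ?thesis
    unfolding L2_inner_def set_lebesgue_integral_def weak_grad_vec_def
    by (subst Bochner_Integration.integral_sum[symmetric])
      (use int in \<open>auto simp: set_integrable_def inner_vec_def[where 'a = "real ^ 'n"] sum_distrib_left\<close>)
qed


section \<open>Degrees of freedom and the convergence bound\<close>

lemma exists_map_eq:
  assumes "distinct xs" "length ys = length xs"
  shows "\<exists>f. map f xs = ys"
proof (intro exI)
  show "map (the \<circ> map_of (zip xs ys)) xs = ys"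
    by (rule nth_equalityI) (simp_all add: assms map_of_zip_nth[OF assms(2)[symmetric] assms(1)])
qed

lemma exists_map_append_eq:
  assumes "distinct xs" "distinct ys" "length zs = length xs + length ys"
  shows "\<exists>f g. map f xs @ map g ys = zs"
proof -
  obtain f where "map f xs = take (length xs) zs"
    using exists_map_eq[OF assms(1), of "take (length xs) zs"] assms(3) by auto
  moreover obtain g where "map g ys = drop (length xs) zs"
    using exists_map_eq[OF assms(2), of "drop (length xs) zs"] assms(3) by auto
  ultimately show ?thesis by (metis append_take_drop_id)
qed

lemma concat_map_product: "concat (map (\<lambda>x. map (\<lambda>y. h x y) ys) xs) = map (\<lambda>(x, y). h x y) (List.product xs ys)"
  by (induction xs) auto

lemma scalar_dofs_carrier: "scalar_dofs Ks Fs p \<in> carrier_vec (length Ks + length Fs)"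
  by (rule carrier_vecI) (simp add: scalar_dofs_def)

lemma vector_dofs_carrier:
  fixes cs :: "'n::finite list"
  assumes "distinct cs" "set cs = UNIV"
  shows "vector_dofs cs Ks Fs u \<in> carrier_vec (CARD('n) * (length Ks + length Fs))"
proof -
  have "length cs = CARD('n)" using distinct_card[OF assms(1)] assms(2) by simp
  then have "dim_vec (vector_dofs cs Ks Fs u) = CARD('n) * (length Ks + length Fs)"
    unfolding vector_dofs_def concat_map_product
    by (simp add: length_product distrib_left mult.commute del: vec_of_list_map)
  then show ?thesis by (rule carrier_vecI)
qed

text \<open>The matrices are specified only through their values on vectors of degrees of freedom.
  Surjectivity, here and for vector-valued functions, lets these values speak for all coordinate
  vectors.\<close>

lemma scalar_dofs_surj:
  assumes "distinct Ks" "set Ks = T" "distinct Fs" "set Fs = interior_facets \<Omega> T"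
    and y: "y \<in> carrier_vec (length Ks + length Fs)"
  shows "\<exists>p\<in>weak_space0 \<Omega> T. scalar_dofs Ks Fs p = y"
proof -
  obtain f g where fg: "map f Ks @ map g Fs = list_of_vec y"
    using exists_map_append_eq[OF assms(1,3), of "list_of_vec y"] y by auto
  define p where "p = (\<lambda>K. if K \<in> T then f K else 0, \<lambda>F. if F \<in> interior_facets \<Omega> T then g F else 0)"
  have "p \<in> weak_space0 \<Omega> T" by (simp add: p_def weak_space0_def)
  moreover have "scalar_dofs Ks Fs p = y"
  proof -
    have eq: "map (\<lambda>K. fst p K) Ks @ map (\<lambda>F. snd p F) Fs = list_of_vec y"
      using assms(2,4) unfolding fg[symmetric] p_def by auto
    show ?thesis unfolding scalar_dofs_def eq by (rule vec_list)
  qed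
  ultimately show ?thesis by blast
qed

lemma vector_dofs_surj:
  fixes cs :: "'n::finite list"
  assumes cs: "distinct cs" "set cs = UNIV"
    and "distinct Ks" "set Ks = T" "distinct Fs" "set Fs = interior_facets \<Omega> T"
    and y: "y \<in> carrier_vec (CARD('n) * (length Ks + length Fs))"
  shows "\<exists>u\<in>weak_space0 \<Omega> T. vector_dofs cs Ks Fs u = y"
proof -
  have "length cs = CARD('n)" using distinct_card[OF cs(1)] cs(2) by simp
  then obtain f g where fg: "map f (List.product Ks cs) @ map g (List.product Fs cs) = list_of_vec y"
    using exists_map_append_eq[of "List.product Ks cs" "List.product Fs cs" "list_of_vec y"] y assms
    by (auto simp: distinct_product length_product algebra_simps)
  define u :: "('n, real ^ 'n) weak_fun" where "u = (\<lambda>K. if K \<in> T then \<chi> c. f (K, c) else 0,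
    \<lambda>F. if F \<in> interior_facets \<Omega> T then \<chi> c. g (F, c) else 0)"
  have "u \<in> weak_space0 \<Omega> T" by (simp add: u_def weak_space0_def)
  moreover have "vector_dofs cs Ks Fs u = y"
  proof -
    have eq: "map (\<lambda>(K, c). fst u K $ c) (List.product Ks cs) @ map (\<lambda>(F, c). snd u F $ c) (List.product Fs cs) = list_of_vec y"
      using assms(4,6) unfolding fg[symmetric] u_def by auto
    show ?thesis unfolding vector_dofs_def concat_map_product eq by (rule vec_list)
  qed
  ultimately show ?thesis by blast
qed

lemma vec_of_list_replicate_0: "vec_of_list (replicate n 0) = (0\<^sub>v n :: 'a::zero Matrix.vec)"
proof (rule eq_vecI)
  fix i assume i: "i < dim_vec (0\<^sub>v n :: 'a Matrix.vec)"
  then have "i < n" by simp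
  then show "vec_index (vec_of_list (replicate n 0)) i = vec_index (0\<^sub>v n :: 'a Matrix.vec) i"
    by (simp only: vec_of_list_index nth_replicate index_zero_vec)
qed simp

lemma scalar_dofs_zero: "scalar_dofs Ks Fs (\<lambda>_. 0, \<lambda>_. 0) = 0\<^sub>v (length Ks + length Fs)"
  unfolding scalar_dofs_def fst_conv snd_conv map_replicate_const replicate_add[symmetric]
  by (rule vec_of_list_replicate_0)

lemma vector_dofs_zero:
  fixes cs :: "'n::finite list"
  assumes "distinct cs" "set cs = UNIV"
  shows "vector_dofs cs Ks Fs (\<lambda>_. 0, \<lambda>_. 0) = 0\<^sub>v (CARD('n) * (length Ks + length Fs))"
proof -
  let ?L = "List.product Ks cs" and ?M = "List.product Fs cs"
  have eq: "map (\<lambda>_. 0) ?L @ map (\<lambda>_. 0) ?M = replicate (length ?L + length ?M) (0::real)"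
    unfolding map_replicate_const replicate_add ..
  have "vector_dofs cs Ks Fs (\<lambda>_. 0, \<lambda>_. 0) = 0\<^sub>v (length ?L + length ?M)"
    unfolding vector_dofs_def concat_map_product fst_conv snd_conv zero_index case_prod_unfold eq
    by (rule vec_of_list_replicate_0)
  moreover have "length ?L + length ?M = CARD('n) * (length Ks + length Fs)"
    using distinct_card[OF assms(1)] assms(2) by (simp add: length_product algebra_simps)
  ultimately show ?thesis by simp
qed

text \<open>The form \<open>a\<close> lives on \<open>U\<close> only. Lifting unit vectors by
  \<open>surj\<close> yields symmetry entry by entry; lifting arbitrary vectors yields
  positivity.\<close>

lemma sym_pos_def_of_form:
  assumes A: "A \<in> carrier_mat n n"
    and surj: "\<And>x. x \<in> carrier_vec n \<Longrightarrow> \<exists>u\<in>U. \<phi> u = x"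
    and form: "\<And>u v. u \<in> U \<Longrightarrow> v \<in> U \<Longrightarrow> scalar_prod (\<phi> v) (A *\<^sub>v \<phi> u) = a u v"
    and sym: "\<And>u v. u \<in> U \<Longrightarrow> v \<in> U \<Longrightarrow> a u v = a v u"
    and pos: "\<And>u. u \<in> U \<Longrightarrow> \<phi> u \<noteq> 0\<^sub>v n \<Longrightarrow> 0 < a u u"
  shows "sym_pos_def A"
proof -
  have entry: "A $$ (i, j) = scalar_prod (unit_vec n i) (A *\<^sub>v unit_vec n j)" if "i < n" "j < n" for i j
    using A that by simp
  have "A $$ (i, j) = A $$ (j, i)" if "i < n" "j < n" for i j
  proof -
    obtain u where u: "u \<in> U" "\<phi> u = unit_vec n i" using surj[of "unit_vec n i"] by auto
    obtain v where v: "v \<in> U" "\<phi> v = unit_vec n j" using surj[of "unit_vec n j"] by auto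
    show ?thesis
      unfolding entry[OF that] entry[OF that(2,1)]
      using form[OF v(1) u(1)] form[OF u(1) v(1)] sym[OF u(1) v(1)] u v by simp
  qed
  then have "transpose_mat A = A" using A by (intro eq_matI) auto
  moreover have "0 < scalar_prod x (A *\<^sub>v x)" if "x \<in> carrier_vec n" "x \<noteq> 0\<^sub>v n" for x
    using surj[OF that(1)] that(2) form pos by metis
  ultimately show ?thesis using A by (auto simp: sym_pos_def_def)
qed

lemma weak_component_space0: "u \<in> weak_space0 \<Omega> T \<Longrightarrow> weak_component i u \<in> weak_space0 \<Omega> T"
  by (simp add: weak_space0_def weak_component_def)

text \<open>The root of the weight is split between the two factors. In the application the weights
  are the element volumes, the functions being constant on each element.\<close>

lemma weighted_Cauchy_Schwarz_sum:
  fixes m f g :: "'a \<Rightarrow> real"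
  assumes "\<And>i. i \<in> I \<Longrightarrow> 0 \<le> m i"
  shows "(\<Sum>i\<in>I. f i * g i * m i)\<^sup>2 \<le> (\<Sum>i\<in>I. f i * f i * m i) * (\<Sum>i\<in>I. g i * g i * m i)"
proof -
  have eq: "(\<Sum>i\<in>I. (sqrt (m i) * x i) * (sqrt (m i) * y i)) = (\<Sum>i\<in>I. x i * y i * m i)" for x y
  proof (rule sum.cong[OF refl])
    fix i assume "i \<in> I"
    have "(sqrt (m i) * x i) * (sqrt (m i) * y i) = (sqrt (m i) * sqrt (m i)) * (x i * y i)" by (simp only: ac_simps)
    then show "(sqrt (m i) * x i) * (sqrt (m i) * y i) = x i * y i * m i" using assms[OF \<open>i \<in> I\<close>] by simp
  qed
  have "(\<Sum>i\<in>I. (sqrt (m i) * f i) * (sqrt (m i) * g i))\<^sup>2 \<le>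
    (\<Sum>i\<in>I. (sqrt (m i) * f i)\<^sup>2) * (\<Sum>i\<in>I. (sqrt (m i) * g i)\<^sup>2)"
    by (rule Cauchy_Schwarz_ineq_sum)
  then show ?thesis unfolding power2_eq_square[of "sqrt _ * _"] eq .
qed

theorem proposition4p1:
  fixes \<Omega> :: "(real ^ 'n) set" and T :: "(real ^ 'n) set set" and \<sigma> :: real
    and Ks Fs :: "(real ^ 'n) set list" and cs :: "'n list"
    and lam \<mu> \<epsilon> \<alpha> c0 \<kappa> \<Delta>t :: real
    and A1 A0 B D S P \<A> M :: "real Matrix.mat"
    and b x0 :: "real Matrix.vec" and r :: "nat \<Rightarrow> real Matrix.vec" and nV nW k :: nat
  assumes "lipschitz_domain \<Omega>" and "simplicial_mesh \<Omega> T" and "quasi_uniform \<sigma> T"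
    and Ks: "distinct Ks" "set Ks = T"
    and Fs: "distinct Fs" "set Fs = interior_facets \<Omega> T"
    and cs: "distinct cs" "set cs = UNIV"
    and "lam > 0" "\<mu> > 0" "\<alpha> > 0" "c0 > 0" "\<kappa> > 0" "\<Delta>t > 0"
    and \<epsilon>: "\<epsilon> = \<mu> / (lam + \<mu>)"
    and nV: "nV = CARD('n) * (length Ks + length Fs)"
    and nW: "nW = length Ks + length Fs"
    and A1: "A1 \<in> carrier_mat nV nV"
      "\<And>u v. u \<in> weak_space0 \<Omega> T \<Longrightarrow> v \<in> weak_space0 \<Omega> T \<Longrightarrow>
         scalar_prod (vector_dofs cs Ks Fs v) (A1 *\<^sub>v vector_dofs cs Ks Fs u) =
         (\<Sum>K\<in>T. L2_inner K (weak_grad_vec K u) (weak_grad_vec K v))"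
    and A0: "A0 \<in> carrier_mat nV nV"
      "\<And>u v. u \<in> weak_space0 \<Omega> T \<Longrightarrow> v \<in> weak_space0 \<Omega> T \<Longrightarrow>
         scalar_prod (vector_dofs cs Ks Fs v) (A0 *\<^sub>v vector_dofs cs Ks Fs u) =
         (\<Sum>K\<in>T. L2_inner K (\<lambda>x. weak_div K u) (\<lambda>x. weak_div K v))"
    and B: "B \<in> carrier_mat nW nV"
      "\<And>u q. u \<in> weak_space0 \<Omega> T \<Longrightarrow> q \<in> weak_space0 \<Omega> T \<Longrightarrow>
         scalar_prod (scalar_dofs Ks Fs q) (B *\<^sub>v vector_dofs cs Ks Fs u) =
         (\<Sum>K\<in>T. L2_inner K (\<lambda>x. weak_div K u) (\<lambda>x. fst q K))"
    and D: "D \<in> carrier_mat nW nW"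
      "\<And>p q. p \<in> weak_space0 \<Omega> T \<Longrightarrow> q \<in> weak_space0 \<Omega> T \<Longrightarrow>
         scalar_prod (scalar_dofs Ks Fs q) (D *\<^sub>v scalar_dofs Ks Fs p) =
         c0 * (\<Sum>K\<in>T. L2_inner K (\<lambda>x. fst p K) (\<lambda>x. fst q K)) +
         \<Delta>t * (\<Sum>K\<in>T. L2_inner K (\<lambda>x. \<kappa> *\<^sub>R weak_grad K p x) (weak_grad K q))"
    and \<A>: "\<A> = four_block_mat
                  (\<epsilon> \<cdot>\<^sub>m A1 + A0)             (- (\<alpha> * \<epsilon> / \<mu>) \<cdot>\<^sub>m transpose_mat B)
                  (- (\<alpha> * \<epsilon> / \<mu>) \<cdot>\<^sub>m B)     (- (\<epsilon> / \<mu>) \<cdot>\<^sub>m D)"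
    and S: "S = (\<epsilon> / \<mu>) \<cdot>\<^sub>m D"
    and P: "P = four_block_mat (\<epsilon> \<cdot>\<^sub>m A1 + A0) (0\<^sub>m nV nW) (0\<^sub>m nW nV) S"
    and M: "M = inv_sqrt_mat P * \<A> * inv_sqrt_mat P"
    and "b \<in> carrier_vec (nV + nW)" "x0 \<in> carrier_vec (nV + nW)"
    and r: "\<And>j. minres_residual M b x0 j (r j)"
    and "r 0 \<noteq> 0\<^sub>v (nV + nW)"
  shows "eucl_norm (r (2 * k)) / eucl_norm (r 0) \<le>
    2 * ((sqrt (1 + 1 / c0 * (\<alpha>\<^sup>2 * real CARD('n) / \<mu>)) - 1) /
         (sqrt (1 + 1 / c0 * (\<alpha>\<^sup>2 * real CARD('n) / \<mu>)) + 1)) ^ k"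
proof -
  note mesh = \<open>simplicial_mesh \<Omega> T\<close>
  note m = simplicial_meshD[OF mesh]
  have "open \<Omega>" using \<open>lipschitz_domain \<Omega>\<close> by (simp add: lipschitz_domain_def)
  have eps: "0 < \<epsilon>" "\<epsilon> < 1" using \<open>lam > 0\<close> \<open>\<mu> > 0\<close> by (auto simp: \<epsilon>)
  let ?V = "weak_space0 \<Omega> T :: ('n, real ^ 'n) weak_fun set"
  let ?W = "weak_space0 \<Omega> T :: ('n, real) weak_fun set"
  let ?\<phi> = "vector_dofs cs Ks Fs" and ?\<psi> = "scalar_dofs Ks Fs"
  have \<phi>: "?\<phi> u \<in> carrier_vec nV" for u unfolding nV by (rule vector_dofs_carrier[OF cs])
  have \<psi>: "?\<psi> p \<in> carrier_vec nW" for p unfolding nW by (rule scalar_dofs_carrier)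
  have surjV: "\<exists>u\<in>?V. ?\<phi> u = x" if "x \<in> carrier_vec nV" for x
    using vector_dofs_surj[OF cs Ks Fs] that unfolding nV by blast
  have surjW: "\<exists>p\<in>?W. ?\<psi> p = x" if "x \<in> carrier_vec nW" for x
    using scalar_dofs_surj[OF Ks Fs] that unfolding nW by blast
  define G where "G u v = (\<Sum>K\<in>T. L2_inner K (weak_grad_vec K u) (weak_grad_vec K v))" for u v
  define E where "E u v = (\<Sum>K\<in>T. L2_inner K (\<lambda>x. weak_div K u) (\<lambda>x. weak_div K v))" for u v
  define I where "I p q = (\<Sum>K\<in>T. L2_inner K (\<lambda>x. fst p K) (\<lambda>x. fst q K))" for p q :: "('n, real) weak_fun"
  define J where "J p q = (\<Sum>K\<in>T. L2_inner K (weak_grad K p) (weak_grad K q))" for p q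
  have sym: "G u v = G v u" "E u v = E v u" "I p q = I q p" "J p q = J q p" for u v p q
    by (simp_all add: G_def E_def I_def J_def L2_inner_commute)
  have nonneg: "0 \<le> G u u" "0 \<le> E u u" "0 \<le> I p p" "0 \<le> J p p" for u p
    by (simp_all add: G_def E_def I_def J_def L2_inner_nonneg sum_nonneg)

  define H where "H = \<epsilon> \<cdot>\<^sub>m A1 + A0"
  have H: "H \<in> carrier_mat nV nV" using A1(1) A0(1) by (simp add: H_def)
  have smv: "(k \<cdot>\<^sub>m X) *\<^sub>v x = k \<cdot>\<^sub>v (X *\<^sub>v x)" if "X \<in> carrier_mat i j" "x \<in> carrier_vec j"
    for X :: "real Matrix.mat" and x k i j
    using that by (intro eq_vecI) auto
  have Hform: "scalar_prod (?\<phi> v) (H *\<^sub>v ?\<phi> u) = \<epsilon> * G u v + E u v" if "u \<in> ?V" "v \<in> ?V" for u v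
  proof -
    have "H *\<^sub>v ?\<phi> u = \<epsilon> \<cdot>\<^sub>v (A1 *\<^sub>v ?\<phi> u) + A0 *\<^sub>v ?\<phi> u"
      unfolding H_def smv[OF A1(1) \<phi>, symmetric]
      by (rule add_mult_distrib_mat_vec[OF _ A0(1) \<phi>]) (use A1(1) in simp)
    then have "scalar_prod (?\<phi> v) (H *\<^sub>v ?\<phi> u) =
      \<epsilon> * scalar_prod (?\<phi> v) (A1 *\<^sub>v ?\<phi> u) + scalar_prod (?\<phi> v) (A0 *\<^sub>v ?\<phi> u)"
      using A1(1) A0(1) \<phi>[of u] \<phi>[of v]
      by (simp add: scalar_prod_add_distrib[of _ nV] scalar_prod_smult_distrib[of _ nV])
    then show ?thesis using A1(2)[OF that] A0(2)[OF that] by (simp add: G_def E_def)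
  qed
  have Hspd: "sym_pos_def H"
  proof (rule sym_pos_def_of_form[OF H surjV Hform])
    fix u :: "('n, real ^ 'n) weak_fun" assume u: "u \<in> ?V" "?\<phi> u \<noteq> 0\<^sub>v nV"
    \<comment> \<open>\<open>E\<close> sees facet values only, so strict positivity has to come from
      the gradient form \<open>G\<close>.\<close>
    have "G u u \<noteq> 0"
    proof
      assume "G u u = 0"
      then have "L2_inner K (weak_grad_vec K u) (weak_grad_vec K u) = 0" if "K \<in> T" for K
        using that m(1) by (simp add: G_def sum_nonneg_eq_0_iff L2_inner_nonneg)
      then have "L2_inner K (weak_grad K (weak_component i u)) (weak_grad K (weak_component i u)) = 0"
        if "K \<in> T" for K i
        using that L2_inner_weak_grad_vec[OF m(2)[OF that], of u u]
        by (simp add: sum_nonneg_eq_0_iff L2_inner_nonneg)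
      then have "weak_component i u = (\<lambda>_. 0, \<lambda>_. 0)" for i
        by (rule weak_grad_injective[OF mesh \<open>open \<Omega>\<close> weak_component_space0[OF u(1)]])
      then have "fst u K $ i = 0" "snd u F $ i = 0" for K F i
        by (auto simp: weak_component_def fun_eq_iff)
      then have "u = (\<lambda>_. 0, \<lambda>_. 0)" by (simp add: prod_eq_iff fun_eq_iff Finite_Cartesian_Product.vec_eq_iff)
      then show False using u(2) by (simp add: nV vector_dofs_zero[OF cs])
    qed
    then show "0 < \<epsilon> * G u u + E u u" using nonneg(1,2)[of u] eps(1) by (simp add: add_pos_nonneg)
  qed (use sym in simp_all)

  have Sc: "S \<in> carrier_mat nW nW" using D(1) by (simp add: S)
  have Sform: "scalar_prod (?\<psi> q) (S *\<^sub>v ?\<psi> p) = \<epsilon> / \<mu> * (c0 * I p q + \<Delta>t * (\<kappa> * J p q))"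
    if "p \<in> ?W" "q \<in> ?W" for p q
  proof -
    have "(\<Sum>K\<in>T. L2_inner K (\<lambda>x. \<kappa> *\<^sub>R weak_grad K p x) (weak_grad K q)) = \<kappa> * J p q"
      by (simp add: J_def L2_inner_def sum_distrib_left)
    moreover have "scalar_prod (?\<psi> q) (S *\<^sub>v ?\<psi> p) = \<epsilon> / \<mu> * scalar_prod (?\<psi> q) (D *\<^sub>v ?\<psi> p)"
      unfolding S smv[OF D(1) \<psi>] by (rule scalar_prod_smult_right) (use D(1) \<psi>[of q] in auto)
    ultimately show ?thesis using D(2)[OF that] by (simp add: I_def)
  qed
  have Sspd: "sym_pos_def S"
  proof (rule sym_pos_def_of_form[OF Sc surjW Sform])
    fix p :: "('n, real) weak_fun" assume p: "p \<in> ?W" "?\<psi> p \<noteq> 0\<^sub>v nW"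
    \<comment> \<open>\<open>I\<close> controls the element values, and \<open>J\<close> then
      settles the facet values; both enter \<open>S\<close> with positive factors.\<close>
    have "\<not> (I p p = 0 \<and> J p p = 0)"
    proof
      assume 0: "I p p = 0 \<and> J p p = 0"
      have "p = (\<lambda>_. 0, \<lambda>_. 0)"
      proof (rule weak_space0_eq_0[OF mesh p(1)])
        fix K assume K: "K \<in> T"
        show "L2_inner K (weak_grad K p) (weak_grad K p) = 0"
          using 0 K m(1) by (simp add: J_def sum_nonneg_eq_0_iff L2_inner_nonneg)
        have "L2_inner K (\<lambda>x. fst p K) (\<lambda>x. fst p K) = 0"
          using 0 K m(1) by (simp add: I_def sum_nonneg_eq_0_iff L2_inner_nonneg)
        then show "fst p K = 0" using full_simplex(6)[OF m(2)[OF K]] by (simp add: L2_inner_const)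
      qed
      then show False using p(2) by (simp add: nW scalar_dofs_zero)
    qed
    then have "0 < I p p \<or> 0 < J p p" using nonneg(3,4)[of p] by linarith
    then have "0 < c0 * I p p + \<Delta>t * (\<kappa> * J p p)"
      using nonneg(3,4)[of p] \<open>c0 > 0\<close> \<open>\<kappa> > 0\<close> \<open>\<Delta>t > 0\<close> by (auto intro: add_pos_nonneg add_nonneg_pos)
    then show "0 < \<epsilon> / \<mu> * (c0 * I p p + \<Delta>t * (\<kappa> * J p p))" using eps(1) \<open>\<mu> > 0\<close> by simp
  qed (use sym in simp_all)

  define \<beta> where "\<beta> = \<alpha> * \<epsilon> / \<mu>"
  \<comment> \<open>\<open>S\<close> dominates \<open>\<epsilon> / \<mu> * c0\<close> times the
    pressure mass form \<open>I\<close>; \<open>g\<close> is \<open>\<beta>\<^sup>2\<close> divided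
    by this factor.\<close>
  define g where "g = \<alpha>\<^sup>2 * \<epsilon> / (\<mu> * c0)"
  have g: "0 \<le> g" using eps(1) \<open>\<mu> > 0\<close> \<open>c0 > 0\<close> by (simp add: g_def)
  have coupling: "(\<beta> * scalar_prod q (B *\<^sub>v u))\<^sup>2 \<le> g * (scalar_prod u (H *\<^sub>v u) * scalar_prod q (S *\<^sub>v q))"
    if uq: "u \<in> carrier_vec nV" "q \<in> carrier_vec nW" for u q
  proof -
    obtain u' where u': "u' \<in> ?V" "?\<phi> u' = u" using surjV[OF uq(1)] by blast
    obtain q' where q': "q' \<in> ?W" "?\<psi> q' = q" using surjW[OF uq(2)] by blast
    have "scalar_prod q (B *\<^sub>v u) = (\<Sum>K\<in>T. weak_div K u' * fst q' K * measure lebesgue K)"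
      using B(2)[OF u'(1) q'(1)] by (simp add: u' q' L2_inner_const)
    \<comment> \<open>\<open>B\<close> pairs the weak divergence with the element values of the
      pressure. Their squared norms are \<open>E\<close>, which is dominated by \<open>H\<close>,
      and \<open>I\<close>, which is dominated by \<open>S\<close> up to a factor.\<close>
    then have "(scalar_prod q (B *\<^sub>v u))\<^sup>2 \<le> E u' u' * I q' q'"
      using weighted_Cauchy_Schwarz_sum[of T "measure lebesgue" "\<lambda>K. weak_div K u'" "fst q'"]
      by (simp add: E_def I_def L2_inner_const)
    also have "\<dots> \<le> scalar_prod u (H *\<^sub>v u) * I q' q'"
      using Hform[OF u'(1) u'(1)] nonneg(1,3) eps(1) by (intro mult_right_mono) (simp_all add: u')
    finally have 1: "(scalar_prod q (B *\<^sub>v u))\<^sup>2 \<le> scalar_prod u (H *\<^sub>v u) * I q' q'" .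
    have "\<epsilon> / \<mu> * (c0 * I q' q') \<le> scalar_prod q (S *\<^sub>v q)"
    proof -
      have "0 \<le> \<epsilon> / \<mu> * (\<Delta>t * (\<kappa> * J q' q'))"
        using nonneg(4) eps(1) \<open>\<mu> > 0\<close> \<open>\<kappa> > 0\<close> \<open>\<Delta>t > 0\<close> by simp
      then show ?thesis using Sform[OF q'(1) q'(1)] by (simp add: q' distrib_left)
    qed
    moreover have "0 \<le> scalar_prod u (H *\<^sub>v u)"
      using Hform[OF u'(1) u'(1)] nonneg(1,2)[of u'] eps(1) by (simp add: u')
    ultimately have 2: "g * (scalar_prod u (H *\<^sub>v u) * (\<epsilon> / \<mu> * (c0 * I q' q'))) \<le>
      g * (scalar_prod u (H *\<^sub>v u) * scalar_prod q (S *\<^sub>v q))"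
      using g by (intro mult_left_mono)
    have "(\<beta> * scalar_prod q (B *\<^sub>v u))\<^sup>2 \<le> \<beta>\<^sup>2 * (scalar_prod u (H *\<^sub>v u) * I q' q')"
      unfolding power_mult_distrib using 1 by (rule mult_left_mono) simp
    also have "\<beta>\<^sup>2 = g * (\<epsilon> / \<mu> * c0)"
      using \<open>\<mu> > 0\<close> \<open>c0 > 0\<close> by (simp add: \<beta>_def g_def power2_eq_square)
    also have "g * (\<epsilon> / \<mu> * c0) * (scalar_prod u (H *\<^sub>v u) * I q' q') =
      g * (scalar_prod u (H *\<^sub>v u) * (\<epsilon> / \<mu> * (c0 * I q' q')))" by (simp only: ac_simps)
    finally show ?thesis using 2 by linarith
  qed

  have P': "P = four_block_mat H (0\<^sub>m nV nW) (0\<^sub>m nW nV) S" by (simp add: P H_def)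
  have \<A>': "\<A> = four_block_mat H (- \<beta> \<cdot>\<^sub>m transpose_mat B) (- \<beta> \<cdot>\<^sub>m B) (- S)"
  proof -
    have "- (\<epsilon> / \<mu>) \<cdot>\<^sub>m D = - S" unfolding S by (intro eq_matI) auto
    then show ?thesis by (simp add: \<A> H_def \<beta>_def)
  qed
  have "\<forall>u\<in>carrier_vec nV. \<forall>q\<in>carrier_vec nW.
    (\<beta> * scalar_prod q (B *\<^sub>v u))\<^sup>2 \<le> g * (scalar_prod u (H *\<^sub>v u) * scalar_prod q (S *\<^sub>v q))"
    using coupling by blast
  note bounds = block_preconditioned_bounds[OF H Hspd Sc Sspd B(1) g this P' \<A>' M]
  define c where "c = 1 + 1 / c0 * (\<alpha>\<^sup>2 * real CARD('n) / \<mu>)"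
  have "1 < c" using \<open>\<alpha> > 0\<close> \<open>\<mu> > 0\<close> \<open>c0 > 0\<close> by (simp add: c_def)
  have "g \<le> c - 1"
  proof -
    have "1 \<le> real CARD('n)" by (simp add: Suc_le_eq)
    then have "\<epsilon> \<le> real CARD('n)" using eps(2) by linarith
    then have "\<alpha>\<^sup>2 * \<epsilon> / (\<mu> * c0) \<le> \<alpha>\<^sup>2 * real CARD('n) / (\<mu> * c0)"
      using \<open>\<mu> > 0\<close> \<open>c0 > 0\<close> by (intro divide_right_mono mult_left_mono) auto
    then show ?thesis by (simp add: g_def c_def mult.commute)
  qed
  have upper: "scalar_prod (M *\<^sub>v v) (M *\<^sub>v v) \<le> c * scalar_prod v v" if "v \<in> carrier_vec (nV + nW)" for v
  proof -
    have "(1 + g) * scalar_prod v v \<le> c * scalar_prod v v"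
      by (rule mult_right_mono) (use \<open>g \<le> c - 1\<close> in auto)
    then show ?thesis using bounds(4)[OF that] by linarith
  qed
  have "eucl_norm (r (2 * k)) \<le> 2 * ((sqrt c - 1) / (sqrt c + 1)) ^ k * eucl_norm (r 0)"
    by (rule minres_bound_even_step[OF bounds(1,2) \<open>b \<in> carrier_vec (nV + nW)\<close> \<open>x0 \<in> carrier_vec (nV + nW)\<close>
      r \<open>1 < c\<close> bounds(3) upper])
  moreover have "0 \<le> eucl_norm (r 0)" by (simp add: eucl_norm_def)
  moreover have "0 \<le> 2 * ((sqrt c - 1) / (sqrt c + 1)) ^ k" using \<open>1 < c\<close> by simp
  ultimately show ?thesis unfolding c_def[symmetric]
    by (cases "eucl_norm (r 0) = 0") (auto simp: divide_le_eq)
qed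

end
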